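(* Let $d\ge 1$ and let $2k_1,\dots,2k_r$ be $r$ (not necessarily different) multiplicities, i.e. $k_1,\dots,k_r\in\mathbb{N}\setminus\{0\}$. Let $J_r:=\{Y=(Y_1,\dots,Y_r)\in(\mathbb{Z}^d)^r : Y_1=0,\ Y_i\ne Y_j \text{ for } i\neq j\}$. Let $W_{2N}$ denote the set of closed walks $w$ on $\mathbb{Z}^d$ which start and end in $0$ and have $\mathrm{length}(w)\le 2N$. Then the moments of the distribution of $N_{2k}(w)$ are given by $$\sum_{w\in W_{2N}}P\big(N_{2k_1}(w),\dots,N_{2k_r}(w)\big)\,z^{\mathrm{length}(w)}=\frac1{r!}\,z\frac{\partial}{\partial z}\Bigg[\sum_{\sigma\in D(k_1,\dots,k_r)}\ \sum_{Y\in J_r}\ \sum_{h_1,\dots,h_r=1}^{\infty}\ \sum_{F\in H_r(h_1,\dots,h_r)}\mathrm{cof}(A-F)\Bigg(\prod_{1\le a,b\le r}\frac{h(Y_a-Y_b,d,z)^{F_{a,b}}}{(1+h(0,d,z))^{F_{a,b}}\,F_{a,b}!}\Bigg)\prod_{j=1}^r(-1)^{h_j}\,h_j!\,K\big(h_j,k_{\sigma(j)},h(0,d,z)\big)\Bigg]_{z\diamond 2N},$$ where $A=\mathrm{diag}(h_1,\dots,h_r)$ and the vertex factors $K$ are given by $$K(q,k,\omega):=\begin{cases}(-1)^k\,\dfrac1q\left(\dfrac1{1+\omega}\right)^k\displaystyle\sum_{\nu=\max(0,k-q)}^{k-1}\binom{k-1}{\nu}\binom{q}{k-\nu}(-\omega)^\nu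 & q>0,\\[2mm] \dfrac1k\left(\dfrac{\omega}{1+\omega}\right)^k & q=0.\end{cases}$$
   Context: Walks. A walk of length $n$ on $\mathbb{Z}^d$ is a pair $w=(p,s)$ with a starting point $p\in\mathbb{Z}^d$ and a sequence $s=(s_1,\dots,s_n)$ of steps $s_i\in\{\pm1,\dots,\pm d\}$. With $e_i$ the $i$-th unit vector and $e_{-i}:=-e_i$, its points are $p_0=p$, $p_i=p+\sum_{j=1}^i e_{s_j}$. It is closed if $p_n=p$. The multiplicity of $q\in\mathbb{Z}^d$ with respect to $w$ is $mu(q,w)=\delta_{q,p}+\delta_{q,p_n}+2\sum_{i=1}^{n-1}\delta_{q,p_i}$. For a closed walk $w$ and an integer $k\ge1$, $N_{2k}(w):=\#\{q\in\mathbb{Z}^d: mu(q,w)=2k\}$. Symbol $P$. For a family $(n_k)$ of nonnegative integers, $P(n_{k_1},\dots,n_{k_l})$ is the coefficient defined by $\prod_k(1+\lambda_k)^{n_k}=1+\sum_{l\ge1}\sum_{k_1\le\dots\le k_l}P(n_{k_1},\dots,n_{k_l})\prod_{j=1}^l\lambda_{k_j}$ (only finitely many of the variables $\lambda_k$ being nonzero), i.e. $P(n_{k_1},\dots,n_{k_l})=\prod_k\binom{n_k}{\#\{i:k_i=k\}}$; it is read symmetrically in the indices. Here $n_k=N_{2k}(w)$. Function $h$. For $p=(p^{(1)},\dots,p^{(d)})\in\mathbb{Z}^d$ and $|z|<\frac1{2d}$, $h(p,d,z):=-\delta_{p,0}+\int_0^\infty e^{-y}\prod_{\alpha=1}^d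 I_{|p^{(\alpha)}|}(2zy)\,dy$, with $I_\mu$ the modified Bessel function; in the formula it is used through its power series expansion in $z$ at $0$. Truncation. For a formal power series $g(z)=\sum_{n\ge0}a_nz^n$ and $k\in\mathbb{N}$, $(g(z))_{z\diamond k}:=\sum_{n=0}^k a_nz^n$. Because of this projection all sums in the formula are in fact finite. Permutations. $D(k_1,\dots,k_r)$ is the set of equivalence classes of permutations $\sigma\in S_r$ under $\sigma\sim\hat\sigma\iff k_{\sigma(i)}=k_{\hat\sigma(i)}$ for all $i=1,\dots,r$. Matrices. For $h_1,\dots,h_r\in\mathbb{N}\setminus\{0\}$, $H_r(h_1,\dots,h_r)$ is the set of $r\times r$ matrices $F$ with nonnegative integer entries such that $F_{j,j}=0$ and $\sum_{i=1}^rF_{i,j}=\sum_{i=1}^rF_{j,i}=h_j$ for all $j=1,\dots,r$. $\mathrm{cof}(A-F)$ is the cofactor of $A-F$, which is the same no matter which row and which column is erased.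
   Formalization: For r=1 the sum over h_1≥1 is replaced by the single term h_1=0 (with h_1≥1 the set H_1(h_1) is empty and the right side would be 0), and the walk of length 0 is left out of W_{2N}; it would add a constant 1 only for r=1, k_1=1, and contributes 0 otherwise. *)

theory Defs
  imports "HOL-Complex_Analysis.Complex_Analysis" "Jordan_Normal_Form.Determinant"
begin

subsection \<open>Walks\<close>

text \<open>The lattice is \<open>int ^ 'd\<close>, with dimension \<open>CARD('d) \<ge> 1\<close>; the step \<open>Pos a\<close> stands
  for the index \<open>a\<close> and \<open>Neg a\<close> for \<open>-a\<close>.\<close>

datatype 'd step = Pos 'd | Neg 'd

type_synonym 'd walk = "(int ^ 'd) \<times> 'd step list"

fun step_vec :: "'d step \<Rightarrow> int ^ 'd::finite" where
  "step_vec (Pos a) = axis a 1"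
| "step_vec (Neg a) = - axis a 1"

definition walk_length :: "'d walk \<Rightarrow> nat" where
  "walk_length w = length (snd w)"

definition walk_point :: "('d::finite) walk \<Rightarrow> nat \<Rightarrow> int ^ 'd" where
  "walk_point w i = fst w + (\<Sum>j<i. step_vec (snd w ! j))"

definition closed_walk :: "('d::finite) walk \<Rightarrow> bool" where
  "closed_walk w \<longleftrightarrow> walk_point w (walk_length w) = fst w"

definition mu :: "int ^ 'd \<Rightarrow> ('d::finite) walk \<Rightarrow> nat" where
  "mu q w = of_bool (q = fst w) + of_bool (q = walk_point w (walk_length w))
     + 2 * (\<Sum>i\<in>{1..<walk_length w}. of_bool (q = walk_point w i))"

text \<open>\<open>N2 k w\<close> is \<open>N\<^sub>2\<^sub>k(w)\<close>.\<close>

definition N2 :: "nat \<Rightarrow> ('d::finite) walk \<Rightarrow> nat" where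
  "N2 k w = card {q. mu q w = 2 * k}"

text \<open>The step sequence \<open>(s\<^sub>1, \<dots>, s\<^sub>n)\<close> of a walk is read as having \<open>n \<ge> 1\<close>. The walk without
  steps would matter only for a single multiplicity \<open>k\<^sub>1 = 1\<close>, where it would add \<open>1\<close> to a
  polynomial that the right-hand side, being a \<open>z\<close>-derivative times \<open>z\<close>, gives without constant
  term; for \<open>r \<ge> 2\<close> its contribution is zero, see \<open>P_no_steps\<close> below.\<close>

definition closed_walks_upto :: "nat \<Rightarrow> ('d::finite) walk set" where
  "closed_walks_upto n =
     {w. closed_walk w \<and> fst w = 0 \<and> 1 \<le> walk_length w \<and> walk_length w \<le> n}"

definition P :: "(nat \<Rightarrow> nat) \<Rightarrow> nat list \<Rightarrow> nat" where
  "P n ks = (\<Prod>k\<in>set ks. n k choose count_list ks k)"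

lemma P_no_steps:
  fixes p :: "int ^ ('d::finite)"
  assumes "2 \<le> length ks" and "\<forall>k\<in>set ks. 0 < k"
  shows "P (\<lambda>k. N2 k (p, [])) ks = 0"
proof -
  have N: "N2 k (p, []) = of_bool (k = 1)" if "0 < k" for k
  proof -
    have "{q. mu q (p, []) = 2 * k} = (if k = 1 then {p} else {})"
      using that by (auto simp: mu_def walk_point_def walk_length_def)
    then show ?thesis by (simp add: N2_def)
  qed
  have "\<exists>k\<in>set ks. (N2 k (p, []) choose count_list ks k) = 0"
  proof (cases "set ks \<subseteq> {1}")
    case True
    then have "count_list ks 1 = length ks"
      by (induction ks) auto
    moreover have "1 \<in> set ks"
      using True assms(1) by (cases ks) auto
    ultimately show ?thesis
      using assms by (intro bexI[of _ 1]) (auto simp: N binomial_eq_0)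
  next
    case False
    then obtain k where k: "k \<in> set ks" "k \<noteq> 1" by auto
    then have "0 < count_list ks k"
      by (simp add: count_list_0_iff zero_less_iff_neq_zero)
    then show ?thesis
      using k assms(2) by (intro bexI[of _ k]) (auto simp: N)
  qed
  then show ?thesis by (simp add: P_def)
qed

subsection \<open>The function \<open>h\<close> and its expansion\<close>

text \<open>The modified Bessel function of the first kind of integer order.\<close>

definition bessel_I :: "nat \<Rightarrow> complex \<Rightarrow> complex" where
  "bessel_I m x = (\<Sum>j. (x / 2) ^ (2 * j + m) / (fact j * fact (j + m)))"

definition h_fun :: "int ^ ('d::finite) \<Rightarrow> complex \<Rightarrow> complex" where
  "h_fun p z = - of_bool (p = 0)
     + (LBINT y:{0..}. of_real (exp (- y)) *
          (\<Prod>a\<in>UNIV. bessel_I (nat \<bar>vec_nth p a\<bar>) (2 * z * of_real y)))"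

definition h_series :: "int ^ ('d::finite) \<Rightarrow> complex fps" where
  "h_series p = fps_expansion (h_fun p) 0"

subsection \<open>Permutation classes, matrices and vertex factors\<close>

text \<open>Indices run over \<open>{..<r}\<close> with \<open>r = length ks\<close>.\<close>

definition perm_rel :: "nat list \<Rightarrow> ((nat \<Rightarrow> nat) \<times> (nat \<Rightarrow> nat)) set" where
  "perm_rel ks = {(\<sigma>, \<tau>). \<sigma> permutes {..<length ks} \<and> \<tau> permutes {..<length ks} \<and>
     (\<forall>i<length ks. ks ! \<sigma> i = ks ! \<tau> i)}"

definition D :: "nat list \<Rightarrow> (nat \<Rightarrow> nat) set set" where
  "D ks = {\<sigma>. \<sigma> permutes {..<length ks}} // perm_rel ks"

text \<open>The list \<open>map (\<lambda>j. ks ! \<sigma> j) [0..<length ks]\<close> is the same for all \<open>\<sigma>\<close> in one class.\<close>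

definition rep :: "(nat \<Rightarrow> nat) set \<Rightarrow> nat \<Rightarrow> nat" where
  "rep C = (SOME \<sigma>. \<sigma> \<in> C)"

definition J :: "nat \<Rightarrow> (int ^ ('d::finite)) list set" where
  "J r = {Y. length Y = r \<and> Y ! 0 = 0 \<and> distinct Y}"

text \<open>The range of \<open>(h\<^sub>1, \<dots>, h\<^sub>r)\<close>. For \<open>r = 1\<close> a matrix with zero diagonal has row sum \<open>0\<close>, so the
  only admissible value is \<open>h\<^sub>1 = 0\<close>; this is the case covered by \<open>K(0, k, \<omega>)\<close>.\<close>

definition orders :: "nat \<Rightarrow> nat list set" where
  "orders r = (if r = 1 then {[0]} else {hs. length hs = r \<and> (\<forall>h\<in>set hs. 1 \<le> h)})"

definition H :: "nat list \<Rightarrow> nat mat set" where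
  "H hs = {F \<in> carrier_mat (length hs) (length hs). \<forall>j<length hs.
     F $$ (j, j) = 0 \<and>
     (\<Sum>i<length hs. F $$ (i, j)) = hs ! j \<and> (\<Sum>i<length hs. F $$ (j, i)) = hs ! j}"

text \<open>All cofactors of \<open>A - F\<close> coincide; the one at \<open>(0, 0)\<close> is used. For \<open>r = 1\<close> it is the
  empty determinant, \<open>1\<close>.\<close>

definition cof :: "nat list \<Rightarrow> nat mat \<Rightarrow> int" where
  "cof hs F = cofactor (mat_diag (length hs) (\<lambda>j. int (hs ! j)) - map_mat int F) 0 0"

definition K :: "nat \<Rightarrow> nat \<Rightarrow> complex fps \<Rightarrow> complex fps" where
  "K q k \<omega> =
     (if q > 0
      then (-1) ^ k * fps_const (1 / of_nat q) * (1 / (1 + \<omega>)) ^ k *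
           (\<Sum>\<nu>\<in>{nat (max 0 (int k - int q))..k - 1}.
              of_nat ((k - 1) choose \<nu>) * of_nat (q choose (k - \<nu>)) * (- \<omega>) ^ \<nu>)
      else fps_const (1 / of_nat k) * (\<omega> / (1 + \<omega>)) ^ k)"

definition summand ::
  "nat list \<Rightarrow> (nat \<Rightarrow> nat) \<Rightarrow> (int ^ ('d::finite)) list \<Rightarrow> nat list \<Rightarrow> nat mat \<Rightarrow> complex fps" where
  "summand ks \<sigma> Y hs F = (let r = length ks; h0 = h_series (0 :: int ^ 'd) in
     of_int (cof hs F) *
     (\<Prod>a<r. \<Prod>b<r. h_series (Y ! a - Y ! b) ^ (F $$ (a, b)) /
        ((1 + h0) ^ (F $$ (a, b)) * of_nat (fact (F $$ (a, b))))) *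
     (\<Prod>j<r. (-1) ^ (hs ! j) * of_nat (fact (hs ! j)) * K (hs ! j) (ks ! \<sigma> j) h0))"

text \<open>The truncation \<open>(g)\<^bsub>z \<diamond> k\<^esub>\<close>, keeping the coefficients up to and including \<open>k\<close>.
  Infinite sums of power series are \<open>infsum\<close> for the metric of type \<open>fps\<close>, in which a family is
  summable iff each coefficient vanishes for all but finitely many members; the truncation of
  such a sum is a finite sum.\<close>

definition trunc :: "nat \<Rightarrow> complex fps \<Rightarrow> complex fps" where
  "trunc k g = fps_cutoff (Suc k) g"

end

theory Submission
  imports Defs "HOL-Probability.Distributions" "HOL-Combinatorics.Multiset_Permutations"
begin

text \<open>The coefficients of \<open>h\<close> count walks: \<open>h(p) = \<Sum>\<^sub>n\<^sub>\<ge>\<^sub>1 W\<^sub>n(p) z\<^sup>n\<close> with \<open>W\<^sub>n(p)\<close> the number of walks of length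
  \<open>n\<close> from \<open>0\<close> to \<open>p\<close>. Fix distinct points \<open>Y\<^sub>1, \<dots>, Y\<^sub>r\<close>. Marking \<open>l\<^sub>j\<close> of the visits to each \<open>Y\<^sub>j\<close>
  cuts a closed walk into free pieces, each contributing a factor \<open>h(Y\<^sub>b - Y\<^sub>a)\<close>, and moving the root
  of the walk to a marked visit to \<open>Y\<^sub>1\<close> produces the factor \<open>n / l\<^sub>1\<close>, hence the operator
  \<open>z d/dz\<close>. The cyclic sequences of marked points with given transition numbers \<open>G\<close> are
  Eulerian circuits, which the BEST theorem counts by a cofactor; this cofactor does not see the
  diagonal of \<open>G\<close>. Inclusion-exclusion turns marked visits into exact visit numbers, and
  summing over the diagonal of \<open>G\<close> yields the vertex factors \<open>K\<close>. Finally, translating \<open>Y\<^sub>1\<close>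
  to \<open>0\<close> trades the walks rooted at \<open>0\<close> for the tuples in \<open>J\<^sub>r\<close>.\<close>

subsection \<open>The function \<open>h\<close> counts walks\<close>

text \<open>The BEST theorem is obtained by comparing recursions: the series of marked walks and the
  determinant expression behave alike when the first edge of a trail is removed. For the recursion
  to close, the formula must cover open trails from \<open>u\<close> to \<open>0\<close> and
  vertices whose edges are used up; hence the unit rows in \<open>tree_mat\<close>. The vertex
  factor is likewise identified by a recursion, in \<open>k\<close>, after powers of 1 + \<omega>
  have been cleared. Infinite sums are controlled coefficient by coefficient. Since
  \<open>h_series\<close> has no constant term, at most \<open>n\<close> edges matter for the
  coefficient of z^n. Since the cofactor vanishes as soon as some vertices are not connected to
  vertex 0, the points of a contributing tuple stay near 0. The same vanishing removes orders with a
  zero entry for r >= 2: the sum over marks does produce them, but they lie outside the range of the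
  theorem.\<close>

lemma UNIV_step: "(UNIV :: 'd step set) = range Pos \<union> range Neg"
proof -
  have "s \<in> range Pos \<union> range Neg" for s :: "'d step" by (cases s) auto
  then show ?thesis by auto
qed

lemma finite_step [simp, intro]: "finite (A :: ('d::finite) step set)"
  by (rule finite_subset[OF subset_UNIV]) (simp add: UNIV_step)

lemma sum_step:
  "(\<Sum>s\<in>(UNIV :: ('d::finite) step set). f s) = (\<Sum>a\<in>UNIV. f (Pos a) + f (Neg a))"
proof -
  have "(\<Sum>s\<in>(UNIV :: 'd step set). f s) = sum f (range Pos) + sum f (range Neg)"
    unfolding UNIV_step by (rule sum.union_disjoint) auto
  also have "sum f (range Pos) = (\<Sum>a\<in>UNIV. f (Pos a))"
    by (subst sum.reindex) (auto simp: inj_on_def)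
  also have "sum f (range Neg) = (\<Sum>a\<in>UNIV. f (Neg a))"
    by (subst sum.reindex) (auto simp: inj_on_def)
  finally show ?thesis by (simp add: sum.distrib)
qed

lemma card_step: "card (UNIV :: ('d::finite) step set) = 2 * CARD('d)"
  using sum_step[of "\<lambda>_ :: 'd step. 1 :: nat"] by simp

section \<open>Numbers of walks with given length and displacement\<close>

abbreviation displacement :: "('d::finite) step list \<Rightarrow> int ^ 'd" where
  "displacement ss \<equiv> sum_list (map step_vec ss)"

lemma finite_step_lists [simp, intro]: "finite {ss :: ('d::finite) step list. length ss = n \<and> Q ss}"
  by (rule finite_subset[OF _ finite_lists_length_eq[of "UNIV :: 'd step set" n]]) auto

lemma sum_step_lists_Suc:
  "(\<Sum>ss\<in>{ss :: ('d::finite) step list. length ss = Suc n \<and> Q ss}. f ss) =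
     (\<Sum>s\<in>UNIV. \<Sum>ss\<in>{ss. length ss = n \<and> Q (s # ss)}. f (s # ss))"
proof -
  have "(\<Sum>s\<in>(UNIV :: 'd step set). \<Sum>ss\<in>{ss. length ss = n \<and> Q (s # ss)}. f (s # ss)) =
      (\<Sum>(s, ss)\<in>(SIGMA s:UNIV. {ss. length ss = n \<and> Q (s # ss)}). f (s # ss))"
    by (rule sum.Sigma) auto
  also have "\<dots> = (\<Sum>ss\<in>{ss. length ss = Suc n \<and> Q ss}. f ss)"
    by (rule sum.reindex_bij_witness[of _ "\<lambda>ss. (hd ss, tl ss)" "\<lambda>(s, ss). s # ss"])
       (auto simp: length_Suc_conv)
  finally show ?thesis by simp
qed

definition num_walks :: "nat \<Rightarrow> int ^ ('d::finite) \<Rightarrow> nat" where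
  "num_walks n p = card {ss. length ss = n \<and> displacement ss = p}"

lemma num_walks_0: "num_walks 0 (p :: int ^ ('d::finite)) = of_bool (p = 0)"
proof -
  have "{ss :: 'd step list. length ss = 0 \<and> displacement ss = p} = (if p = 0 then {[]} else {})"
    by auto
  then show ?thesis by (simp add: num_walks_def)
qed

lemma num_walks_Suc: "num_walks (Suc n) (p :: int ^ ('d::finite)) = (\<Sum>s\<in>UNIV. num_walks n (p - step_vec s))"
  using sum_step_lists_Suc[where n = n and Q = "\<lambda>ss. displacement ss = p" and f = "\<lambda>_. 1 :: nat"]
  by (simp add: num_walks_def algebra_simps eq_diff_eq)

lemma num_walks_le: "num_walks n (p :: int ^ ('d::finite)) \<le> (2 * CARD('d)) ^ n"
proof (induction n arbitrary: p)
  case (Suc n)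
  have "num_walks (Suc n) p \<le> (\<Sum>s\<in>(UNIV :: 'd step set). (2 * CARD('d)) ^ n)"
    unfolding num_walks_Suc by (intro sum_mono Suc)
  then show ?case by (simp add: card_step)
qed (simp add: num_walks_0)

text \<open>The series of \<open>I\<^sub>m(2x)\<close> for an integer order \<open>m\<close>, written so that the recurrence
  \<open>d/dx I\<^sub>m(2x) = I\<^sub>m\<^sub>-\<^sub>1(2x) + I\<^sub>m\<^sub>+\<^sub>1(2x)\<close> is Pascal's rule.\<close>

definition bessel_fps :: "int \<Rightarrow> complex fps" where
  "bessel_fps m = Abs_fps (\<lambda>n. if 0 \<le> int n + m \<and> even (int n + m)
     then of_nat (n choose nat ((int n + m) div 2)) / fact n else 0)"

lemma bessel_fps_nth:
  assumes "int n + m = 2 * int k"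
  shows "bessel_fps m $ n = of_nat (n choose k) / fact n"
  unfolding bessel_fps_def fps_nth_Abs_fps assms by simp

lemma fps_deriv_bessel: "fps_deriv (bessel_fps m) = bessel_fps (m - 1) + bessel_fps (m + 1)"
proof (rule fps_ext)
  fix n
  show "fps_deriv (bessel_fps m) $ n = (bessel_fps (m - 1) + bessel_fps (m + 1)) $ n"
  proof (cases "0 \<le> int n + m + 1 \<and> even (int n + m + 1)")
    case True
    then obtain i :: int where i: "int n + m + 1 = 2 * i" "0 \<le> i"
      by (metis dvdE zero_le_mult_iff not_numeral_le_zero zero_less_numeral)
    then obtain j where j: "int n + m + 1 = 2 * int j" using nonneg_int_cases by metis
    have e: "(1 + (m + int n)) div 2 = int j" "(1 + (int n + m)) div 2 = int j" using j by auto
    show ?thesis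
    proof (cases j)
      case 0
      \<comment> \<open>The boundary of Pascal's rule: \<open>bessel_fps (m - 1)\<close> has no
        coefficient at \<open>n\<close>, and only the binomial with lower index 0 remains.\<close>
      then have m: "m = - int n - 1" using j by simp
      have "fact n + fact n * complex_of_nat n = fact (Suc n)" by (simp add: algebra_simps)
      then have nz: "fact n + fact n * complex_of_nat n \<noteq> 0" by (metis fact_nonzero)
      show ?thesis
        by (auto simp: bessel_fps_def m field_simps) (use nz in blast)
    next
      case (Suc k)
      then have "int (Suc n) + m = 2 * int (Suc k)" "int n + (m - 1) = 2 * int k"
        "int n + (m + 1) = 2 * int (Suc k)" using j by auto
      then have "bessel_fps m $ Suc n = of_nat (Suc n choose Suc k) / fact (Suc n)"
        "bessel_fps (m - 1) $ n = of_nat (n choose k) / fact n"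
        "bessel_fps (m + 1) $ n = of_nat (n choose Suc k) / fact n"
        by (simp_all only: bessel_fps_nth)
      then show ?thesis
        by (simp add: add_divide_distrib distrib_left del: of_nat_Suc)
    qed
  next
    case False
    then have "\<not> (0 \<le> int n + (m - 1) \<and> even (int n + (m - 1)))" by auto
    then show ?thesis using False by (auto simp: bessel_fps_def algebra_simps)
  qed
qed

lemma norm_bessel_fps_le: "norm (bessel_fps m $ n) \<le> 2 ^ n / fact n"
proof -
  have "real (n choose k) \<le> 2 ^ n" for k
    using binomial_le_pow2[of n k] by (metis of_nat_le_iff of_nat_numeral of_nat_power)
  then show ?thesis
    by (auto simp: bessel_fps_def norm_divide divide_right_mono)
qed

lemma fps_conv_radius_bessel [simp]: "fps_conv_radius (bessel_fps m) = \<infinity>"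
  unfolding fps_conv_radius_def
proof (rule conv_radius_inftyI'')
  fix z :: complex
  have s: "summable (\<lambda>n. (2 * norm z) ^ n / fact n)"
    using summable_exp_generic[of "2 * norm z"] by (simp add: scaleR_conv_of_real field_simps)
  show "summable (\<lambda>n. bessel_fps m $ n * z ^ n)"
  proof (rule summable_comparison_test'[OF s])
    fix n
    show "norm (bessel_fps m $ n * z ^ n) \<le> (2 * norm z) ^ n / fact n"
      using mult_right_mono[OF norm_bessel_fps_le[of m n], of "norm z ^ n"]
      by (simp add: norm_mult norm_power power_mult_distrib)
  qed
qed

text \<open>The coefficients live on n = 2 j + |m|. For \<open>m = k\<close> the lower index of the
  binomial is \<open>j + k\<close>, for \<open>m = - k\<close> it is \<open>j\<close>; both give n!
  / (j! (j + k)!), so only the absolute value of the order matters.\<close>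

lemma eval_bessel_fps: "eval_fps (bessel_fps m) x = bessel_I (nat \<bar>m\<bar>) (2 * x)"
proof -
  let ?k = "nat \<bar>m\<bar>"
  let ?f = "\<lambda>n. bessel_fps m $ n * x ^ n"
  have "?f sums eval_fps (bessel_fps m) x"
    unfolding eval_fps_def by (intro summable_sums summable_fps) simp
  moreover have "?f n = 0" if "n \<notin> range (\<lambda>j. 2 * j + ?k)" for n
  proof (rule ccontr)
    assume "?f n \<noteq> 0"
    then have a: "0 \<le> int n + m" "even (int n + m)" "nat ((int n + m) div 2) \<le> n"
      by (auto simp: bessel_fps_def binomial_eq_0_iff not_less split: if_splits)
    then obtain i where "int n + m = 2 * i" by blast
    then have "n = 2 * nat (i - max 0 m) + ?k"
      using a by (cases "m \<ge> 0") auto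
    then show False using that by blast
  qed
  ultimately have "(\<lambda>j. ?f (2 * j + ?k)) sums eval_fps (bessel_fps m) x"
    by (subst sums_mono_reindex) (auto simp: strict_mono_def)
  moreover have "?f (2 * j + ?k) = x ^ (2 * j + ?k) / (fact j * fact (j + ?k))" for j
  proof (cases "m \<ge> 0")
    case True
    then obtain k where k: "m = int k" using nonneg_int_cases by blast
    define n where "n = 2 * j + k"
    have n: "int n + int k = 2 * int (j + k)" by (simp add: n_def)
    have c: "complex_of_nat (n choose (j + k)) = fact n / (fact (j + k) * fact j)"
      by (subst binomial_fact) (auto simp: n_def)
    have "fps_nth (bessel_fps (int k)) n = of_nat (n choose (j + k)) / fact n"
      by (rule bessel_fps_nth[OF n])
    then have "fps_nth (bessel_fps (int k)) n * x ^ n = x ^ n / (fact j * fact (j + k))"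
      by (simp add: c)
    then show ?thesis by (simp only: k n_def nat_int abs_of_nat)
  next
    case False
    then obtain k where k: "m = - int k" by (metis nonpos_int_cases nle_le)
    define n where "n = 2 * j + k"
    have n: "int n + - int k = 2 * int j" by (simp add: n_def)
    have c: "complex_of_nat (n choose j) = fact n / (fact j * fact (j + k))"
      by (subst binomial_fact) (auto simp: n_def algebra_simps)
    have "fps_nth (bessel_fps (- int k)) n = of_nat (n choose j) / fact n"
      by (rule bessel_fps_nth[OF n])
    then have "fps_nth (bessel_fps (- int k)) n * x ^ n = x ^ n / (fact j * fact (j + k))"
      by (simp add: c)
    then show ?thesis by (simp only: k n_def nat_int abs_of_nat abs_minus_cancel)
  qed
  ultimately show ?thesis
    by (simp add: bessel_I_def sums_iff)
qed

lemma fps_deriv_prod: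
  fixes f :: "'b \<Rightarrow> ('a :: comm_ring_1) fps"
  assumes "finite S"
  shows "fps_deriv (\<Prod>a\<in>S. f a) = (\<Sum>a\<in>S. fps_deriv (f a) * (\<Prod>b\<in>S - {a}. f b))"
  using assms
proof (induction S rule: finite_induct)
  case (insert x S)
  have "(\<Sum>a\<in>S. fps_deriv (f a) * (\<Prod>b\<in>insert x S - {a}. f b)) =
      (\<Sum>a\<in>S. f x * (fps_deriv (f a) * (\<Prod>b\<in>S - {a}. f b)))"
  proof (rule sum.cong)
    fix a assume "a \<in> S"
    then have "insert x S - {a} = insert x (S - {a})" using insert by auto
    then show "fps_deriv (f a) * (\<Prod>b\<in>insert x S - {a}. f b) =
        f x * (fps_deriv (f a) * (\<Prod>b\<in>S - {a}. f b))"
      using insert by (simp add: algebra_simps)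
  qed simp
  then show ?case
    using insert by (simp add: sum_distrib_left algebra_simps)
qed simp

lemma fps_nth_0_prod: "(\<Prod>a\<in>S. f a) $ 0 = (\<Prod>a\<in>S. (f a :: 'a :: comm_ring_1 fps) $ 0)"
  by (induction S rule: infinite_finite_induct) auto

text \<open>Differentiation moves the index of one factor by one in either direction, so the
  coefficients times \<open>fact n\<close> satisfy the recurrence of \<open>num_walks_Suc\<close>.
  The product is the exponential generating function of the walks.\<close>

lemma prod_bessel_fps_nth:
  "(\<Prod>a\<in>(UNIV :: 'd::finite set). bessel_fps (vec_nth (p :: int ^ 'd) a)) $ n = of_nat (num_walks n p) / fact n"
proof (induction n arbitrary: p)
  case 0
  have "bessel_fps m $ 0 = of_bool (m = 0)" for m
    by (auto simp: bessel_fps_def binomial_eq_0_iff elim!: evenE)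
  then have "(\<Prod>a\<in>(UNIV :: 'd set). bessel_fps (vec_nth p a)) $ 0 = (\<Prod>a\<in>UNIV. of_bool (vec_nth p a = 0))"
    by (simp add: fps_nth_0_prod)
  also have "\<dots> = of_bool (p = 0)"
    using Finite_Cartesian_Product.vec_eq_iff[of p 0] by auto
  finally show ?case by (simp add: num_walks_0)
next
  case (Suc n)
  let ?F = "\<lambda>p. \<Prod>a\<in>(UNIV :: 'd set). bessel_fps (vec_nth p a)"
  have upd: "?F (p + axis a c) = bessel_fps (vec_nth p a + c) * (\<Prod>b\<in>UNIV - {a}. bessel_fps (vec_nth p b))" for p :: "int ^ 'd" and a c
    by (subst prod.remove[of _ a]) (auto simp: axis_def intro!: prod.cong)
  have "fps_deriv (?F p) = (\<Sum>a\<in>UNIV. ?F (p + axis a (-1)) + ?F (p + axis a 1))"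
    by (simp only: fps_deriv_prod[OF finite] fps_deriv_bessel upd ring_distribs) simp
  also have "\<dots> = (\<Sum>s\<in>UNIV. ?F (p - step_vec s))"
  proof -
    have "axis a (-1) = - axis a (1 :: int)" for a :: 'd by (simp add: axis_def Finite_Cartesian_Product.vec_eq_iff)
    then show ?thesis by (simp add: sum_step)
  qed
  finally have "fps_deriv (?F p) $ n = (\<Sum>s\<in>UNIV. of_nat (num_walks n (p - step_vec s)) / fact n)"
    by (simp add: fps_sum_nth flip: Suc)
  also have "\<dots> = of_nat (num_walks (Suc n) p) / fact n"
    by (simp add: num_walks_Suc sum_divide_distrib)
  finally show ?case by (simp add: field_simps del: of_nat_Suc)
qed

lemma eval_prod_bessel_fps:
  assumes "finite S"
  shows "fps_conv_radius (\<Prod>a\<in>S. bessel_fps (f a)) = \<infinity> \<and>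
    eval_fps (\<Prod>a\<in>S. bessel_fps (f a)) x = (\<Prod>a\<in>S. bessel_I (nat \<bar>f a\<bar>) (2 * x))"
  using assms
proof (induction S rule: finite_induct)
  case (insert a S)
  have "fps_conv_radius (bessel_fps (f a) * (\<Prod>a\<in>S. bessel_fps (f a))) = \<infinity>"
    using fps_conv_radius_mult[of "bessel_fps (f a)" "\<Prod>a\<in>S. bessel_fps (f a)"] insert by simp
  then show ?case using insert by (simp add: eval_fps_mult eval_bessel_fps)
qed simp

section \<open>Termwise integration of the Bessel product\<close>

lemma power_times_exp_integral:
  "has_bochner_integral lborel (\<lambda>y. indicator {0..} y * (y ^ n * exp (- y))) (fact n :: real)"
proof (rule has_bochner_integral_nn_integral)
  have "(\<integral>\<^sup>+ y. ennreal (indicator {0..} y * (y ^ n * exp (- y))) \<partial>lborel) =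
     (\<integral>\<^sup>+ y. ennreal (y ^ n * exp (- y)) * indicator {0..} y \<partial>lborel)"
    by (intro nn_integral_cong) (auto simp: indicator_def)
  then show "(\<integral>\<^sup>+ y. ennreal (indicator {0..} y * (y ^ n * exp (- y))) \<partial>lborel) = ennreal (fact n)"
    by (simp add: nn_intergal_power_times_exp_Ici)
qed (auto simp: indicator_def intro!: AE_I2)

text \<open>The lattice Green function; it exceeds \<open>h_series\<close> only by the walk without
  steps.\<close>

definition green :: "int ^ ('d::finite) \<Rightarrow> complex fps" where
  "green p = Abs_fps (\<lambda>n. of_nat (num_walks n p))"

text \<open>The weight exp(-y) integrates y^n to n!, which turns the exponential generating function
  of the walks into the ordinary one. The bound \<open>num_walks_le\<close> gives a geometric
  majorant of ratio 2d|z| < 1, so sum and integral may be exchanged.\<close>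

lemma h_integral_sums:
  fixes p :: "int ^ ('d::finite)"
  assumes "norm z < 1 / (2 * real CARD('d))"
  shows "(\<lambda>n. of_nat (num_walks n p) * z ^ n) sums
     (LBINT y:{0..}. of_real (exp (- y)) *
          (\<Prod>a\<in>UNIV. bessel_I (nat \<bar>vec_nth p a\<bar>) (2 * z * of_real y)))"
proof -
  define c :: "nat \<Rightarrow> complex" where "c n = of_nat (num_walks n p) / fact n" for n
  define g where "g n y = (indicator {0..} y * (y ^ n * exp (- y)) :: real)" for n y
  define f where "f n y = c n * z ^ n * complex_of_real (g n y)" for n y
  have prod: "(\<lambda>n. c n * x ^ n) sums (\<Prod>a\<in>UNIV. bessel_I (nat \<bar>vec_nth p a\<bar>) (2 * x))"
    and abs: "summable (\<lambda>n. norm (c n * x ^ n))" for x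
  proof -
    let ?F = "\<Prod>a\<in>(UNIV :: 'd set). bessel_fps (vec_nth p a)"
    note E = eval_prod_bessel_fps[of "UNIV :: 'd set" "\<lambda>a. vec_nth p a" x]
    have "(\<lambda>n. ?F $ n * x ^ n) sums eval_fps ?F x"
      unfolding eval_fps_def by (intro summable_sums summable_fps) (use E in simp)
    then show "(\<lambda>n. c n * x ^ n) sums (\<Prod>a\<in>UNIV. bessel_I (nat \<bar>vec_nth p a\<bar>) (2 * x))"
      using E by (simp add: prod_bessel_fps_nth c_def)
    show "summable (\<lambda>n. norm (c n * x ^ n))"
      using norm_summable_fps[of x ?F] E by (simp add: prod_bessel_fps_nth c_def)
  qed
  have g: "integrable lborel (g n)" "integral\<^sup>L lborel (g n) = fact n" for n
    using power_times_exp_integral[of n] unfolding g_def has_bochner_integral_iff by auto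
  have f: "integrable lborel (f n)" for n
    unfolding f_def by (intro integrable_mult_right integrable_of_real g)
  have int_f: "integral\<^sup>L lborel (f n) = of_nat (num_walks n p) * z ^ n" for n
    unfolding f_def using g by (simp add: c_def)
  have norm_f: "norm (f n y) = norm (c n) * norm z ^ n * g n y" for n y
    by (auto simp: f_def norm_mult norm_power g_def indicator_def)
  have f_eq: "f n y = indicator {0..} y *\<^sub>R (of_real (exp (- y)) * (c n * (z * of_real y) ^ n))" for n y
    by (auto simp: f_def g_def indicator_def power_mult_distrib)
  have "(\<lambda>n. integral\<^sup>L lborel (f n)) sums (\<integral>y. (\<Sum>n. f n y) \<partial>lborel)"
  proof (rule sums_integral[OF f])
    have "summable (\<lambda>n. norm (f n y))" for y
      using summable_mult[OF abs[of "z * of_real y"], of "indicator {0..} y * exp (- y)"]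
      by (simp add: f_eq norm_mult mult.assoc)
    then show "AE y in lborel. summable (\<lambda>n. norm (f n y))" by simp
    have s: "summable (\<lambda>n. (2 * CARD('d) * norm z) ^ n)"
      using assms by (intro summable_geometric) (auto simp: field_simps)
    show "summable (\<lambda>n. \<integral>y. norm (f n y) \<partial>lborel)"
    proof (rule summable_comparison_test'[OF s])
      fix n
      have "(\<integral>y. norm (f n y) \<partial>lborel) = real (num_walks n p) * norm z ^ n"
        unfolding norm_f using g by (simp add: c_def norm_divide)
      also have "\<dots> \<le> real ((2 * CARD('d)) ^ n) * norm z ^ n"
        by (intro mult_right_mono) (use num_walks_le[of n p] of_nat_le_iff in \<open>blast, simp\<close>)
      finally show "norm (\<integral>y. norm (f n y) \<partial>lborel) \<le> (2 * CARD('d) * norm z) ^ n"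
        by (simp add: power_mult_distrib)
    qed
  qed
  moreover have "(\<Sum>n. f n y) = indicator {0..} y *\<^sub>R (of_real (exp (- y)) *
      (\<Prod>a\<in>UNIV. bessel_I (nat \<bar>vec_nth p a\<bar>) (2 * z * of_real y)))" for y
    unfolding f_eq
    using sums_scaleR_right[OF sums_mult[OF prod[of "z * of_real y"], of "of_real (exp (- y))"],
      of "indicator {0..} y"]
    by (simp add: sums_iff mult.assoc)
  ultimately show ?thesis
    by (simp add: int_f set_lebesgue_integral_def)
qed

text \<open>On the disc |z| < 1/(2d) the integral agrees with a convergent power series, and the
  expansion at 0 is determined by the values near 0.\<close>

lemma h_series_eq:
  fixes p :: "int ^ ('d::finite)"
  shows "h_series p = green p - of_bool (p = 0)"
  unfolding h_series_def
proof (rule fps_expansion_eqI)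
  let ?R = "1 / (2 * real CARD('d))"
  define F where "F = green p"
  have s: "summable (\<lambda>n. F $ n * z ^ n)" if "norm z < ?R" for z
    using h_integral_sums[OF that, of p] by (auto simp: F_def green_def sums_iff)
  have "fps_conv_radius F \<ge> ?R"
    unfolding fps_conv_radius_def
  proof (rule conv_radius_geI_ex)
    fix r :: real assume "0 < r" "ereal r < ereal ?R"
    then show "\<exists>z. norm z = r \<and> summable (\<lambda>n. F $ n * z ^ n)"
      using s[of "of_real r"] by (intro exI[of _ "of_real r"]) auto
  qed
  then have "0 < fps_conv_radius F" by (rule less_le_trans[rotated]) simp
  moreover have "eval_fps F z = h_fun p z + of_bool (p = 0)" if "norm z < ?R" for z
    using h_integral_sums[OF that, of p]
    by (simp add: F_def green_def eval_fps_def h_fun_def sums_iff)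
  then have "eventually (\<lambda>z. eval_fps F z = h_fun p z + of_bool (p = 0)) (nhds 0)"
    by (intro eventually_mono[OF eventually_nhds_in_open[of "ball 0 ?R"]]) (auto simp: dist_norm)
  ultimately have "(\<lambda>z. h_fun p z + of_bool (p = 0)) has_fps_expansion F"
    by (simp add: has_fps_expansion_def)
  then have "(\<lambda>z. h_fun p z + of_bool (p = 0) - of_bool (p = 0)) has_fps_expansion
      F - fps_const (of_bool (p = 0))"
    by (rule has_fps_expansion_diff) (rule has_fps_expansion_const)
  then show "h_fun p has_fps_expansion green p - of_bool (p = 0)"
    by (auto simp: F_def split: if_splits)
qed

text \<open>\<open>h_fun\<close> sees only the absolute values of the coordinates. This reconciles
  \<open>Y ! a - Y ! b\<close> in \<open>summand\<close> with the direction of travel from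
  \<open>a\<close> to \<open>b\<close> used for trails.\<close>

lemma h_series_minus: "h_series (- p) = h_series p"
  by (simp add: h_series_def h_fun_def[abs_def])

subsection \<open>The BEST theorem\<close>

text \<open>In \<open>tree_mat\<close> and \<open>trail_weight\<close>, \<open>G (a, b)\<close> is the number of edges from \<open>a\<close> to \<open>b\<close> and
  \<open>l a\<close> the out-degree of \<open>a\<close>. The determinant counts the spanning trees oriented towards \<open>0\<close>;
  vertices without outgoing edges get a unit row, so that they are ignored.\<close>

definition tree_mat :: "nat \<Rightarrow> (nat \<Rightarrow> nat) \<Rightarrow> (nat \<times> nat \<Rightarrow> nat) \<Rightarrow> int mat" where
  "tree_mat r l G = mat r r (\<lambda>(i, j). if i = 0 \<or> l i = 0 then of_bool (i = j)
     else of_bool (i = j) * int (l i) - int (G (i, j)))"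

definition trail_weight :: "nat \<Rightarrow> (nat \<Rightarrow> nat) \<Rightarrow> (nat \<times> nat \<Rightarrow> nat) \<Rightarrow> int" where
  "trail_weight r l G = det (tree_mat r l G) * fact (l 0) * (\<Prod>j\<in>{1..<r}. fact (l j - 1))"

text \<open>The degree conditions satisfied by the edge multiplicities of a trail from \<open>u\<close> to \<open>0\<close>.\<close>

definition transitions :: "nat \<Rightarrow> (nat \<Rightarrow> nat) \<Rightarrow> nat \<Rightarrow> (nat \<times> nat \<Rightarrow> nat) set" where
  "transitions r l u = {G \<in> ({..<r} \<times> {..<r}) \<rightarrow>\<^sub>E UNIV. (\<forall>a<r. (\<Sum>b<r. G (a, b)) = l a) \<and>
     (\<forall>b<r. (\<Sum>a<r. G (a, b)) + of_bool (b = u) = l b + of_bool (b = 0))}"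

text \<open>The indicator vector of \<open>S\<close> lies in the kernel of \<open>A\<close>. This is
  how a set of vertices cut off from vertex 0 makes a Laplacian determinant vanish.\<close>

lemma det_eq_0_of_block:
  fixes A :: "int mat"
  assumes A: "A \<in> carrier_mat r r" and S: "S \<subseteq> {..<r}" "S \<noteq> {}"
    and rows: "\<And>i. i < r \<Longrightarrow> (\<Sum>j\<in>S. A $$ (i, j)) = 0"
  shows "det A = 0"
proof -
  let ?v = "Matrix.vec r (\<lambda>j. of_bool (j \<in> S)) :: int Matrix.vec"
  have "?v \<noteq> 0\<^sub>v r"
    using S by (auto simp: vec_eq_iff)
  moreover have "A *\<^sub>v ?v = 0\<^sub>v r"
  proof (rule eq_vecI)
    fix i assume "i < dim_vec (0\<^sub>v r :: int Matrix.vec)"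
    then have i: "i < r" by simp
    have "(A *\<^sub>v ?v) $ i = (\<Sum>j\<in>{0..<r}. A $$ (i, j) * of_bool (j \<in> S))"
      using A i by (auto simp: scalar_prod_def intro!: sum.cong)
    also have "\<dots> = (\<Sum>j\<in>S. A $$ (i, j))"
      using S by (intro sum.mono_neutral_cong_right) auto
    finally show "(A *\<^sub>v ?v) $ i = 0\<^sub>v r $ i" using rows i by simp
  qed (use A in auto)
  ultimately show ?thesis
    using det_0_iff_vec_prod_zero[OF A] by (metis vec_carrier)
qed

lemma det_eq_0_of_column:
  assumes A: "(A :: int mat) \<in> carrier_mat r r" and "c < r" "\<And>i. i < r \<Longrightarrow> A $$ (i, c) = 0"
  shows "det A = 0"
  using assms by (simp add: laplace_expansion_column[OF A \<open>c < r\<close>])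

lemma cofactor_cong_row:
  assumes "A \<in> carrier_mat r r" "B \<in> carrier_mat r r"
    and "\<And>i j. i < r \<Longrightarrow> j < r \<Longrightarrow> i \<noteq> u \<Longrightarrow> A $$ (i, j) = B $$ (i, j)"
  shows "cofactor A u j = cofactor B u j"
proof -
  have "mat_delete A u j = mat_delete B u j"
    using assms by (intro eq_matI) (auto simp: mat_delete_def)
  then show ?thesis by (simp add: cofactor_def)
qed

text \<open>This is the removal of the first edge \<open>(u, b)\<close> of an Eulerian trail. Since the determinant is
  linear in row \<open>u\<close>, only the cofactors along that row enter.\<close>

lemma trail_weight_step:
  assumes G: "G \<in> transitions r l u" and u: "u < r" and lu: "0 < l u"
  shows "trail_weight r l G =
    (\<Sum>b<r. int (G (u, b)) * trail_weight r (l(u := l u - 1)) (G((u, b) := G (u, b) - 1)))"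
proof -
  let ?l = "l(u := l u - 1)" and ?G = "\<lambda>b. G((u, b) := G (u, b) - 1)"
  let ?M = "tree_mat r l G" and ?N = "\<lambda>b. tree_mat r ?l (?G b)"
  define c where "c j = cofactor ?M u j" for j
  have M: "?M \<in> carrier_mat r r" "?N b \<in> carrier_mat r r" for b by (auto simp: tree_mat_def)
  have row: "(\<Sum>b<r. int (G (u, b))) = int (l u)"
    using G u by (auto simp: transitions_def simp flip: of_nat_sum)
  show ?thesis
  proof (cases "u = 0")
    case True
    \<comment> \<open>Row 0 is a unit row in both matrices, so an edge leaving 0 changes only
      \<open>fact (l 0)\<close>, by the factor \<open>l 0\<close>, which is the row sum.\<close>
    have "?N b = ?M" for b using True by (intro eq_matI) (auto simp: tree_mat_def)
    moreover have "(\<Prod>j\<in>{1..<r}. fact (?l j - 1)) = (\<Prod>j\<in>{1..<r}. fact (l j - 1) :: int)"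
      using True by (intro prod.cong) auto
    ultimately have "(\<Sum>b<r. int (G (u, b)) * trail_weight r ?l (?G b)) =
        int (l u) * (det ?M * fact (l 0 - 1) * (\<Prod>j\<in>{1..<r}. fact (l j - 1)))"
      using True row by (simp add: trail_weight_def flip: sum_distrib_right)
    also have "\<dots> = trail_weight r l G"
      using True lu by (simp add: trail_weight_def fact_reduce[of "l 0"])
    finally show ?thesis by simp
  next
    case False
    have cN: "cofactor (?N b) u j = c j" for b j
      unfolding c_def using False u by (intro cofactor_cong_row[of _ r]) (auto simp: tree_mat_def)
    have detM: "det ?M = int (l u) * c u - (\<Sum>b<r. int (G (u, b)) * c b)"
    proof -
      have "det ?M = (\<Sum>j<r. ?M $$ (u, j) * c j)"
        unfolding c_def by (rule laplace_expansion_row[OF M(1) u])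
      also have "\<dots> = (\<Sum>j<r. of_bool (j = u) * (int (l u) * c u) - int (G (u, j)) * c j)"
        using u lu False by (intro sum.cong) (auto simp: tree_mat_def algebra_simps)
      also have "\<dots> = int (l u) * c u - (\<Sum>b<r. int (G (u, b)) * c b)"
        using u by (simp add: sum_subtractf flip: sum_distrib_right)
      finally show ?thesis .
    qed
    have detN: "det (?N b) = (\<Sum>j<r. ?N b $$ (u, j) * c j)" for b
      using laplace_expansion_row[OF M(2) u, of b] by (simp only: cN)
    have "(\<Sum>b<r. int (G (u, b)) * (det (?N b) * fact (l u - 1 - 1))) = det ?M * fact (l u - 1)"
    proof (cases "l u = 1")
      case True
      \<comment> \<open>The last edge out of \<open>u\<close> is removed. Since a trail that starts
        at \<open>u\<close> then never returns, \<open>u\<close> has in-degree 0, and column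
        \<open>u\<close> of \<open>?M\<close> vanishes outside row \<open>u\<close>.\<close>
      have colu: "G (i, u) = 0" if "i < r" for i
      proof -
        have "(\<Sum>a<r. G (a, u)) + 1 = 1"
          using G u False True by (auto simp: transitions_def)
        then show ?thesis using that by simp
      qed
      have c0: "c b = 0" if "b < r" "b \<noteq> u" for b
      proof -
        \<comment> \<open>The cofactor at (u, b) is the determinant after row \<open>u\<close> is
          replaced by the unit vector at \<open>b\<close>; for \<open>b\<close> different from
          \<open>u\<close> this leaves a zero column.\<close>
        let ?B = "mat r r (\<lambda>(i, j). if i = u then of_bool (j = b) else ?M $$ (i, j))"
        have B: "?B \<in> carrier_mat r r" by simp
        have "det ?B = (\<Sum>j<r. of_bool (j = b) * cofactor ?B u j)"
          using laplace_expansion_row[OF B u] u by simp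
        also have "\<dots> = cofactor ?B u b" using that by simp
        also have "\<dots> = c b"
          unfolding c_def using M u by (intro cofactor_cong_row[of _ r]) auto
        finally have "c b = det ?B" ..
        also have "\<dots> = 0"
          by (rule det_eq_0_of_column[OF B u]) (use that u False colu in \<open>auto simp: tree_mat_def\<close>)
        finally show ?thesis .
      qed
      have Guu: "G (u, u) = 0" using colu u by simp
      have "(\<Sum>b<r. int (G (u, b)) * c b) = (\<Sum>b<r. 0)"
        using c0 Guu by (intro sum.cong refl) auto
      then have "det ?M = c u" using detM True by simp
      moreover have "det (?N b) = c u" for b
      proof -
        have "det (?N b) = (\<Sum>j<r. of_bool (j = u) * c j)"
          unfolding detN using u True False by (intro sum.cong) (auto simp: tree_mat_def)
        then show ?thesis using u by simp
      qed
      ultimately show ?thesis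
        using True row by (simp flip: sum_distrib_right)
    next
      case F: False
      have "int (G (u, b)) * det (?N b) = int (G (u, b)) * (det ?M - c u + c b)" if "b < r" for b
      proof (cases "G (u, b) = 0")
        case False
        \<comment> \<open>Both \<open>l u\<close> and \<open>G (u, b)\<close> drop by one: row
          \<open>u\<close> loses the unit vector at \<open>u\<close> and gains the one at
          \<open>b\<close>. Truncated subtraction at \<open>G (u, b) = 0\<close> would break this,
          but then the factor in front is 0.\<close>
        have "det (?N b) = (\<Sum>j<r. ?M $$ (u, j) * c j - of_bool (j = u) * c u + of_bool (j = b) * c b)"
          unfolding detN using u lu F \<open>u \<noteq> 0\<close> False
          by (intro sum.cong) (auto simp: tree_mat_def algebra_simps of_nat_diff)
        also have "\<dots> = det ?M - c u + c b"
          using u that laplace_expansion_row[OF M(1) u]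
          by (simp add: sum.distrib sum_subtractf c_def flip: sum_distrib_right)
        finally show ?thesis by simp
      qed simp
      then have "(\<Sum>b<r. int (G (u, b)) * det (?N b)) =
          (\<Sum>b<r. int (G (u, b)) * (det ?M - c u) + int (G (u, b)) * c b)"
        by (intro sum.cong) (auto simp: algebra_simps)
      also have "\<dots> = int (l u) * (det ?M - c u) + (\<Sum>b<r. int (G (u, b)) * c b)"
        by (simp add: sum.distrib flip: row sum_distrib_right)
      also have "\<dots> = (int (l u) - 1) * det ?M"
        unfolding detM by (simp add: algebra_simps)
      also have "int (l u) - 1 = int (l u - 1)" using lu by simp
      finally have "(\<Sum>b<r. int (G (u, b)) * det (?N b)) = int (l u - 1) * det ?M" .
      moreover have "fact (l u - 1) = int (l u - 1) * fact (l u - 1 - 1)"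
        using lu F by (subst fact_reduce) auto
      moreover have "(\<Sum>b<r. int (G (u, b)) * (det (?N b) * fact (l u - 1 - 1))) =
          (\<Sum>b<r. int (G (u, b)) * det (?N b)) * fact (l u - 1 - 1)"
        by (simp only: sum_distrib_right mult.assoc)
      ultimately show ?thesis by (simp only: mult.commute mult.left_commute)
    qed
    moreover have "trail_weight r ?l (?G b) = det (?N b) * fact (l u - 1 - 1) *
        (fact (l 0) * (\<Prod>j\<in>{1..<r} - {u}. fact (l j - 1)))" for b
    proof -
      have "(\<Prod>j\<in>{1..<r}. fact (?l j - 1)) =
          fact (l u - 1 - 1) * (\<Prod>j\<in>{1..<r} - {u}. fact (l j - 1) :: int)"
        using u False by (subst prod.remove[of _ u]) auto
      then show ?thesis using False by (simp add: trail_weight_def)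
    qed
    moreover have "trail_weight r l G = det ?M * fact (l u - 1) *
        (fact (l 0) * (\<Prod>j\<in>{1..<r} - {u}. fact (l j - 1)))"
    proof -
      have "(\<Prod>j\<in>{1..<r}. fact (l j - 1)) =
          fact (l u - 1) * (\<Prod>j\<in>{1..<r} - {u}. fact (l j - 1) :: int)"
        using u False by (intro prod.remove) auto
      then show ?thesis by (simp add: trail_weight_def)
    qed
    ultimately show ?thesis
      by (simp only: mult.assoc[symmetric] sum_distrib_right[symmetric])
  qed
qed

text \<open>A trail stuck at \<open>u\<close> while edges remain elsewhere cannot be completed.
  Degree balance forces \<open>u = 0\<close>; no edge leads from the vertices with remaining edges
  to the others, so their rows sum to 0 within this set.\<close>

lemma trail_weight_eq_0:
  assumes G: "G \<in> transitions r l u" and u: "u < r" and lu: "l u = 0" and l: "\<exists>j<r. l j \<noteq> 0"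
  shows "trail_weight r l G = 0"
proof -
  have "u = 0"
  proof (rule ccontr)
    assume "u \<noteq> 0"
    then have "(\<Sum>a<r. G (a, u)) + 1 = 0" using G u lu by (auto simp: transitions_def)
    then show False by simp
  qed
  then have col: "(\<Sum>a<r. G (a, b)) = l b" if "b < r" for b
    using G that by (auto simp: transitions_def)
  let ?S = "{j\<in>{..<r}. l j \<noteq> 0}"
  have out: "G (i, j) = 0" if "i < r" "j < r" "l j = 0" for i j
    using col[of j] that by simp
  have "det (tree_mat r l G) = 0"
  proof (rule det_eq_0_of_block[of _ r ?S])
    fix i assume i: "i < r"
    show "(\<Sum>j\<in>?S. tree_mat r l G $$ (i, j)) = 0"
    proof (cases "i = 0 \<or> l i = 0")
      case True
      then have "l i = 0" using \<open>u = 0\<close> lu by auto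
      then show ?thesis using True i by (intro sum.neutral) (auto simp: tree_mat_def)
    next
      case False
      have "(\<Sum>j\<in>?S. tree_mat r l G $$ (i, j)) =
          (\<Sum>j\<in>?S. of_bool (i = j) * int (l i)) - (\<Sum>j\<in>?S. int (G (i, j)))"
        using False i by (subst sum_subtractf[symmetric], intro sum.cong) (auto simp: tree_mat_def)
      also have "(\<Sum>j\<in>?S. of_bool (i = j) * int (l i)) = int (l i)"
        using False i by (simp add: sum.delta' flip: sum_distrib_right)
      also have "(\<Sum>j\<in>?S. int (G (i, j))) = (\<Sum>j<r. int (G (i, j)))"
        using out i by (intro sum.mono_neutral_left) auto
      also have "\<dots> = int (l i)" using G i by (auto simp: transitions_def simp flip: of_nat_sum)
      finally show ?thesis by simp
    qed
  qed (use l in \<open>auto simp: tree_mat_def\<close>)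
  then show ?thesis by (simp add: trail_weight_def)
qed


section \<open>The generating function of trails\<close>

lemma finite_transitions: "finite (transitions r l u)"
proof (rule finite_subset)
  let ?L = "\<Sum>a<r. l a"
  show "transitions r l u \<subseteq> ({..<r} \<times> {..<r}) \<rightarrow>\<^sub>E {..?L}"
  proof
    fix G assume G: "G \<in> transitions r l u"
    have "G (a, b) \<le> ?L" if "a < r" "b < r" for a b
    proof -
      have "G (a, b) \<le> (\<Sum>b<r. G (a, b))" using that by (intro member_le_sum) auto
      also have "\<dots> = l a" using G that by (auto simp: transitions_def)
      also have "\<dots> \<le> ?L" using that by (intro member_le_sum) auto
      finally show ?thesis .
    qed
    then show "G \<in> ({..<r} \<times> {..<r}) \<rightarrow>\<^sub>E {..?L}"
      using G by (auto simp: transitions_def PiE_iff)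
  qed
  show "finite (({..<r} \<times> {..<r}) \<rightarrow>\<^sub>E {..?L})" by (intro finite_PiE) auto
qed

lemma transitions_add:
  assumes "u < r" "b < r" "0 < l u"
  shows "G((u, b) := Suc (G (u, b))) \<in> transitions r l u \<longleftrightarrow>
    G \<in> transitions r (l(u := l u - 1)) b"
proof -
  let ?G = "G((u, b) := Suc (G (u, b)))"
  have row: "(\<Sum>j<r. ?G (i, j)) = (\<Sum>j<r. G (i, j)) + of_bool (i = u)" for i
  proof -
    have "(\<Sum>j<r. ?G (i, j)) = (\<Sum>j<r. G (i, j) + (if j = b then of_bool (i = u) else 0))"
      by (intro sum.cong) auto
    then show ?thesis using assms by (simp add: sum.distrib)
  qed
  have col: "(\<Sum>j<r. ?G (j, i)) = (\<Sum>j<r. G (j, i)) + of_bool (i = b)" for i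
  proof -
    have "(\<Sum>j<r. ?G (j, i)) = (\<Sum>j<r. G (j, i) + (if j = u then of_bool (i = b) else 0))"
      by (intro sum.cong) auto
    then show ?thesis using assms by (simp add: sum.distrib)
  qed
  have "?G \<in> ({..<r} \<times> {..<r}) \<rightarrow>\<^sub>E UNIV \<longleftrightarrow> G \<in> ({..<r} \<times> {..<r}) \<rightarrow>\<^sub>E UNIV"
    using assms by (auto simp: PiE_iff extensional_def)
  moreover have "(\<Sum>j<r. ?G (i, j)) = l i \<longleftrightarrow> (\<Sum>j<r. G (i, j)) = (l(u := l u - 1)) i" for i
    unfolding row using assms by auto
  moreover have "(\<Sum>j<r. ?G (j, i)) + of_bool (i = u) = l i + of_bool (i = 0) \<longleftrightarrow>
      (\<Sum>j<r. G (j, i)) + of_bool (i = b) = (l(u := l u - 1)) i + of_bool (i = 0)" for i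
    unfolding col using assms by auto
  ultimately show ?thesis unfolding transitions_def by simp
qed

text \<open>\<open>trail_weight\<close> counts trails with distinguishable parallel edges, and the
  factorials of the multiplicities remove the labels. This is thus the sum over vertex sequences
  from \<open>u\<close> to 0 that leave each \<open>a\<close> exactly \<open>l a\<close> times,
  weighted by \<open>x\<close> along each transition.\<close>

definition trail_series ::
  "nat \<Rightarrow> (nat \<Rightarrow> nat \<Rightarrow> complex fps) \<Rightarrow> (nat \<Rightarrow> nat) \<Rightarrow> nat \<Rightarrow> complex fps" where
  "trail_series r x l u = (\<Sum>G\<in>transitions r l u.
     fps_const (of_int (trail_weight r l G) / (\<Prod>p\<in>{..<r} \<times> {..<r}. fact (G p))) *
     (\<Prod>(a, b)\<in>{..<r} \<times> {..<r}. x a b ^ G (a, b)))"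

lemma trail_series_zero:
  assumes "u < r" "\<forall>j<r. l j = 0"
  shows "trail_series r x l u = of_bool (u = 0)"
proof -
  let ?Z = "restrict (\<lambda>_. 0) ({..<r} \<times> {..<r}) :: nat \<times> nat \<Rightarrow> nat"
  have "G = ?Z \<and> u = 0" if G: "G \<in> transitions r l u" for G
  proof
    show "G = ?Z"
      using G assms by (intro ext) (auto simp: transitions_def PiE_iff extensional_def restrict_def)
    then have "(\<Sum>a<r. ?Z (a, u)) + of_bool (u = u) = l u + of_bool (u = 0)"
      using G assms unfolding transitions_def by blast
    then show "u = 0" using assms by (cases "u = 0") auto
  qed
  moreover have "?Z \<in> transitions r l u" if "u = 0"
    using assms that by (auto simp: transitions_def)
  ultimately have "transitions r l u = (if u = 0 then {?Z} else {})" by auto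
  moreover have "trail_weight r l ?Z = 1"
  proof -
    have "tree_mat r l ?Z = 1\<^sub>m r" using assms by (intro eq_matI) (auto simp: tree_mat_def)
    moreover have "fact (l 0) = (1 :: int)" using assms by simp
    moreover have "(\<Prod>j\<in>{1..<r}. fact (l j - 1)) = (1 :: int)"
      using assms by (intro prod.neutral) auto
    ultimately show ?thesis by (simp add: trail_weight_def)
  qed
  ultimately show ?thesis by (auto simp: trail_series_def intro!: prod.neutral)
qed

lemma fps_const_sum: "fps_const (sum f S) = (\<Sum>s\<in>S. fps_const (f s))"
  by (induction S rule: infinite_finite_induct) (auto simp flip: fps_const_add)

text \<open>The recursion by the first transition. In \<open>trail_weight_step\<close> the factor
  \<open>G (u, b)\<close> cancels against \<open>fact (G (u, b))\<close> and leaves the factorial of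
  the matrix with one edge less.\<close>

lemma trail_series_step:
  assumes u: "u < r" and l: "\<exists>j<r. l j \<noteq> 0"
  shows "trail_series r x l u =
    (if 0 < l u then \<Sum>b<r. x u b * trail_series r x (l(u := l u - 1)) b else 0)"
proof (cases "0 < l u")
  case False
  then show ?thesis
    using trail_weight_eq_0[OF _ u] l by (auto simp: trail_series_def intro!: sum.neutral)
next
  case True
  let ?l = "l(u := l u - 1)" and ?I = "{..<r} \<times> {..<r}"
  define m where "m G = (\<Prod>(a, b)\<in>?I. x a b ^ G (a, b))" for G :: "nat \<times> nat \<Rightarrow> nat"
  define q where "q G = (\<Prod>p\<in>?I. fact (G p) :: complex)" for G :: "nat \<times> nat \<Rightarrow> nat"
  define t where "t b G = fps_const (of_int (trail_weight r ?l (G((u, b) := G (u, b) - 1))) *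
      of_nat (G (u, b)) / q G) * m G" for b G
  have fin: "finite ?I" by simp
  have step: "x u b * trail_series r x ?l b = (\<Sum>G\<in>transitions r l u. t b G)" if b: "b < r" for b
  proof -
    let ?up = "\<lambda>G :: nat \<times> nat \<Rightarrow> nat. G((u, b) := Suc (G (u, b)))"
    have ub: "(u, b) \<in> ?I" using u b by simp
    have m: "m (?up G) = x u b * m G" for G
    proof -
      have "m (?up G) = x u b ^ Suc (G (u, b)) * (\<Prod>(a, c)\<in>?I - {(u, b)}. x a c ^ G (a, c))"
        unfolding m_def by (subst prod.remove[OF fin ub]) (auto intro!: arg_cong2[where f = times] prod.cong split: if_splits)
      also have "\<dots> = x u b * m G"
        unfolding m_def by (subst prod.remove[OF fin ub]) (simp add: mult.assoc)
      finally show ?thesis .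
    qed
    have q: "q (?up G) = of_nat (Suc (G (u, b))) * q G" for G
    proof -
      have "q (?up G) = fact (Suc (G (u, b))) * (\<Prod>p\<in>?I - {(u, b)}. fact (G p))"
        unfolding q_def by (subst prod.remove[OF fin ub]) (auto intro!: arg_cong2[where f = times] prod.cong split: if_splits)
      also have "\<dots> = of_nat (Suc (G (u, b))) * q G"
        unfolding q_def by (subst prod.remove[OF fin ub]) (simp add: mult.assoc)
      finally show ?thesis .
    qed
    have "x u b * trail_series r x ?l b =
        (\<Sum>G\<in>transitions r ?l b. fps_const (of_int (trail_weight r ?l G) / q G) * (x u b * m G))"
      unfolding trail_series_def sum_distrib_left by (intro sum.cong) (auto simp: m_def q_def)
    also have "\<dots> = (\<Sum>G\<in>transitions r ?l b. t b (?up G))"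
    proof (rule sum.cong)
      fix G
      have "of_int (trail_weight r ?l G) * of_nat (Suc (G (u, b))) / q (?up G) =
          of_int (trail_weight r ?l G) / q G"
        unfolding q by (simp del: of_nat_Suc)
      then show "fps_const (of_int (trail_weight r ?l G) / q G) * (x u b * m G) = t b (?up G)"
        unfolding t_def m by (simp del: of_nat_Suc)
    qed simp
    also have "\<dots> = (\<Sum>G\<in>?up ` transitions r ?l b. t b G)"
      by (subst sum.reindex) (auto simp: inj_on_def fun_eq_iff split: if_splits)
    also have "\<dots> = (\<Sum>G\<in>transitions r l u. t b G)"
    proof (rule sum.mono_neutral_left)
      show "finite (transitions r l u)" by (rule finite_transitions)
      show "?up ` transitions r ?l b \<subseteq> transitions r l u"
        using transitions_add[where r = r and l = l and u = u and b = b] u b True by auto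
      show "\<forall>G\<in>transitions r l u - ?up ` transitions r ?l b. t b G = 0"
      proof
        fix G assume G: "G \<in> transitions r l u - ?up ` transitions r ?l b"
        have "G (u, b) = 0"
        proof (rule ccontr)
          assume "G (u, b) \<noteq> 0"
          then have e: "?up (G((u, b) := G (u, b) - 1)) = G" by auto
          then have "G((u, b) := G (u, b) - 1) \<in> transitions r ?l b"
            using G u b True transitions_add[where r = r and l = l and u = u and b = b
              and G = "G((u, b) := G (u, b) - 1)"] by simp
          then show False using G e by (metis (no_types, lifting) DiffE image_eqI)
        qed
        then show "t b G = 0" by (simp add: t_def)
      qed
    qed
    finally show ?thesis .
  qed
  have "(\<Sum>b<r. x u b * trail_series r x ?l b) = (\<Sum>b<r. \<Sum>G\<in>transitions r l u. t b G)"
    by (intro sum.cong refl, rule step) simp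
  also have "\<dots> = (\<Sum>G\<in>transitions r l u. \<Sum>b<r. t b G)" by (rule sum.swap)
  also have "\<dots> = trail_series r x l u"
    unfolding trail_series_def
  proof (rule sum.cong)
    fix G assume G: "G \<in> transitions r l u"
    have "(\<Sum>b<r. t b G) = fps_const (\<Sum>b<r. of_int (trail_weight r ?l (G((u, b) := G (u, b) - 1))) *
        of_nat (G (u, b)) / q G) * m G"
      unfolding t_def by (simp add: sum_distrib_right fps_const_sum)
    also have "(\<Sum>b<r. of_int (trail_weight r ?l (G((u, b) := G (u, b) - 1))) * of_nat (G (u, b)) / q G) =
        of_int (trail_weight r l G) / q G"
      unfolding trail_weight_step[OF G u True] by (simp add: sum_divide_distrib mult.commute)
    finally show "(\<Sum>b<r. t b G) = fps_const (of_int (trail_weight r l G) / (\<Prod>p\<in>?I. fact (G p))) *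
        (\<Prod>(a, b)\<in>?I. x a b ^ G (a, b))"
      by (simp add: m_def q_def)
  qed simp
  finally show ?thesis using True by simp
qed

subsection \<open>Vertex factors\<close>

text \<open>The series in \<open>\<omega>\<close> that results from summing over the number \<open>g\<close> of consecutive repetitions at a
  vertex. For \<open>h = g = 0\<close> the truncated subtraction is harmless, as the binomial coefficient
  vanishes for \<open>k > 0\<close>.\<close>

definition vertex_fps :: "nat \<Rightarrow> nat \<Rightarrow> complex fps" where
  "vertex_fps h k = Abs_fps (\<lambda>g. (-1) ^ (h + g + k) * of_nat ((h + g) choose k) *
     fact (h + g - 1) / fact g)"

text \<open>This is (k + 1) C(n, k + 1) = (n - k) C(n, k) for \<open>n = h + g\<close>, with
  multiplication by \<open>g\<close> written as the operator X d/dX.\<close>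

lemma vertex_fps_Suc:
  "of_nat (Suc k) * vertex_fps h (Suc k) =
     (of_nat k - of_nat h) * vertex_fps h k - fps_X * fps_deriv (vertex_fps h k)"
proof (rule fps_ext)
  fix g
  have b: "of_nat (Suc k) * of_nat ((h + g) choose Suc k) =
      (of_nat h + of_nat g - of_nat k) * (of_nat ((h + g) choose k) :: complex)"
  proof (cases "k \<le> h + g")
    case True
    have "Suc k * ((h + g) choose Suc k) = (h + g - k) * ((h + g) choose k)"
      using binomial_absorb_comp[of "h + g" k] Suc_times_binomial_eq binomial_absorption
      by (metis binomial_absorption diff_Suc_1 mult.commute)
    then show ?thesis using True
      by (metis of_nat_add of_nat_diff of_nat_mult)
  qed (simp add: binomial_eq_0)
  have "fps_nth (of_nat (Suc k) * vertex_fps h (Suc k)) g =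
     - ((-1) ^ (h + g + k) * (of_nat (Suc k) * of_nat ((h + g) choose Suc k)) * fact (h + g - 1) / fact g)"
    by (simp add: vertex_fps_def fps_mult_of_nat_nth algebra_simps add_divide_distrib)
  also have "\<dots> = (of_nat k - of_nat h - of_nat g) * fps_nth (vertex_fps h k) g"
    unfolding b by (simp add: vertex_fps_def field_simps)
  also have "\<dots> = fps_nth ((of_nat k - of_nat h) * vertex_fps h k - fps_X * fps_deriv (vertex_fps h k)) g"
  proof -
    have "fps_nth (fps_X * fps_deriv (vertex_fps h k)) g = of_nat g * fps_nth (vertex_fps h k) g"
      by (cases g) auto
    then show ?thesis
      by (simp add: algebra_simps fps_mult_of_nat_nth)
  qed
  finally show "fps_nth (of_nat (Suc k) * vertex_fps h (Suc k)) g =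
      fps_nth ((of_nat k - of_nat h) * vertex_fps h k - fps_X * fps_deriv (vertex_fps h k)) g" .
qed

text \<open>For \<open>k > 0\<close> the series is rational with its only pole at -1. The power of
  \<open>U\<close> clears it and makes \<open>vertex_fps_Suc\<close> a recursion between numerators;
  \<open>of_nat (h + k) * p\<close> stems from differentiating that power.\<close>

lemma vertex_fps_step:
  fixes h k :: nat
  defines "U \<equiv> (1 + fps_X) :: complex fps"
  assumes p: "vertex_fps h k * U ^ (h + k) = p"
  shows "of_nat (Suc k) * (vertex_fps h (Suc k) * U ^ (h + Suc k)) =
    (of_nat k - of_nat h) * (U * p) - fps_X * (U * fps_deriv p - of_nat (h + k) * p)"
proof -
  let ?v = "vertex_fps h k"
  have dU: "fps_deriv (U ^ n) * U = of_nat n * U ^ n" for n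
  proof -
    have "fps_deriv U = 1" by (simp add: U_def)
    then have "fps_deriv (U ^ n) = of_nat n * U ^ (n - 1)" by (subst fps_deriv_power') simp
    then show ?thesis by (cases n) (auto simp: mult_ac simp del: of_nat_Suc)
  qed
  have "U * fps_deriv p = fps_deriv ?v * U ^ (h + Suc k) + ?v * (fps_deriv (U ^ (h + k)) * U)"
    unfolding p[symmetric] by (simp add: algebra_simps)
  also have "\<dots> = fps_deriv ?v * U ^ (h + Suc k) + of_nat (h + k) * p"
    unfolding dU p[symmetric] by (simp add: algebra_simps)
  finally have d: "fps_deriv ?v * U ^ (h + Suc k) = U * fps_deriv p - of_nat (h + k) * p"
    by simp
  have "of_nat (Suc k) * (vertex_fps h (Suc k) * U ^ (h + Suc k)) =
      ((of_nat k - of_nat h) * ?v - fps_X * fps_deriv ?v) * U ^ (h + Suc k)"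
    by (simp only: mult.assoc[symmetric] vertex_fps_Suc)
  also have "\<dots> = (of_nat k - of_nat h) * (U * (?v * U ^ (h + k))) -
      fps_X * (fps_deriv ?v * U ^ (h + Suc k))"
    by (simp add: algebra_simps)
  finally show ?thesis unfolding d p .
qed

lemma fps_negative_binomial:
  "Abs_fps (\<lambda>g. (-1) ^ g * of_nat ((h + g) choose g)) * (1 + fps_X) ^ Suc h = (1 :: complex fps)"
proof (induction h)
  case 0
  have "Abs_fps (\<lambda>g. (-1) ^ g) * (1 + fps_X) = (1 :: complex fps)"
  proof (rule fps_ext)
    fix n show "fps_nth (Abs_fps (\<lambda>g. (-1) ^ g) * (1 + fps_X)) n = fps_nth (1 :: complex fps) n"
      by (cases n) (auto simp: distrib_left)
  qed
  then show ?case by simp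
next
  case (Suc h)
  let ?B = "\<lambda>h. Abs_fps (\<lambda>g. (-1) ^ g * of_nat ((h + g) choose g)) :: complex fps"
  have "?B (Suc h) * (1 + fps_X) = ?B h"
  proof (rule fps_ext)
    fix n show "fps_nth (?B (Suc h) * (1 + fps_X)) n = fps_nth (?B h) n"
      by (cases n) (auto simp: distrib_left algebra_simps)
  qed
  then show ?case
    using Suc unfolding power_Suc[of _ "Suc h"] by (simp only: mult.assoc[symmetric])
qed

lemma fact_mult_binomial: "fact h * of_nat ((h + g) choose g) = (fact (h + g) / fact g :: complex)"
  by (subst binomial_fact) auto

text \<open>The numerator of \<open>K\<close>. For \<open>k > 0\<close> the truncated difference
  \<open>k - \<nu>\<close> is harmless, since the first binomial vanishes for \<nu> >= k.\<close>

definition vertex_poly :: "nat \<Rightarrow> nat \<Rightarrow> complex fps" where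
  "vertex_poly h k = Abs_fps (\<lambda>\<nu>. (-1) ^ \<nu> * of_nat ((k - 1) choose \<nu>) * of_nat (h choose (k - \<nu>)))"

lemma binomial_Suc_times:
  "of_nat (Suc j) * of_nat (h choose Suc j) = (of_nat h - of_nat j) * (of_nat (h choose j) :: complex)"
proof (cases "j \<le> h")
  case True
  have "Suc j * (h choose Suc j) = (h - j) * (h choose j)"
    by (metis binomial_absorption binomial_absorb_comp diff_Suc_1 mult.commute)
  then show ?thesis using True by (metis of_nat_diff of_nat_mult)
qed (simp add: binomial_eq_0)

text \<open>The recursion of \<open>vertex_fps_step\<close> with all signs reversed; the sign in
  \<open>vertex_fps_closed_pos\<close>, which alternates with \<open>k\<close>, absorbs the
  difference.\<close>

lemma vertex_poly_step:
  assumes "0 < k"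
  shows "of_nat (Suc k) * vertex_poly h (Suc k) =
    (of_nat h - of_nat k) * ((1 + fps_X) * vertex_poly h k) +
    fps_X * ((1 + fps_X) * fps_deriv (vertex_poly h k) - of_nat (h + k) * vertex_poly h k)"
    (is "_ = ?R")
proof (rule fps_ext)
  fix n
  define a where "a k n = of_nat ((k - 1) choose n) * (of_nat (h choose (k - n)) :: complex)" for k n
  have nth: "fps_nth (vertex_poly h k) n = (-1) ^ n * a k n" for k n
    by (simp add: vertex_poly_def a_def)
  obtain k' where k: "k = Suc k'" using assms gr0_implies_Suc by blast
  show "fps_nth (of_nat (Suc k) * vertex_poly h (Suc k)) n = fps_nth ?R n"
  proof (cases n)
    case 0
    have "of_nat (Suc k) * a (Suc k) 0 = (of_nat h - of_nat k) * a k 0"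
      using binomial_Suc_times[of k h] by (simp add: a_def)
    then show ?thesis
      using 0 by (simp add: fps_mult_of_nat_nth nth distrib_right left_diff_distrib)
  next
    case (Suc m)
    have "of_nat (Suc k) * a (Suc k) n =
        (of_nat h - of_nat k + of_nat n) * a k n + (2 * of_nat k - of_nat m) * a k m"
    proof (cases "n \<le> k")
      case True
      have "k - m = Suc (k - n)" using True Suc by simp
      then have e: "(of_nat h - of_nat (k - n)) * of_nat (h choose (k - n)) =
          of_nat (Suc (k - n)) * (of_nat (h choose (k - m)) :: complex)"
        using binomial_Suc_times[of "k - n" h] by simp
      have f: "of_nat n * of_nat (k' choose n) = (of_nat k - of_nat n) * (of_nat (k' choose m) :: complex)"
        using binomial_Suc_times[of m k'] Suc k by simp
      define x where "x = (of_nat (k' choose n) :: complex)"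
      define y where "y = (of_nat (k' choose m) :: complex)"
      define z where "z = (of_nat (h choose (k - m)) :: complex)"
      have xy: "of_nat n * x = (of_nat k - of_nat n) * y" using f by (simp add: x_def y_def)
      have e': "(of_nat h - of_nat k + of_nat n) * of_nat (h choose (k - n)) =
          (of_nat k - of_nat n + 1) * z"
        using e True by (simp add: of_nat_diff z_def algebra_simps)
      have t1: "(of_nat h - of_nat k + of_nat n) * a k n = x * ((of_nat k - of_nat n + 1) * z)"
      proof -
        have "a k n = x * of_nat (h choose (k - n))" by (simp add: a_def x_def k)
        then show ?thesis unfolding e'[symmetric] by (simp only: mult.left_commute)
      qed
      have t2: "a k m = y * z" by (simp add: a_def k y_def z_def)
      have t3: "a (Suc k) n = (x + y) * z"
        using Suc True by (simp add: a_def k x_def y_def z_def algebra_simps)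
      have nm: "of_nat n = (of_nat m + 1 :: complex)" using Suc by simp
      \<comment> \<open>All binomials are expressed by \<open>x\<close>, \<open>y\<close> and
        \<open>z\<close>; the claim is then linear in \<open>z\<close> and follows from the relation
        \<open>xy\<close> between \<open>x\<close> and \<open>y\<close>.\<close>
      have key: "(K + 1) * ((x + y) * z) = x * ((K - N + 1) * z) + (2 * K - M) * (y * z)"
        if "N * x = (K - N) * y" "N = M + 1" for K N M :: complex
      proof -
        have M: "M = N - 1" using that by simp
        have "N * x * z = (K - N) * y * z" using that by simp
        then show ?thesis unfolding M by (simp add: algebra_simps)
      qed
      show ?thesis using key[OF xy nm] unfolding t1 t2 t3 by (simp add: add.commute)
    next
      case False
      then show ?thesis using Suc k by (simp add: a_def binomial_eq_0)
    qed
    then have "fps_nth (of_nat (Suc k) * vertex_poly h (Suc k)) n =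
        (-1) ^ n * ((of_nat h - of_nat k + of_nat n) * a k n + (2 * of_nat k - of_nat m) * a k m)"
      unfolding fps_mult_of_nat_nth nth by (metis mult.left_commute)
    also have "\<dots> = fps_nth ?R n"
    proof -
      let ?p = "vertex_poly h k"
      have "fps_nth ((1 + fps_X) * ?p) (Suc m) = fps_nth ?p (Suc m) + fps_nth ?p m"
        by (simp add: distrib_right)
      moreover have "fps_nth ((1 + fps_X) * fps_deriv ?p) m =
          of_nat (Suc m) * fps_nth ?p (Suc m) + of_nat m * fps_nth ?p m"
        by (cases m) (simp_all add: distrib_right)
      moreover have "fps_nth ((of_nat h - of_nat k) * q) i = (of_nat h - of_nat k) * fps_nth q i"
        for q :: "complex fps" and i by (simp add: left_diff_distrib)
      ultimately have "fps_nth ?R (Suc m) =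
          (of_nat h - of_nat k) * (fps_nth ?p (Suc m) + fps_nth ?p m) +
          (of_nat (Suc m) * fps_nth ?p (Suc m) + of_nat m * fps_nth ?p m - of_nat (h + k) * fps_nth ?p m)"
        by (simp only: fps_add_nth fps_sub_nth fps_mult_of_nat_nth fps_X_mult_nth) simp
      then show ?thesis unfolding Suc nth by (simp add: algebra_simps)
    qed
    finally show ?thesis .
  qed
qed

text \<open>Induction on \<open>k\<close> through the common recursion of both sides. At
  \<open>k = 1\<close> the factor \<open>h + g\<close> completes the factorial, and the series is
  the binomial series of (1 + X)^(-h-1).\<close>

lemma vertex_fps_closed_pos:
  assumes "0 < h" "0 < k"
  shows "vertex_fps h k * (1 + fps_X) ^ (h + k) =
     fps_const ((-1) ^ (h + k) * fact (h - 1)) * vertex_poly h k"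
  using assms(2)
proof (induction k rule: nat_induct_non_zero)
  case 1
  have "vertex_fps h 1 = fps_const ((-1) ^ (h + 1) * fact h) *
      Abs_fps (\<lambda>g. (-1) ^ g * of_nat ((h + g) choose g))"
  proof (rule fps_ext)
    fix g
    have "of_nat (h + g) * fact (h + g - 1) = (fact (h + g) :: complex)"
      using assms(1) by (simp add: fact_reduce)
    then have "fps_nth (vertex_fps h 1) g = (-1) ^ (h + g + 1) * (fact (h + g) / fact g)"
      by (simp add: vertex_fps_def mult.assoc)
    then show "fps_nth (vertex_fps h 1) g = fps_nth (fps_const ((-1) ^ (h + 1) * fact h) *
      Abs_fps (\<lambda>g. (-1) ^ g * of_nat ((h + g) choose g))) g"
      unfolding fact_mult_binomial[symmetric] by (simp add: power_add mult_ac)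
  qed
  then have "vertex_fps h 1 * (1 + fps_X) ^ (h + 1) = fps_const ((-1) ^ (h + 1) * fact h)"
    using fps_negative_binomial[of h] by (simp add: mult.assoc)
  moreover have "vertex_poly h 1 = fps_const (of_nat h)"
    by (rule fps_ext) (auto simp: vertex_poly_def)
  moreover have "fact h = fact (h - 1) * (of_nat h :: complex)"
    using assms(1) by (simp add: fact_reduce)
  ultimately show ?case by simp
next
  case (Suc k)
  define c where "c = (fps_const ((-1) ^ (h + k) * fact (h - 1)) :: complex fps)"
  have d: "fps_deriv (c * vertex_poly h k) = c * fps_deriv (vertex_poly h k)"
    by (simp add: c_def)
  note IH = Suc.IH[folded c_def]
  have "of_nat (Suc k) * (vertex_fps h (Suc k) * (1 + fps_X) ^ (h + Suc k)) =
      - c * (of_nat (Suc k) * vertex_poly h (Suc k))"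
    unfolding vertex_fps_step[OF IH] vertex_poly_step[OF Suc.hyps] d
    by (simp add: algebra_simps)
  also have "\<dots> = of_nat (Suc k) * (fps_const ((-1) ^ (h + Suc k) * fact (h - 1)) * vertex_poly h (Suc k))"
    by (simp add: c_def algebra_simps)
  finally show ?case by (simp del: of_nat_Suc)
qed

text \<open>For \<open>h = 0\<close> and \<open>g > 0\<close> the quotient of factorials is 1/g, so
  the closed form with \<open>fact (h - 1)\<close> is replaced by another one. It starts from X / (1
  + X) and continues by the same recursion.\<close>

lemma vertex_fps_closed_0:
  assumes "0 < k"
  shows "vertex_fps 0 k * (1 + fps_X) ^ k = fps_const (1 / of_nat k) * fps_X ^ k"
  using assms
proof (induction k rule: nat_induct_non_zero)
  case 1
  have "vertex_fps 0 1 * (1 + fps_X) = fps_X"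
  proof (rule fps_ext)
    fix n
    have v: "fps_nth (vertex_fps 0 (Suc 0)) g = (if g = 0 then 0 else (-1) ^ Suc g)" for g
      by (simp add: vertex_fps_def fact_reduce)
    show "fps_nth (vertex_fps 0 1 * (1 + fps_X)) n = fps_nth fps_X n"
      by (cases n) (auto simp: distrib_left v)
  qed
  then show ?case by simp
next
  case (Suc k)
  define c where "c = (fps_const (1 / of_nat k) :: complex fps)"
  have kc: "of_nat k * c = 1" using Suc.hyps by (simp add: c_def flip: fps_of_nat)
  obtain k' where k: "k = Suc k'" using Suc.hyps gr0_implies_Suc by blast
  have IH: "vertex_fps 0 k * (1 + fps_X) ^ (0 + k) = c * fps_X ^ k" using Suc.IH by (simp add: c_def)
  have d: "fps_deriv (c * fps_X ^ k) = (of_nat k * c) * fps_X ^ k'"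
    unfolding c_def k by (simp add: fps_deriv_power' mult_ac del: of_nat_Suc power_Suc)
  have "of_nat (Suc k) * (vertex_fps 0 (Suc k) * (1 + fps_X) ^ (0 + Suc k)) =
      (of_nat k * c) * ((1 + fps_X) * fps_X ^ k) -
      fps_X * ((1 + fps_X) * ((of_nat k * c) * fps_X ^ k') - (of_nat k * c) * fps_X ^ k)"
    unfolding vertex_fps_step[OF IH] d by (simp add: algebra_simps)
  also have "\<dots> = fps_X ^ Suc k"
    unfolding kc by (simp add: k algebra_simps)
  also have "\<dots> = of_nat (Suc k) * (fps_const (1 / of_nat (Suc k)) * fps_X ^ Suc k)"
    by (simp flip: fps_of_nat mult.assoc del: of_nat_Suc)
  finally show ?case by (simp del: of_nat_Suc power_Suc)
qed

lemma vertex_poly_compose: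
  assumes "fps_nth \<omega> 0 = 0" "0 < k"
  shows "vertex_poly h k oo \<omega> =
    (\<Sum>\<nu>\<in>{nat (max 0 (int k - int h))..k - 1}.
       of_nat ((k - 1) choose \<nu>) * of_nat (h choose (k - \<nu>)) * (- \<omega>) ^ \<nu>)"
proof -
  have "vertex_poly h k = (\<Sum>\<nu>\<in>{..k - 1}.
       fps_const (of_nat ((k - 1) choose \<nu>) * of_nat (h choose (k - \<nu>)) * (-1) ^ \<nu>) * fps_X ^ \<nu>)"
    (is "_ = (\<Sum>\<nu>\<in>_. fps_const (?c \<nu>) * _)")
  proof (rule fps_ext)
    fix n
    have nth: "fps_nth (fps_const c * fps_X ^ \<nu>) n = (if n = \<nu> then c else 0)" for c :: complex and \<nu>
      by simp
    show "fps_nth (vertex_poly h k) n = fps_nth (\<Sum>\<nu>\<in>{..k - 1}. fps_const (?c \<nu>) * fps_X ^ \<nu>) n"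
      unfolding fps_sum_nth nth by (auto simp: vertex_poly_def binomial_eq_0)
  qed
  then have "vertex_poly h k oo \<omega> = (\<Sum>\<nu>\<in>{..k - 1}.
       fps_const (of_nat ((k - 1) choose \<nu>) * of_nat (h choose (k - \<nu>)) * (-1) ^ \<nu>) * \<omega> ^ \<nu>)"
    using assms(1)
    by (simp add: fps_compose_sum_distrib fps_compose_mult_distrib flip: fps_compose_power)
  also have "\<dots> = (\<Sum>\<nu>\<in>{..k - 1}.
       of_nat ((k - 1) choose \<nu>) * of_nat (h choose (k - \<nu>)) * (- \<omega>) ^ \<nu>)"
  proof (rule sum.cong)
    fix \<nu>
    have "(- \<omega>) ^ \<nu> = fps_const ((-1) ^ \<nu>) * \<omega> ^ \<nu>"
      by (simp add: power_minus[of \<omega>] flip: fps_const_power fps_const_neg)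
    then show "fps_const (of_nat ((k - 1) choose \<nu>) * of_nat (h choose (k - \<nu>)) * (-1) ^ \<nu>) * \<omega> ^ \<nu> =
        of_nat ((k - 1) choose \<nu>) * of_nat (h choose (k - \<nu>)) * (- \<omega>) ^ \<nu>"
      by (simp add: fps_of_nat[symmetric] mult_ac)
  qed simp
  \<comment> \<open>Below the new lower limit \<open>k - \<nu>\<close> exceeds \<open>h\<close>, so
    the second binomial is 0.\<close>
  also have "\<dots> = (\<Sum>\<nu>\<in>{nat (max 0 (int k - int h))..k - 1}.
       of_nat ((k - 1) choose \<nu>) * of_nat (h choose (k - \<nu>)) * (- \<omega>) ^ \<nu>)"
    by (rule sum.mono_neutral_right) (auto simp: binomial_eq_0)
  finally show ?thesis .
qed

text \<open>The theorem distributes the factor \<open>(1 + \<omega>) ^ h\<close> over the edges: the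
  exponents of 1 + h(0) in row \<open>a\<close> of \<open>F\<close> add up to \<open>hs ! a\<close>.
  The remaining power \<open>k\<close> belongs to \<open>K\<close>.\<close>

lemma vertex_fps_compose:
  assumes \<omega>: "fps_nth \<omega> 0 = 0" and k: "0 < k"
  shows "(vertex_fps h k oo \<omega>) * (1 + \<omega>) ^ h = (-1) ^ h * of_nat (fact h) * K h k \<omega>"
proof -
  let ?U = "1 + \<omega>"
  have "fps_nth ?U 0 = 1" using \<omega> by simp
  then have U: "fps_nth ?U 0 \<noteq> 0" "?U \<noteq> 0" by (metis zero_neq_one, metis fps_zero_nth zero_neq_one)
  have one: "1 / ?U * ?U = 1"
    using U by (simp add: fps_divide_unit inverse_mult_eq_1)
  have c: "(vertex_fps h k * (1 + fps_X) ^ n) oo \<omega> = (vertex_fps h k oo \<omega>) * ?U ^ n" for n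
    using \<omega> by (simp add: fps_compose_mult_distrib fps_compose_add_distrib flip: fps_compose_power)
  have "(vertex_fps h k oo \<omega>) * ?U ^ h * ?U ^ k = (-1) ^ h * of_nat (fact h) * K h k \<omega> * ?U ^ k"
  proof (cases "h = 0")
    case True
    have "(vertex_fps 0 k oo \<omega>) * ?U ^ k = fps_const (1 / of_nat k) * \<omega> ^ k"
      using c[of k] True vertex_fps_closed_0[OF k] \<omega>
      by (simp add: fps_compose_mult_distrib flip: fps_compose_power)
    also have "\<omega> = \<omega> / ?U * ?U"
      using U by (simp add: fps_divide_unit inverse_mult_eq_1 mult.assoc)
    then have "\<omega> ^ k = (\<omega> / ?U) ^ k * ?U ^ k"
      by (metis power_mult_distrib)
    finally show ?thesis using True by (simp add: K_def mult.assoc)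
  next
    case False
    have "(vertex_fps h k oo \<omega>) * ?U ^ (h + k) =
        fps_const ((-1) ^ (h + k) * fact (h - 1)) * (vertex_poly h k oo \<omega>)"
      using c[of "h + k"] False k vertex_fps_closed_pos[of h k] \<omega>
      by (simp add: fps_compose_mult_distrib)
    also have "\<dots> = (-1) ^ h * of_nat (fact h) * ((-1) ^ k * fps_const (1 / of_nat h) *
        (vertex_poly h k oo \<omega>))"
    proof -
      have "fps_const ((-1) ^ (h + k) * fact (h - 1)) =
         (-1) ^ h * of_nat (fact h) * ((-1) ^ k * fps_const (1 / of_nat h) :: complex fps)"
      proof -
        have m: "(-1) ^ n = (fps_const ((-1) ^ n) :: complex fps)" for n
          by (simp flip: fps_const_power fps_const_neg)
        have "fact h = of_nat h * (fact (h - 1) :: complex)" using False by (simp add: fact_reduce)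
        then show ?thesis using False
          by (simp add: m fps_of_nat[symmetric] power_add)
      qed
      then show ?thesis by (simp add: mult.assoc)
    qed
    also have "\<dots> = (-1) ^ h * of_nat (fact h) * K h k \<omega> * ?U ^ k"
    proof -
      have "(1 / ?U) ^ k * ?U ^ k = 1"
        unfolding power_mult_distrib[symmetric] one by simp
      then show ?thesis
        using False unfolding K_def vertex_poly_compose[OF \<omega> k]
        by (simp add: mult_ac)
    qed
    finally show ?thesis by (simp add: power_add mult.assoc)
  qed
  then show ?thesis using U(2) by simp
qed

subsection \<open>Walks with marked visits\<close>

lemma green_rec:
  fixes p :: "int ^ ('d::finite)"
  shows "green p = of_bool (p = 0) + fps_X * (\<Sum>s\<in>UNIV. green (p - step_vec s))"
proof (rule fps_ext)
  fix n
  show "fps_nth (green p) n = fps_nth (of_bool (p = 0) + fps_X * (\<Sum>s\<in>UNIV. green (p - step_vec s))) n"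
    by (cases n) (auto simp: green_def num_walks_0 num_walks_Suc fps_sum_nth)
qed

text \<open>At least one step is made: this is the weight of a piece between successive marked
  visits, which may be to the same point.\<close>

lemma h_series_rec:
  fixes p :: "int ^ ('d::finite)"
  shows "h_series p = fps_X * (\<Sum>s\<in>UNIV. green (p - step_vec s))"
  unfolding h_series_eq by (subst green_rec) simp

text \<open>The factor X makes coefficient \<open>n\<close> depend on coefficients of index
  \<open>n - 1\<close> only. It gives uniqueness for the equation of
  \<open>visit_series_rec\<close>.\<close>

lemma fps_step_unique:
  fixes D :: "int ^ ('d::finite) \<Rightarrow> complex fps"
  assumes "\<And>x. D x = fps_X * (\<Sum>s\<in>UNIV. D (x + step_vec s))"
  shows "D x = 0"
proof (rule fps_ext)
  fix n
  show "fps_nth (D x) n = fps_nth 0 n"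
    by (induction n arbitrary: x; subst assms) (auto simp: fps_sum_nth)
qed

text \<open>The end point is omitted: a closed walk lists its points cyclically, and moving its root
  rotates the list.\<close>

fun sites :: "int ^ ('d::finite) \<Rightarrow> 'd step list \<Rightarrow> (int ^ 'd) list" where
  "sites p [] = []"
| "sites p (s # ss) = p # sites (p + step_vec s) ss"

lemma length_sites [simp]: "length (sites p ss) = length ss"
  by (induction ss arbitrary: p) auto

lemma sites_nth: "i < length ss \<Longrightarrow> sites p ss ! i = p + displacement (take i ss)"
proof (induction ss arbitrary: p i)
  case (Cons s ss)
  then show ?case by (cases i) (auto simp: add.assoc)
qed simp

lemma sites_snoc: "sites p (ss @ [s]) = sites p ss @ [p + displacement ss]"
  by (induction ss arbitrary: p) (auto simp: add.assoc)

text \<open>The number of ways to mark \<open>l j\<close> of the visits to \<open>Y j\<close> for each \<open>j\<close>.\<close>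

definition visit_weight ::
  "nat \<Rightarrow> (nat \<Rightarrow> int ^ ('d::finite)) \<Rightarrow> (nat \<Rightarrow> nat) \<Rightarrow> (int ^ 'd) list \<Rightarrow> complex" where
  "visit_weight r Y l xs = (\<Prod>j<r. of_nat (count_list xs (Y j) choose l j))"

text \<open>The final arrival at \<open>Y 0\<close> is not among the sites and cannot be marked,
  whereas the start can.\<close>

definition visit_series ::
  "nat \<Rightarrow> (nat \<Rightarrow> int ^ ('d::finite)) \<Rightarrow> (nat \<Rightarrow> nat) \<Rightarrow> int ^ 'd \<Rightarrow> complex fps" where
  "visit_series r Y l x = Abs_fps (\<lambda>n.
     \<Sum>ss | length ss = n \<and> x + displacement ss = Y 0. visit_weight r Y l (sites x ss))"

text \<open>Walks that start at \<open>Y b\<close> with their starting point marked.\<close>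

definition return_series ::
  "nat \<Rightarrow> (nat \<Rightarrow> int ^ ('d::finite)) \<Rightarrow> (nat \<Rightarrow> nat) \<Rightarrow> nat \<Rightarrow> complex fps" where
  "return_series r Y l b = (if 0 < l b
     then fps_X * (\<Sum>s\<in>UNIV. visit_series r Y (l(b := l b - 1)) (Y b + step_vec s)) else 0)"

lemma visit_weight_Cons_other:
  assumes "x \<notin> Y ` {..<r}"
  shows "visit_weight r Y l (x # xs) = visit_weight r Y l xs"
  unfolding visit_weight_def using assms by (intro prod.cong) auto

text \<open>Pascal's rule: the visit at the front is left unmarked, or it uses up one of the
  \<open>l b\<close> marks.\<close>

lemma visit_weight_Cons_visit:
  assumes Y: "inj_on Y {..<r}" and b: "b < r"
  shows "visit_weight r Y l (Y b # xs) = visit_weight r Y l xs +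
    (if 0 < l b then visit_weight r Y (l(b := l b - 1)) xs else 0)"
proof -
  let ?c = "\<lambda>j. count_list xs (Y j)"
  let ?Q = "\<Prod>j\<in>{..<r} - {b}. of_nat (?c j choose l j) :: complex"
  have rem: "(\<Prod>j<r. g j) = g b * (\<Prod>j\<in>{..<r} - {b}. g j)" for g :: "nat \<Rightarrow> complex"
    using b by (intro prod.remove) auto
  have "visit_weight r Y l (Y b # xs) = of_nat (Suc (?c b) choose l b) * ?Q"
    unfolding visit_weight_def
    by (subst rem) (use Y b in \<open>auto simp: inj_on_def intro!: arg_cong2[where f = times] prod.cong split: if_splits\<close>)
  moreover have "visit_weight r Y l xs = of_nat (?c b choose l b) * ?Q"
    unfolding visit_weight_def by (subst rem) simp
  moreover have "visit_weight r Y (l(b := l b - 1)) xs = of_nat (?c b choose (l b - 1)) * ?Q"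
    unfolding visit_weight_def
    by (subst rem) (auto intro!: arg_cong2[where f = times] prod.cong)
  ultimately show ?thesis
    by (cases "l b") (auto simp: algebra_simps)
qed

lemma visit_series_rec:
  assumes Y: "inj_on Y {..<r}"
  shows "visit_series r Y l x = of_bool (x = Y 0 \<and> (\<forall>j<r. l j = 0)) +
     fps_X * (\<Sum>s\<in>UNIV. visit_series r Y l (x + step_vec s)) +
     (\<Sum>b<r. of_bool (x = Y b) * return_series r Y l b)" (is "_ = ?R")
proof (rule fps_ext)
  fix n
  show "fps_nth (visit_series r Y l x) n = fps_nth ?R n"
  proof (cases n)
    case 0
    have p: "(\<Prod>j<r. of_nat (0 choose l j)) = (of_bool (\<forall>j<r. l j = 0) :: complex)"
    proof (cases "\<forall>j<r. l j = 0")
      case False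
      then obtain j where "j < r" "0 < l j" by auto
      then show ?thesis using False by (intro prod_zero[THEN trans]) (auto intro!: bexI[of _ j])
    qed simp
    have e: "{ss. length ss = 0 \<and> x + displacement ss = Y 0} = (if x = Y 0 then {[]} else {})"
      by auto
    have "fps_nth (visit_series r Y l x) 0 = of_bool (x = Y 0 \<and> (\<forall>j<r. l j = 0))"
      unfolding visit_series_def fps_nth_Abs_fps e
      by (cases "x = Y 0") (simp_all only: if_True if_False sum.insert finite.emptyI sum.empty
          visit_weight_def sites.simps count_list.simps p empty_iff simp_thms not_False_eq_True add_0_right of_bool_eq(1))
    moreover have "fps_nth (return_series r Y l b) 0 = 0" for b
      by (simp add: return_series_def)
    then have "fps_nth (of_bool (x = Y b) * return_series r Y l b) 0 = 0" for b
      by simp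
    then have "fps_nth (\<Sum>b<r. of_bool (x = Y b) * return_series r Y l b) 0 = 0"
      by (simp only: fps_sum_nth sum.neutral_const)
    then have "fps_nth ?R 0 = of_bool (x = Y 0 \<and> (\<forall>j<r. l j = 0))"
      unfolding fps_add_nth fps_X_mult_nth by (cases "x = Y 0 \<and> (\<forall>j<r. l j = 0)") simp_all
    ultimately show ?thesis unfolding 0 by simp
  next
    case (Suc m)
    let ?w = "\<lambda>l s. \<Sum>ss | length ss = m \<and> (x + step_vec s) + displacement ss = Y 0.
        visit_weight r Y l (sites (x + step_vec s) ss)"
    have w: "fps_nth (visit_series r Y l (x + step_vec s)) m = ?w l s" for l s
      by (simp add: visit_series_def)
    have "fps_nth (visit_series r Y l x) n = (\<Sum>s\<in>UNIV. 
        \<Sum>ss | length ss = m \<and> (x + step_vec s) + displacement ss = Y 0.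
          visit_weight r Y l (x # sites (x + step_vec s) ss))"
      unfolding visit_series_def Suc
      by (simp add: sum_step_lists_Suc[where Q = "\<lambda>ss. x + displacement ss = Y 0"] add.assoc)
    also have "\<dots> = (\<Sum>s\<in>UNIV. ?w l s) + 
        (\<Sum>b<r. of_bool (x = Y b) * of_bool (0 < l b) * (\<Sum>s\<in>UNIV. ?w (l(b := l b - 1)) s))"
    proof (cases "x \<in> Y ` {..<r}")
      case False
      then show ?thesis by (auto simp: visit_weight_Cons_other intro!: sum.neutral)
    next
      case True
      then obtain b where b: "b < r" "x = Y b" by auto
      have "(\<Sum>b'<r. of_bool (x = Y b') * of_bool (0 < l b') * (\<Sum>s\<in>UNIV. ?w (l(b' := l b' - 1)) s)) =
          (\<Sum>b'\<in>{b}. of_bool (x = Y b') * of_bool (0 < l b') * (\<Sum>s\<in>UNIV. ?w (l(b' := l b' - 1)) s))"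
        using Y b by (intro sum.mono_neutral_right) (auto simp: inj_on_def)
      then show ?thesis
        by (cases "0 < l b") (simp_all add: b visit_weight_Cons_visit[OF Y b(1)] sum.distrib)
    qed
    also have "\<dots> = fps_nth ?R n"
    proof -
      have "of_bool (x = Y b) * of_bool (0 < l b) *
            (\<Sum>s\<in>UNIV. fps_nth (visit_series r Y (l(b := l b - 1)) (x + step_vec s)) m) =
          fps_nth (of_bool (x = Y b) * return_series r Y l b) (Suc m)" for b
        by (cases "x = Y b") (simp_all add: return_series_def fps_sum_nth)
      moreover have "fps_nth (of_bool Q) (Suc m) = (0 :: complex)" for Q
        by (cases Q) simp_all
      ultimately show ?thesis
        unfolding w[symmetric] Suc
        by (simp only: fps_add_nth fps_sum_nth fps_X_mult_nth nat.distinct if_False add_0_left diff_Suc_1)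
    qed
    finally show ?thesis .
  qed
qed

text \<open>Decomposition at the first marked visit: a free walk leads from \<open>x\<close> to some
  \<open>Y b\<close>, or to the end \<open>Y 0\<close> if nothing is to be marked. As
  \<open>green\<close> is the resolvent of the step operator, the right-hand side solves the
  equation of \<open>visit_series_rec\<close>.\<close>

lemma visit_series_eq:
  fixes Y :: "nat \<Rightarrow> int ^ ('d::finite)"
  assumes Y: "inj_on Y {..<r}"
  shows "visit_series r Y l x = (if \<forall>j<r. l j = 0 then green (Y 0 - x) else 0) +
    (\<Sum>b<r. green (Y b - x) * return_series r Y l b)"
proof -
  let ?z = "\<forall>j<r. l j = 0"
  let ?R = "return_series r Y l"
  define G where "G x = (if ?z then green (Y 0 - x) else 0) + (\<Sum>b<r. green (Y b - x) * ?R b)" for x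
  have g: "green (y - x) = of_bool (x = y) + fps_X * (\<Sum>s\<in>UNIV. green (y - (x + step_vec s)))"
    for x y :: "int ^ 'd"
    by (subst green_rec) (auto simp: algebra_simps)
  have G_rec: "G x = of_bool (x = Y 0 \<and> ?z) + fps_X * (\<Sum>s\<in>UNIV. G (x + step_vec s)) +
      (\<Sum>b<r. of_bool (x = Y b) * ?R b)" for x
  proof -
    have "(\<Sum>b<r. green (Y b - x) * ?R b) = (\<Sum>b<r. of_bool (x = Y b) * ?R b) +
        fps_X * (\<Sum>s\<in>UNIV. \<Sum>b<r. green (Y b - (x + step_vec s)) * ?R b)"
    proof -
      have "(\<Sum>s\<in>(UNIV :: 'd step set). \<Sum>b<r. green (Y b - (x + step_vec s)) * ?R b) =
          (\<Sum>b<r. (\<Sum>s\<in>UNIV. green (Y b - (x + step_vec s))) * ?R b)"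
        by (subst sum.swap) (simp only: sum_distrib_right)
      moreover have "fps_X * (\<Sum>b<r. A b * ?R b) = (\<Sum>b<r. fps_X * A b * ?R b)" for A
        by (simp only: sum_distrib_left mult.assoc)
      ultimately show ?thesis
        by (simp only: g[of _ x] distrib_right sum.distrib)
    qed
    moreover have "(if ?z then green (Y 0 - x) else 0) = of_bool (x = Y 0 \<and> ?z) +
        fps_X * (\<Sum>s\<in>(UNIV :: 'd step set). if ?z then green (Y 0 - (x + step_vec s)) else 0)"
    proof (cases ?z)
      case True
      then have z: "?z = True" by simp
      show ?thesis unfolding z using g[of "Y 0" x] by simp
    next
      case False
      then have z: "?z = False" by simp
      show ?thesis unfolding z by simp
    qed
    ultimately show ?thesis
      unfolding G_def by (simp only: sum.distrib distrib_left add_ac)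
  qed
  have "visit_series r Y l x - G x = 0"
  proof (rule fps_step_unique[of "\<lambda>x. visit_series r Y l x - G x"])
    fix x
    show "visit_series r Y l x - G x =
        fps_X * (\<Sum>s\<in>UNIV. visit_series r Y l (x + step_vec s) - G (x + step_vec s))"
      by (subst visit_series_rec[OF Y], subst G_rec) (simp add: sum_subtractf algebra_simps)
  qed
  then show ?thesis by (simp add: G_def)
qed

text \<open>From the marked visit at \<open>Y u\<close> the walk goes on to the next marked visit,
  or to its end at \<open>Y 0\<close> when no marks are left. The first step is forced, so
  \<open>green\<close> is replaced by \<open>h_series\<close>.\<close>

lemma return_series_step:
  fixes Y :: "nat \<Rightarrow> int ^ ('d::finite)"
  assumes Y: "inj_on Y {..<r}" and r: "0 < r"
  shows "return_series r Y l u = (if 0 < l u then let l' = l(u := l u - 1) in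
     \<Sum>b<r. h_series (Y b - Y u) *
       (if \<forall>j<r. l' j = 0 then of_bool (b = 0) else return_series r Y l' b) else 0)"
proof (cases "0 < l u")
  case True
  define l' where "l' = l(u := l u - 1)"
  let ?z = "\<forall>j<r. l' j = 0"
  have "return_series r Y l u = fps_X * (\<Sum>s\<in>UNIV. (if ?z then green (Y 0 - Y u - step_vec s) else 0)) +
     fps_X * (\<Sum>s\<in>UNIV. \<Sum>b<r. green (Y b - Y u - step_vec s) * return_series r Y l' b)"
  proof -
    have "return_series r Y l u = fps_X * (\<Sum>s\<in>UNIV. visit_series r Y l' (Y u + step_vec s))"
      using True by (simp only: return_series_def l'_def if_True)
    then show ?thesis
      by (simp only: visit_series_eq[OF Y] sum.distrib distrib_left diff_diff_eq)
  qed
  also have "fps_X * (\<Sum>s\<in>(UNIV :: 'd step set). (if ?z then green (Y 0 - Y u - step_vec s) else 0)) =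
      (if ?z then h_series (Y 0 - Y u) else 0)"
  proof (cases ?z)
    case False
    then have z: "?z = False" by simp
    show ?thesis unfolding z by simp
  qed (simp add: h_series_rec)
  also have "fps_X * (\<Sum>s\<in>(UNIV :: 'd step set). \<Sum>b<r. green (Y b - Y u - step_vec s) * return_series r Y l' b) =
      (\<Sum>b<r. h_series (Y b - Y u) * return_series r Y l' b)"
  proof -
    have "(\<Sum>s\<in>(UNIV :: 'd step set). \<Sum>b<r. green (Y b - Y u - step_vec s) * return_series r Y l' b) =
        (\<Sum>b<r. (\<Sum>s\<in>UNIV. green (Y b - Y u - step_vec s)) * return_series r Y l' b)"
      by (subst sum.swap) (simp only: sum_distrib_right)
    moreover have "fps_X * (\<Sum>b<r. A b * R b) = (\<Sum>b<r. fps_X * A b * R b)" for A R :: "nat \<Rightarrow> complex fps"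
      by (simp only: sum_distrib_left mult.assoc)
    ultimately show ?thesis by (simp only: h_series_rec)
  qed
  also have "(if ?z then h_series (Y 0 - Y u) else 0) + (\<Sum>b<r. h_series (Y b - Y u) * return_series r Y l' b) =
      (\<Sum>b<r. h_series (Y b - Y u) * (if ?z then of_bool (b = 0) else return_series r Y l' b))"
  proof (cases ?z)
    case z: True
    then have "return_series r Y l' b = 0" if "b < r" for b
      using that by (simp add: return_series_def)
    moreover have "(\<Sum>b<r. h_series (Y b - Y u) * (if ?z then of_bool (b = 0) else return_series r Y l' b)) =
        (\<Sum>b<r. if b = 0 then h_series (Y 0 - Y u) else 0)"
      using z by (intro sum.cong) auto
    ultimately show ?thesis using z r by simp
  next
    case False
    then have z: "?z = False" by simp
    show ?thesis unfolding z by simp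
  qed
  finally show ?thesis
    unfolding Let_def l'_def[symmetric] using True by (simp only: if_True)
qed (simp add: return_series_def)

text \<open>Both sides obey the same recursion, which spends one mark and one edge at a time.
  Without marks \<open>return_series\<close> is 0 while the empty trail counts 1 at vertex 0, hence
  the case distinction.\<close>

lemma return_series_eq_trail_series:
  fixes Y :: "nat \<Rightarrow> int ^ ('d::finite)"
  assumes Y: "inj_on Y {..<r}" and u: "u < r"
  shows "(if \<forall>j<r. l j = 0 then of_bool (u = 0) else return_series r Y l u) =
    trail_series r (\<lambda>a b. h_series (Y b - Y a)) l u"
  using u
proof (induction "\<Sum>j<r. l j" arbitrary: l u rule: less_induct)
  case less
  show ?case
  proof (cases "\<forall>j<r. l j = 0")
    case True
    then show ?thesis using less by (simp add: trail_series_zero)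
  next
    case False
    let ?l = "l(u := l u - 1)"
    have "(\<Sum>b<r. h_series (Y b - Y u) *
       (if \<forall>j<r. ?l j = 0 then of_bool (b = 0) else return_series r Y ?l b)) =
       (\<Sum>b<r. h_series (Y b - Y u) * trail_series r (\<lambda>a b. h_series (Y b - Y a)) ?l b)" if "0 < l u"
    proof (intro sum.cong refl arg_cong2[where f = times])
      fix b assume "b \<in> {..<r}"
      moreover have "(\<Sum>j<r. ?l j) < (\<Sum>j<r. l j)"
        using less.prems that by (intro sum_strict_mono_ex1) (auto intro!: bexI[of _ u])
      ultimately show "(if \<forall>j<r. ?l j = 0 then of_bool (b = 0) else return_series r Y ?l b) =
          trail_series r (\<lambda>a b. h_series (Y b - Y a)) ?l b"
        using less.hyps[of ?l b] by blast
    qed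
    moreover have "return_series r Y l u = (if 0 < l u then \<Sum>b<r. h_series (Y b - Y u) *
       (if \<forall>j<r. ?l j = 0 then of_bool (b = 0) else return_series r Y ?l b) else 0)"
      using return_series_step[OF Y, of l u] less.prems unfolding Let_def by linarith
    moreover have "trail_series r (\<lambda>a b. h_series (Y b - Y a)) l u = (if 0 < l u then
        \<Sum>b<r. h_series (Y b - Y u) * trail_series r (\<lambda>a b. h_series (Y b - Y a)) ?l b else 0)"
      using False less.prems by (intro trail_series_step) auto
    moreover have "(\<forall>j<r. l j = 0) = False" using False by simp
    ultimately show ?thesis by (simp only: if_False split: if_split) blast
  qed
qed

subsection \<open>Moving the root of a closed walk\<close>

text \<open>The starting point is free; the demand that \<open>q\<close> be visited makes the set
  finite.\<close>

definition closed_visiting :: "nat \<Rightarrow> int ^ ('d::finite) \<Rightarrow> 'd walk set" where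
  "closed_visiting n q = {(p, ss). length ss = n \<and> displacement ss = 0 \<and> q \<in> set (sites p ss)}"

definition rotate_walk :: "('d::finite) walk \<Rightarrow> 'd walk" where
  "rotate_walk w = (fst w + step_vec (hd (snd w)), rotate1 (snd w))"

lemma finite_closed_visiting: "finite (closed_visiting n (q :: int ^ ('d::finite)))"
proof (rule finite_subset)
  let ?f = "\<lambda>(i, ss :: 'd step list). (q - displacement (take i ss), ss)"
  show "closed_visiting n q \<subseteq> ?f ` ({..<n} \<times> {ss. length ss = n})"
  proof
    fix w assume "w \<in> closed_visiting n q"
    then obtain p ss i where "w = (p, ss)" "length ss = n" "i < n" "sites p ss ! i = q"
      by (auto simp: closed_visiting_def in_set_conv_nth)
    then show "w \<in> ?f ` ({..<n} \<times> {ss. length ss = n})"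
      by (intro image_eqI[of _ _ "(i, ss)"]) (auto simp: sites_nth)
  qed
  show "finite (?f ` ({..<n} \<times> {ss :: 'd step list. length ss = n}))"
    using finite_step_lists[of n "\<lambda>_. True"] by (intro finite_imageI finite_cartesian_product) simp_all
qed

lemma sites_rotate_walk:
  assumes "displacement (snd w) = 0" "snd w \<noteq> []"
  shows "sites (fst (rotate_walk w)) (snd (rotate_walk w)) = rotate1 (sites (fst w) (snd w))"
proof -
  obtain p s ss where w: "w = (p, s # ss)" using assms(2) by (metis list.exhaust prod.exhaust_sel)
  then show ?thesis using assms(1) by (simp add: rotate_walk_def sites_snoc add.assoc)
qed

lemma displacement_rotate1: "displacement (rotate1 ss) = displacement ss"
  by (cases ss) auto

lemma bij_rotate_walk:
  assumes "0 < n"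
  shows "bij_betw rotate_walk (closed_visiting n q) (closed_visiting n q)"
proof -
  have ne: "snd w \<noteq> [] \<and> displacement (snd w) = 0 \<and> length (snd w) = n" if "w \<in> closed_visiting n q" for w
    using assms that by (auto simp: closed_visiting_def)
  have into: "rotate_walk w \<in> closed_visiting n q" if "w \<in> closed_visiting n q" for w
    using sites_rotate_walk[of w] ne[OF that] that
    by (cases "rotate_walk w") (auto simp: closed_visiting_def rotate_walk_def displacement_rotate1)
  have "inj_on rotate_walk (closed_visiting n q)"
  proof (rule inj_onI)
    fix w w' assume w: "w \<in> closed_visiting n q" "w' \<in> closed_visiting n q"
      and e: "rotate_walk w = rotate_walk w'"
    have "rotate1 (snd w) = rotate1 (snd w')" using e by (simp add: rotate_walk_def)
    then have s: "snd w = snd w'"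
      using ne[OF w(1)] ne[OF w(2)] by (cases "snd w"; cases "snd w'") auto
    then show "w = w'" using e by (simp add: rotate_walk_def prod_eq_iff)
  qed
  moreover have "rotate_walk ` closed_visiting n q = closed_visiting n q"
    using into calculation by (intro endo_inj_surj finite_closed_visiting) auto
  ultimately show ?thesis by (simp add: bij_betw_def)
qed

lemma count_list_conv_sum: "count_list xs q = (\<Sum>i<length xs. of_bool (xs ! i = q))"
proof (induction xs)
  case (Cons x xs)
  then show ?case by (simp add: sum.lessThan_Suc_shift del: sum.lessThan_Suc)
qed simp

text \<open>Double counting of pairs of a walk and a time \<open>i < n\<close> at which it is at
  \<open>q\<close>: rotation by \<open>i\<close> moves this visit to the root, and for each
  \<open>i\<close> it is a bijection.\<close>

lemma sum_rotation:
  fixes f :: "('d::finite) walk \<Rightarrow> complex"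
  assumes n: "0 < n"
    and f: "\<And>w. w \<in> closed_visiting n q \<Longrightarrow> f (rotate_walk w) = f w"
  shows "(\<Sum>w\<in>closed_visiting n q. of_nat (count_list (sites (fst w) (snd w)) q) * f w) =
    of_nat n * (\<Sum>w\<in>closed_visiting n q. of_bool (fst w = q) * f w)"
proof -
  let ?S = "closed_visiting n q :: 'd walk set"
  define g where "g w = of_bool (fst w = q) * f w" for w
  have pow: "(rotate_walk ^^ i) w \<in> ?S \<and> f ((rotate_walk ^^ i) w) = f w \<and>
      sites (fst ((rotate_walk ^^ i) w)) (snd ((rotate_walk ^^ i) w)) = rotate i (sites (fst w) (snd w))"
    if "w \<in> ?S" for w i
  proof (induction i)
    case (Suc i)
    let ?w = "(rotate_walk ^^ i) w"
    have "?w \<in> ?S" using Suc by simp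
    then have "displacement (snd ?w) = 0" "snd ?w \<noteq> []"
      using n by (auto simp: closed_visiting_def)
    then show ?case
      using Suc f[of ?w] sites_rotate_walk[of ?w] bij_betwE[OF bij_rotate_walk[OF n, of q]] by auto
  qed (use that in simp)
  have site: "of_bool (sites (fst w) (snd w) ! i = q) * f w = g ((rotate_walk ^^ i) w)"
    if "w \<in> ?S" "i < n" for w i
  proof -
    let ?w = "(rotate_walk ^^ i) w"
    have "length (sites (fst w) (snd w)) = n" "length (snd ?w) = n"
      using that pow[OF that(1), of i] by (auto simp: closed_visiting_def)
    moreover from this have "fst ?w = sites (fst ?w) (snd ?w) ! 0"
      using n by (subst sites_nth) auto
    ultimately have "fst ?w = sites (fst w) (snd w) ! i"
      using pow[OF that(1), of i] that(2) n by (simp add: nth_rotate)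
    then show ?thesis using pow[OF that(1), of i] by (simp add: g_def)
  qed
  have "(\<Sum>w\<in>?S. of_nat (count_list (sites (fst w) (snd w)) q) * f w) =
      (\<Sum>w\<in>?S. \<Sum>i<n. of_bool (sites (fst w) (snd w) ! i = q) * f w)"
    by (intro sum.cong refl) (auto simp: count_list_conv_sum closed_visiting_def sum_distrib_right)
  also have "\<dots> = (\<Sum>i<n. \<Sum>w\<in>?S. g ((rotate_walk ^^ i) w))"
    by (subst sum.swap) (intro sum.cong refl, simp add: site)
  also have "\<dots> = (\<Sum>i<n. \<Sum>w\<in>?S. g w)"
    using bij_betw_funpow[OF bij_rotate_walk[OF n, of q]]
    by (intro sum.cong refl sum.reindex_bij_betw)
  finally show ?thesis by (simp add: g_def)
qed

text \<open>The root is itself a marked visit: \<open>tl\<close> drops it, and the other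
  \<open>l 0 - 1\<close> marks go to later visits.\<close>

lemma return_series_nth:
  fixes Y :: "nat \<Rightarrow> int ^ ('d::finite)"
  assumes "0 < n" "0 < l 0"
  shows "fps_nth (return_series r Y l 0) n =
    (\<Sum>ss | length ss = n \<and> displacement ss = 0. visit_weight r Y (l(0 := l 0 - 1)) (tl (sites (Y 0) ss)))"
proof -
  obtain m where n: "n = Suc m" using assms(1) gr0_implies_Suc by blast
  have "(\<Sum>ss | length ss = n \<and> displacement ss = (0 :: int ^ 'd).
      visit_weight r Y (l(0 := l 0 - 1)) (tl (sites (Y 0) ss))) =
      (\<Sum>s\<in>UNIV. \<Sum>ss | length ss = m \<and> Y 0 + step_vec s + displacement ss = Y 0.
        visit_weight r Y (l(0 := l 0 - 1)) (sites (Y 0 + step_vec s) ss))"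
    unfolding n by (simp add: sum_step_lists_Suc[where Q = "\<lambda>ss. displacement ss = 0"] add.assoc)
  then show ?thesis
    using assms n by (simp add: return_series_def visit_series_def fps_sum_nth)
qed

text \<open>The identity l C(c, l) = c C(c - 1, l - 1), with \<open>c\<close> the number of visits
  to \<open>Y 0\<close>, singles out one visit and leaves a rotation-invariant weight
  \<open>f\<close>. After \<open>sum_rotation\<close> this is the weight in
  \<open>return_series_nth\<close>.\<close>

lemma sum_visit_weight:
  fixes Y :: "nat \<Rightarrow> int ^ ('d::finite)"
  assumes Y: "inj_on Y {..<r}" and r: "0 < r" and n: "0 < n" and l: "0 < l 0"
  shows "of_nat (l 0) * (\<Sum>(p, ss)\<in>closed_visiting n (Y 0). visit_weight r Y l (sites p ss)) =
    of_nat n * fps_nth (trail_series r (\<lambda>a b. h_series (Y b - Y a)) l 0) n"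
proof -
  let ?S = "closed_visiting n (Y 0) :: 'd walk set"
  let ?c = "\<lambda>w j. count_list (sites (fst w) (snd w)) (Y j)"
  define f where "f w = of_nat ((?c w 0 - 1) choose (l 0 - 1)) *
      (\<Prod>j\<in>{..<r} - {0}. of_nat (?c w j choose l j) :: complex)" for w
  have rem: "(\<Prod>j<r. g j) = g 0 * (\<Prod>j\<in>{..<r} - {0}. g j)" for g :: "nat \<Rightarrow> complex"
    using r by (intro prod.remove) auto
  have pos: "0 < ?c w 0" if "w \<in> ?S" for w
    using that by (auto simp: closed_visiting_def count_list_0_iff intro!: gr0I)
  have rot: "f (rotate_walk w) = f w" if "w \<in> ?S" for w
  proof -
    have "displacement (snd w) = 0" "snd w \<noteq> []" using that n by (auto simp: closed_visiting_def)
    moreover have "count_list (rotate1 xs) x = count_list xs x" for xs and x :: "int ^ 'd"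
      by (cases xs) auto
    ultimately show ?thesis by (simp add: f_def sites_rotate_walk)
  qed
  have "of_nat (l 0) * (\<Sum>(p, ss)\<in>?S. visit_weight r Y l (sites p ss)) =
      (\<Sum>w\<in>?S. of_nat (?c w 0) * f w)"
    unfolding sum_distrib_left
  proof (rule sum.cong)
    fix w assume w: "w \<in> ?S"
    have "l 0 * (?c w 0 choose l 0) = ?c w 0 * ((?c w 0 - 1) choose (l 0 - 1))"
      using l pos[OF w] by (metis times_binomial_minus1_eq)
    then have "of_nat (l 0) * of_nat (?c w 0 choose l 0) =
        (of_nat (?c w 0) * of_nat ((?c w 0 - 1) choose (l 0 - 1)) :: complex)"
      by (simp flip: of_nat_mult)
    then show "of_nat (l 0) * (case w of (p, ss) \<Rightarrow> visit_weight r Y l (sites p ss)) =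
        of_nat (?c w 0) * f w"
      unfolding visit_weight_def case_prod_beta f_def
      by (subst rem) (simp only: mult.assoc[symmetric])
  qed simp
  also have "\<dots> = of_nat n * (\<Sum>w\<in>?S. of_bool (fst w = Y 0) * f w)"
    by (rule sum_rotation[OF n]) (rule rot)
  also have "(\<Sum>w\<in>?S. of_bool (fst w = Y 0) * f w) =
      (\<Sum>ss | length ss = n \<and> displacement ss = 0. f (Y 0, ss))"
  proof -
    have "(\<Sum>w\<in>?S. of_bool (fst w = Y 0) * f w) = (\<Sum>w\<in>{w\<in>?S. fst w = Y 0}. f w)"
      using finite_closed_visiting by (intro sum.mono_neutral_cong_right) auto
    also have "\<dots> = (\<Sum>ss | length ss = n \<and> displacement ss = 0. f (Y 0, ss))"
    proof (rule sum.reindex_bij_witness[of _ "\<lambda>ss. (Y 0, ss)" snd])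
      fix ss :: "'d step list" assume "ss \<in> {ss. length ss = n \<and> displacement ss = 0}"
      then show "(Y 0, ss) \<in> {w \<in> ?S. fst w = Y 0}"
        using n by (cases ss) (auto simp: closed_visiting_def)
    qed (auto simp: closed_visiting_def)
    finally show ?thesis .
  qed
  also have "\<dots> = fps_nth (return_series r Y l 0) n"
    unfolding return_series_nth[where Y = Y and l = l, OF n l]
  proof (rule sum.cong)
    fix ss :: "'d step list" assume "ss \<in> {ss. length ss = n \<and> displacement ss = 0}"
    then obtain s ss' where ss: "ss = s # ss'" using n by (cases ss) auto
    let ?xs = "sites (Y 0 + step_vec s) ss'"
    have "visit_weight r Y (l(0 := l 0 - 1)) ?xs = of_nat (count_list ?xs (Y 0) choose (l 0 - 1)) *
        (\<Prod>j\<in>{..<r} - {0}. of_nat (count_list ?xs (Y j) choose l j))"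
      unfolding visit_weight_def
      by (subst rem) (auto intro!: arg_cong2[where f = times] prod.cong)
    moreover have "Y 0 \<noteq> Y j" if "j \<in> {..<r} - {0}" for j
      using that Y r by (auto simp: inj_on_def)
    ultimately show "f (Y 0, ss) = visit_weight r Y (l(0 := l 0 - 1)) (tl (sites (Y 0) ss))"
      by (simp add: f_def ss)
  qed simp
  also have "return_series r Y l 0 = trail_series r (\<lambda>a b. h_series (Y b - Y a)) l 0"
  proof -
    have "(\<forall>j<r. l j = 0) = False" using l r by auto
    then show ?thesis using return_series_eq_trail_series[OF Y r, of l] by (simp only: if_False)
  qed
  finally show ?thesis .
qed

text \<open>The matrix of binomials is inverted by the same matrix with alternating signs. The bound
  \<open>L\<close> makes the range of summation independent of \<open>v\<close>.\<close>

lemma binomial_indicator: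
  assumes "v \<le> L"
  shows "(\<Sum>l\<le>L. (-1) ^ (l + k) * of_nat (l choose k) * of_nat (v choose l)) = (of_bool (v = k) :: complex)"
proof (cases "k \<le> v")
  case False
  then show ?thesis by (intro sum.neutral[THEN trans]) (auto simp: binomial_eq_0_iff not_le)
next
  case True
  have "(\<Sum>l\<le>L. (-1) ^ (l + k) * of_nat (l choose k) * of_nat (v choose l)) =
      (\<Sum>l=k..v. (-1) ^ (l + k) * of_nat (l choose k) * (of_nat (v choose l) :: complex))"
    using assms by (intro sum.mono_neutral_right) (auto simp: not_le)
  also have "\<dots> = (\<Sum>i\<le>v - k. (-1) ^ i * of_nat ((v - k) choose i) * of_nat (v choose k))"
  proof (rule sum.reindex_bij_witness[of _ "\<lambda>i. i + k" "\<lambda>l. l - k"])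
    fix l assume l: "l \<in> {k..v}"
    then have "(v choose l) * (l choose k) = (v choose k) * ((v - k) choose (l - k))"
      by (intro choose_mult) auto
    then have "of_nat (l choose k) * of_nat (v choose l) =
        (of_nat ((v - k) choose (l - k)) * of_nat (v choose k) :: complex)"
      by (metis of_nat_mult mult.commute)
    moreover have "(-1) ^ (l - k) = ((-1) ^ (l + k) :: complex)"
      using l by (simp add: uminus_power_if)
    ultimately show "(-1) ^ (l - k) * of_nat ((v - k) choose (l - k)) * of_nat (v choose k) =
        (-1) ^ (l + k) * of_nat (l choose k) * (of_nat (v choose l) :: complex)"
      by (simp only: mult.assoc)
  qed (use True in auto)
  also have "\<dots> = of_bool (v = k)"
  proof (cases "v = k")
    case False
    then have "(\<Sum>i\<le>v - k. (-1) ^ i * of_nat ((v - k) choose i)) = (0 :: complex)"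
      using True by (intro choose_alternating_sum) auto
    then show ?thesis using False by (simp flip: sum_distrib_right)
  qed simp
  finally show ?thesis .
qed

subsection \<open>Separating the diagonal of the transition matrix\<close>

text \<open>A loop at \<open>a\<close> raises \<open>l a\<close> and \<open>G (a, a)\<close> alike,
  and only their difference \<open>hs ! a\<close> enters the matrix. The unit row 0 reduces the
  determinant to the cofactor at (0, 0).\<close>

lemma det_tree_mat_eq_cof:
  assumes r: "0 < r" "length hs = r" and F: "F \<in> H hs" and l: "\<And>j. j < r \<Longrightarrow> 0 < l j"
    and G: "\<And>a b. a < r \<Longrightarrow> b < r \<Longrightarrow> G (a, b) = (if a = b then l a - hs ! a else F $$ (a, b))"
    and hl: "\<And>j. j < r \<Longrightarrow> hs ! j \<le> l j"
  shows "det (tree_mat r l G) = cof hs F"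
proof -
  let ?A = "tree_mat r l G"
  have A: "?A \<in> carrier_mat r r" by (simp add: tree_mat_def)
  have Fc: "F \<in> carrier_mat r r" "\<And>j. j < r \<Longrightarrow> F $$ (j, j) = 0"
    using F r by (auto simp: H_def)
  have "det ?A = (\<Sum>j<r. ?A $$ (0, j) * cofactor ?A 0 j)"
    by (rule laplace_expansion_row[OF A r(1)])
  also have "\<dots> = (\<Sum>j<r. if j = 0 then cofactor ?A 0 0 else 0)"
    using r by (intro sum.cong) (auto simp: tree_mat_def)
  also have "\<dots> = cofactor ?A 0 0" using r by simp
  also have "\<dots> = cof hs F"
    unfolding cof_def
  proof (rule cofactor_cong_row[of _ r])
    fix i j assume ij: "i < r" "j < r" "i \<noteq> (0::nat)"
    then show "?A $$ (i, j) =
        (mat_diag (length hs) (\<lambda>j. int (hs ! j)) - map_mat int F) $$ (i, j)"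
      using Fc r l[of i] hl[of i] G by (auto simp: tree_mat_def of_nat_diff mat_diag_def)
  qed (use A Fc r in auto)
  finally show ?thesis .
qed

text \<open>Vertices other than 0 without edges to the rest form a block with zero row sums. This
  discards every disconnected \<open>F\<close>, and with it far away points and vertices without
  edges.\<close>

lemma cof_eq_0:
  assumes F: "F \<in> H hs" and S: "S \<subseteq> {1..<length hs}" "S \<noteq> {}"
    and out: "\<And>i j. i \<in> S \<Longrightarrow> j < length hs \<Longrightarrow> j \<notin> S \<Longrightarrow> F $$ (i, j) = 0"
    and into: "\<And>i j. i < length hs \<Longrightarrow> i \<notin> S \<Longrightarrow> j \<in> S \<Longrightarrow> F $$ (i, j) = 0"
  shows "cof hs F = 0"
proof -
  let ?r = "length hs"
  let ?C = "mat_diag ?r (\<lambda>j. int (hs ! j)) - map_mat int F"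
  \<comment> \<open>The cofactor at (0, 0) ignores row 0, so a unit vector placed there makes it a
    full determinant.\<close>
  let ?B = "mat ?r ?r (\<lambda>(i, j). if i = 0 then of_bool (j = 0) else ?C $$ (i, j))"
  have Fc: "F \<in> carrier_mat ?r ?r" "\<And>j. j < ?r \<Longrightarrow> (\<Sum>i<?r. F $$ (j, i)) = hs ! j"
    using F by (auto simp: H_def)
  have B: "?B \<in> carrier_mat ?r ?r" by simp
  have r: "0 < ?r" using S by auto
  have S': "S \<subseteq> {..<?r}" "0 \<notin> S" "finite S" using S finite_subset[OF S(1)] by auto
  have "cof hs F = cofactor ?B 0 0"
    unfolding cof_def using Fc by (intro cofactor_cong_row[of _ ?r]) auto
  also have "\<dots> = (\<Sum>j<?r. if j = 0 then cofactor ?B 0 0 else 0)" using r by simp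
  also have "\<dots> = (\<Sum>j<?r. ?B $$ (0, j) * cofactor ?B 0 j)"
    using r by (intro sum.cong) auto
  also have "\<dots> = det ?B"
    by (rule laplace_expansion_row[OF B r, symmetric])
  also have "\<dots> = 0"
  proof (rule det_eq_0_of_block[OF B S'(1) S(2)])
    fix i assume i: "i < ?r"
    show "(\<Sum>j\<in>S. ?B $$ (i, j)) = 0"
    proof (cases "i \<in> S")
      case True
      have "(\<Sum>j\<in>S. ?B $$ (i, j)) = (\<Sum>j\<in>S. (if j = i then int (hs ! i) else 0) - int (F $$ (i, j)))"
      proof (intro sum.cong refl)
        fix j assume "j \<in> S"
        then have "j < ?r" using S' by auto
        then show "?B $$ (i, j) = (if j = i then int (hs ! i) else 0) - int (F $$ (i, j))"
          using S' i True Fc(1) by (auto simp: mat_diag_def)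
      qed
      also have "\<dots> = int (hs ! i) - (\<Sum>j\<in>S. int (F $$ (i, j)))"
        using True S' by (simp add: sum_subtractf)
      also have "(\<Sum>j\<in>S. int (F $$ (i, j))) = (\<Sum>j<?r. int (F $$ (i, j)))"
        using S' out True by (intro sum.mono_neutral_left) auto
      also have "\<dots> = int (hs ! i)" using Fc(2)[OF i] by (simp flip: of_nat_sum)
      finally show ?thesis by simp
    next
      case False
      have "?B $$ (i, j) = 0" if "j \<in> S" for j
      proof -
        have "j < ?r" "j \<noteq> 0" "j \<noteq> i" using that S' False by (auto intro!: gr0I)
        then show ?thesis using i into[OF i False that] Fc(1) by (auto simp: mat_diag_def)
      qed
      then show ?thesis by (intro sum.neutral) auto
    qed
  qed
  finally show ?thesis .
qed

lemma finite_H: "finite (H hs)"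
proof (rule finite_subset)
  let ?r = "length hs"
  let ?P = "({..<?r} \<times> {..<?r}) \<rightarrow>\<^sub>E {..sum_list hs}"
  show "H hs \<subseteq> (\<lambda>f. mat ?r ?r f) ` ?P"
  proof
    fix F assume F: "F \<in> H hs"
    have "F $$ (a, b) \<le> sum_list hs" if "a < ?r" "b < ?r" for a b
    proof -
      have "F $$ (a, b) \<le> (\<Sum>b<?r. F $$ (a, b))" using that by (intro member_le_sum) auto
      also have "\<dots> = hs ! a" using F that by (auto simp: H_def)
      also have "\<dots> \<le> sum_list hs" using that by (intro member_le_sum_list) auto
      finally show ?thesis .
    qed
    then have "restrict (\<lambda>p. F $$ p) ({..<?r} \<times> {..<?r}) \<in> ?P" by auto
    moreover have "F = mat ?r ?r (restrict (\<lambda>p. F $$ p) ({..<?r} \<times> {..<?r}))"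
      using F by (intro eq_matI) (auto simp: H_def)
    ultimately show "F \<in> (\<lambda>f. mat ?r ?r f) ` ?P" by blast
  qed
  show "finite ((\<lambda>f. mat ?r ?r f) ` ?P)" by (intro finite_imageI finite_PiE) auto
qed

lemma prod_diagonal_split:
  fixes u :: "nat \<Rightarrow> 'a :: comm_monoid_mult"
  assumes "\<And>a. a < r \<Longrightarrow> v a a = 1"
  shows "(\<Prod>(a, b)\<in>{..<r} \<times> {..<r}. if a = b then u a else v a b) =
    (\<Prod>a<r. u a) * (\<Prod>a<r. \<Prod>b<r. v a b)"
proof -
  have "(\<Prod>(a, b)\<in>{..<r} \<times> {..<r}. if a = b then u a else v a b) =
      (\<Prod>a<r. \<Prod>b<r. (if b = a then u a else 1) * v a b)"
    unfolding prod.cartesian_product[symmetric] using assms by (intro prod.cong) auto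
  also have "\<dots> = (\<Prod>a<r. u a * (\<Prod>b<r. v a b))"
    by (intro prod.cong refl) (simp add: prod.distrib)
  finally show ?thesis by (simp add: prod.distrib)
qed

definition edge_factor :: "nat \<Rightarrow> (nat \<Rightarrow> nat \<Rightarrow> complex fps) \<Rightarrow> nat mat \<Rightarrow> complex fps" where
  "edge_factor r x F = (\<Prod>a<r. \<Prod>b<r. fps_const (1 / fact (F $$ (a, b))) * x a b ^ F $$ (a, b))"

definition bounded_lists :: "nat \<Rightarrow> nat \<Rightarrow> nat list set" where
  "bounded_lists r L = {hs. length hs = r \<and> (\<forall>j<r. hs ! j \<le> L)}"

lemma finite_bounded_lists: "finite (bounded_lists r L)"
  by (rule finite_subset[OF _ finite_lists_length_eq[of "{..L}" r]])
     (auto simp: bounded_lists_def in_set_conv_nth)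

lemma fps_const_prod: "fps_const (prod f S) = (\<Prod>s\<in>S. fps_const (f s))"
  by (induction S rule: infinite_finite_induct) (auto simp flip: fps_const_mult)

text \<open>\<open>hs ! a\<close> counts the departures from \<open>a\<close> to other vertices and
  \<open>l a - hs ! a\<close> the loops. Balance survives because a loop counts in both
  degrees.\<close>

lemma transitions_eq_image:
  fixes l :: "nat \<Rightarrow> nat" and r :: nat
  defines "\<phi> \<equiv> \<lambda>(hs :: nat list, F :: nat mat).
    restrict (\<lambda>(a, b). if a = b then l a - hs ! a else F $$ (a, b)) ({..<r} \<times> {..<r})"
  defines "\<psi> \<equiv> \<lambda>G :: nat \<times> nat \<Rightarrow> nat. (map (\<lambda>j. l j - G (j, j)) [0..<r],
    mat r r (\<lambda>(a, b). if a = b then 0 else G (a, b)))"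
  defines "T \<equiv> Sigma {hs. length hs = r \<and> (\<forall>j<r. hs ! j \<le> l j)} H"
  shows "bij_betw \<phi> T (transitions r l 0)"
proof (rule bij_betw_byWitness[of _ \<psi>])
  show "\<forall>t\<in>T. \<psi> (\<phi> t) = t"
    by (auto simp: T_def \<phi>_def \<psi>_def H_def intro!: nth_equalityI eq_matI)
  have diag: "G (j, j) \<le> l j" if "G \<in> transitions r l 0" "j < r" for G j
  proof -
    have "G (j, j) \<le> (\<Sum>b<r. G (j, b))" using that by (intro member_le_sum) auto
    then show ?thesis using that by (auto simp: transitions_def)
  qed
  show "\<forall>G\<in>transitions r l 0. \<phi> (\<psi> G) = G"
  proof (intro ballI ext)
    fix G p assume G: "G \<in> transitions r l 0"
    then show "\<phi> (\<psi> G) p = G p"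
      using diag[OF G] by (auto simp: \<phi>_def \<psi>_def transitions_def PiE_iff extensional_def split: prod.splits)
  qed
  show "\<phi> ` T \<subseteq> transitions r l 0"
  proof
    fix G assume "G \<in> \<phi> ` T"
    then obtain hs F where G: "G = \<phi> (hs, F)" and hs: "length hs = r" "\<forall>j<r. hs ! j \<le> l j"
      and F: "F \<in> H hs" by (auto simp: T_def)
    have "(\<Sum>b<r. G (a, b)) = l a" if a: "a < r" for a
    proof -
      have "(\<Sum>b<r. G (a, b)) = (\<Sum>b<r. F $$ (a, b) + (if b = a then l a - hs ! a else 0))"
        using F hs a by (intro sum.cong) (auto simp: G \<phi>_def H_def)
      then show ?thesis using F hs a by (simp add: sum.distrib H_def)
    qed
    moreover have "(\<Sum>b<r. G (b, a)) = l a" if a: "a < r" for a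
    proof -
      have "(\<Sum>b<r. G (b, a)) = (\<Sum>b<r. F $$ (b, a) + (if b = a then l a - hs ! a else 0))"
        using F hs a by (intro sum.cong) (auto simp: G \<phi>_def H_def)
      then show ?thesis using F hs a by (simp add: sum.distrib H_def)
    qed
    moreover have "G \<in> ({..<r} \<times> {..<r}) \<rightarrow>\<^sub>E UNIV"
      unfolding G \<phi>_def prod.case by (simp add: PiE_iff)
    ultimately show "G \<in> transitions r l 0" by (simp add: transitions_def)
  qed
  show "\<psi> ` transitions r l 0 \<subseteq> T"
  proof
    fix t assume "t \<in> \<psi> ` transitions r l 0"
    then obtain G where t: "t = \<psi> G" and G: "G \<in> transitions r l 0" by blast
    have row: "(\<Sum>b<r. G (a, b)) = l a" and col: "(\<Sum>b<r. G (b, a)) = l a" if "a < r" for a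
      using G that by (auto simp: transitions_def)
    have "(\<Sum>b<r. if a = b then 0 else G (a, b)) = l a - G (a, a)" if a: "a < r" for a
    proof -
      have "(\<Sum>b<r. G (a, b)) = G (a, a) + (\<Sum>b\<in>{..<r} - {a}. G (a, b))"
        using a by (intro sum.remove) auto
      also have "(\<Sum>b\<in>{..<r} - {a}. G (a, b)) = (\<Sum>b<r. if a = b then 0 else G (a, b))"
        by (intro sum.mono_neutral_cong_left) auto
      finally show ?thesis using row[OF a] by simp
    qed
    moreover have "(\<Sum>b<r. if b = a then 0 else G (b, a)) = l a - G (a, a)" if a: "a < r" for a
    proof -
      have "(\<Sum>b<r. G (b, a)) = G (a, a) + (\<Sum>b\<in>{..<r} - {a}. G (b, a))"
        using a by (intro sum.remove) auto
      also have "(\<Sum>b\<in>{..<r} - {a}. G (b, a)) = (\<Sum>b<r. if b = a then 0 else G (b, a))"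
        by (intro sum.mono_neutral_cong_left) auto
      finally show ?thesis using col[OF a] by simp
    qed
    ultimately show "t \<in> T"
      by (auto simp: t T_def \<psi>_def H_def cong: if_cong)
  qed
qed

text \<open>Division by \<open>l 0\<close> makes \<open>fact (l 0)\<close> into
  \<open>fact (l 0 - 1)\<close>, so vertex 0 is treated like the others and the weight splits into
  edges and one factor per vertex. With all \<open>l j\<close> positive, row 0 is the only
  exceptional row of \<open>tree_mat\<close>.\<close>

lemma trail_series_conv_edges:
  assumes r: "0 < r" and l: "\<And>j. j < r \<Longrightarrow> 0 < l j"
  shows "fps_const (1 / of_nat (l 0)) * trail_series r x l 0 =
    (\<Sum>hs | length hs = r \<and> (\<forall>j<r. hs ! j \<le> l j). \<Sum>F\<in>H hs. of_int (cof hs F) * edge_factor r x F *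
      (\<Prod>j<r. fps_const (fact (l j - 1) / fact (l j - hs ! j)) * x j j ^ (l j - hs ! j)))"
proof -
  let ?hs = "{hs. length hs = r \<and> (\<forall>j<r. hs ! j \<le> l j)}"
  define \<phi> where "\<phi> = (\<lambda>(hs :: nat list, F :: nat mat).
    restrict (\<lambda>(a, b). if a = b then l a - hs ! a else F $$ (a, b)) ({..<r} \<times> {..<r}))"
  have fin: "finite ?hs"
    by (rule finite_subset[OF _ finite_bounded_lists[of r "\<Sum>j<r. l j"]])
       (auto simp: bounded_lists_def intro!: order_trans[OF _ member_le_sum])
  have "fps_const (1 / of_nat (l 0)) * trail_series r x l 0 =
      (\<Sum>G\<in>transitions r l 0. fps_const (1 / of_nat (l 0)) *
       (fps_const (of_int (trail_weight r l G) / (\<Prod>p\<in>{..<r} \<times> {..<r}. fact (G p))) *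
       (\<Prod>(a, b)\<in>{..<r} \<times> {..<r}. x a b ^ G (a, b))))"
    unfolding trail_series_def sum_distrib_left ..
  also have "\<dots> = (\<Sum>t\<in>Sigma ?hs H. fps_const (1 / of_nat (l 0)) *
       (fps_const (of_int (trail_weight r l (\<phi> t)) / (\<Prod>p\<in>{..<r} \<times> {..<r}. fact (\<phi> t p))) *
       (\<Prod>(a, b)\<in>{..<r} \<times> {..<r}. x a b ^ \<phi> t (a, b))))"
    by (rule sum.reindex_bij_betw[symmetric])
       (use transitions_eq_image[of l r] in \<open>simp add: \<phi>_def\<close>)
  also have "\<dots> = (\<Sum>(hs, F)\<in>Sigma ?hs H. of_int (cof hs F) * edge_factor r x F *
      (\<Prod>j<r. fps_const (fact (l j - 1) / fact (l j - hs ! j)) * x j j ^ (l j - hs ! j)))"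
  proof (rule sum.cong)
    fix t assume "t \<in> Sigma ?hs H"
    then obtain hs F where t: "t = (hs, F)" and hs: "length hs = r" "\<And>j. j < r \<Longrightarrow> hs ! j \<le> l j"
      and F: "F \<in> H hs" by auto
    let ?G = "\<phi> (hs, F)"
    have G: "?G (a, b) = (if a = b then l a - hs ! a else F $$ (a, b))" if "a < r" "b < r" for a b
      using that by (simp add: \<phi>_def)
    have F0: "F $$ (a, a) = 0" if "a < r" for a using F hs that by (simp add: H_def)
    have "(\<Prod>p\<in>{..<r} \<times> {..<r}. fact (?G p)) =
        (\<Prod>(a, b)\<in>{..<r} \<times> {..<r}. if a = b then fact (l a - hs ! a) else fact (F $$ (a, b)) :: complex)"
      by (intro prod.cong) (auto simp: G)
    then have q: "(\<Prod>p\<in>{..<r} \<times> {..<r}. fact (?G p)) =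
        (\<Prod>j<r. fact (l j - hs ! j)) * (\<Prod>a<r. \<Prod>b<r. fact (F $$ (a, b)) :: complex)"
      using F0 by (simp add: prod_diagonal_split)
    have "(\<Prod>(a, b)\<in>{..<r} \<times> {..<r}. x a b ^ ?G (a, b)) =
        (\<Prod>(a, b)\<in>{..<r} \<times> {..<r}. if a = b then x a a ^ (l a - hs ! a) else x a b ^ F $$ (a, b))"
      by (intro prod.cong) (auto simp: G)
    then have m: "(\<Prod>(a, b)\<in>{..<r} \<times> {..<r}. x a b ^ ?G (a, b)) =
        (\<Prod>j<r. x j j ^ (l j - hs ! j)) * (\<Prod>a<r. \<Prod>b<r. x a b ^ F $$ (a, b))"
      using F0 by (simp add: prod_diagonal_split)
    have "(\<Prod>j<r. fact (l j - 1)) = fact (l 0 - 1) * (\<Prod>j\<in>{1..<r}. fact (l j - 1) :: int)"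
    proof -
      have "{..<r} - {0} = {1..<r}" by auto
      then show ?thesis using r prod.remove[of "{..<r}" 0 "\<lambda>j. fact (l j - 1) :: int"] by simp
    qed
    moreover have "fact (l 0) = int (l 0) * fact (l 0 - 1)" using l[OF r] by (simp add: fact_reduce)
    ultimately have w: "trail_weight r l ?G = int (l 0) * (cof hs F * (\<Prod>j<r. fact (l j - 1)))"
      using det_tree_mat_eq_cof[OF r hs(1) F l G hs(2)] by (simp add: trail_weight_def)
    have e: "edge_factor r x F = fps_const (1 / (\<Prod>a<r. \<Prod>b<r. fact (F $$ (a, b)))) *
        (\<Prod>a<r. \<Prod>b<r. x a b ^ F $$ (a, b))"
      by (simp add: edge_factor_def prod.distrib fps_const_prod[symmetric] prod_dividef)
    have v: "(\<Prod>j<r. fps_const (fact (l j - 1) / fact (l j - hs ! j)) * x j j ^ (l j - hs ! j)) =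
        fps_const ((\<Prod>j<r. fact (l j - 1)) / (\<Prod>j<r. fact (l j - hs ! j))) *
        (\<Prod>j<r. x j j ^ (l j - hs ! j))"
      by (simp add: prod.distrib fps_const_prod[symmetric] prod_dividef)
    have c: "1 / of_nat (l 0) * (of_int (trail_weight r l ?G) / (\<Prod>p\<in>{..<r} \<times> {..<r}. fact (?G p))) =
        of_int (cof hs F) * (1 / (\<Prod>a<r. \<Prod>b<r. fact (F $$ (a, b)))) *
        ((\<Prod>j<r. fact (l j - 1)) / (\<Prod>j<r. fact (l j - hs ! j)) :: complex)"
      unfolding w q using l[OF r] by (simp add: of_int_prod)
    show "fps_const (1 / of_nat (l 0)) *
       (fps_const (of_int (trail_weight r l (\<phi> t)) / (\<Prod>p\<in>{..<r} \<times> {..<r}. fact (\<phi> t p))) *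
       (\<Prod>(a, b)\<in>{..<r} \<times> {..<r}. x a b ^ \<phi> t (a, b))) =
      (case t of (hs, F) \<Rightarrow> of_int (cof hs F) * edge_factor r x F *
      (\<Prod>j<r. fps_const (fact (l j - 1) / fact (l j - hs ! j)) * x j j ^ (l j - hs ! j)))"
      unfolding t prod.case m e v mult.assoc[symmetric] fps_const_mult c
      by (simp only: fps_const_mult[symmetric] fps_of_int mult_ac)
  qed simp
  also have "\<dots> = (\<Sum>hs\<in>?hs. \<Sum>F\<in>H hs. of_int (cof hs F) * edge_factor r x F *
      (\<Prod>j<r. fps_const (fact (l j - 1) / fact (l j - hs ! j)) * x j j ^ (l j - hs ! j)))"
    by (rule sum.Sigma[symmetric]) (use fin finite_H in auto)
  finally show ?thesis .
qed

subsection \<open>Walks with prescribed visit numbers at given points\<close>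

definition visit_tuples ::
  "nat \<Rightarrow> nat \<Rightarrow> (nat \<Rightarrow> int ^ ('d::finite)) \<Rightarrow> (nat \<Rightarrow> nat) \<Rightarrow> 'd walk set" where
  "visit_tuples n r Y k = {(p, ss). length ss = n \<and> displacement ss = 0 \<and>
     (\<forall>j<r. count_list (sites p ss) (Y j) = k j)}"

lemma visit_tuples_subset:
  assumes "0 < r" "0 < k 0"
  shows "visit_tuples n r Y k \<subseteq> closed_visiting n (Y 0)"
proof
  fix w assume w: "w \<in> visit_tuples n r Y k"
  then have "count_list (sites (fst w) (snd w)) (Y 0) \<noteq> 0"
    using assms by (auto simp: visit_tuples_def)
  then have "Y 0 \<in> set (sites (fst w) (snd w))" by (simp add: count_list_0_iff)
  then show "w \<in> closed_visiting n (Y 0)"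
    using w by (auto simp: visit_tuples_def closed_visiting_def)
qed

text \<open>\<open>binomial_indicator\<close> is applied at each \<open>Y j\<close> and the product
  is expanded over the tuples \<open>l\<close> of mark numbers. A walk of length \<open>n\<close>
  visits a point at most \<open>n\<close> times, so any \<open>L >= n\<close> suffices.\<close>

lemma card_visit_tuples:
  fixes Y :: "nat \<Rightarrow> int ^ ('d::finite)"
  assumes Y: "inj_on Y {..<r}" and r: "0 < r" and n: "0 < n" and k: "\<And>j. j < r \<Longrightarrow> 0 < k j"
    and L: "n \<le> L"
  shows "of_nat (card (visit_tuples n r Y k)) = of_nat n *
    (\<Sum>l\<in>{..<r} \<rightarrow>\<^sub>E {..L}. (\<Prod>j<r. (-1) ^ (l j + k j) * of_nat (l j choose k j)) *
      fps_nth (fps_const (1 / of_nat (l 0)) * trail_series r (\<lambda>a b. h_series (Y b - Y a)) l 0) n :: complex)"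
proof -
  let ?S = "closed_visiting n (Y 0) :: 'd walk set"
  let ?c = "\<lambda>w j. count_list (sites (fst w) (snd w)) (Y j)"
  let ?a = "\<lambda>j l. (-1) ^ (l + k j) * of_nat (l choose k j) :: complex"
  let ?t = "\<lambda>l. trail_series r (\<lambda>a b. h_series (Y b - Y a)) l 0"
  have c: "?c w j \<le> L" if "w \<in> ?S" for w j
    using that L count_le_length[of "sites (fst w) (snd w)" "Y j"] by (auto simp: closed_visiting_def)
  have "visit_tuples n r Y k = {w\<in>?S. \<forall>j<r. ?c w j = k j}"
    using visit_tuples_subset[of r k n Y] r k[OF r] by (auto simp: visit_tuples_def closed_visiting_def)
  then have "of_nat (card (visit_tuples n r Y k)) = (\<Sum>w\<in>{w\<in>?S. \<forall>j<r. ?c w j = k j}. 1 :: complex)"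
    by simp
  also have "\<dots> = (\<Sum>w\<in>?S. \<Prod>j<r. of_bool (?c w j = k j))"
    using finite_closed_visiting by (intro sum.mono_neutral_cong_left) auto
  also have "\<dots> = (\<Sum>w\<in>?S. \<Prod>j<r. \<Sum>l\<le>L. ?a j l * of_nat (?c w j choose l))"
    using c by (intro sum.cong prod.cong refl) (simp add: binomial_indicator)
  also have "\<dots> = (\<Sum>w\<in>?S. \<Sum>l\<in>{..<r} \<rightarrow>\<^sub>E {..L}. \<Prod>j<r. ?a j (l j) * of_nat (?c w j choose l j))"
    by (intro sum.cong refl prod_sum_PiE) auto
  also have "\<dots> = (\<Sum>l\<in>{..<r} \<rightarrow>\<^sub>E {..L}. (\<Prod>j<r. ?a j (l j)) *
      (\<Sum>(p, ss)\<in>?S. visit_weight r Y l (sites p ss)))"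
    by (subst sum.swap) (simp add: prod.distrib visit_weight_def sum_distrib_left case_prod_beta)
  also have "\<dots> = (\<Sum>l\<in>{..<r} \<rightarrow>\<^sub>E {..L}. of_nat n * ((\<Prod>j<r. ?a j (l j)) *
      fps_nth (fps_const (1 / of_nat (l 0)) * ?t l) n))"
  proof (intro sum.cong refl)
    fix l
    show "(\<Prod>j<r. ?a j (l j)) * (\<Sum>(p, ss)\<in>?S. visit_weight r Y l (sites p ss)) =
        of_nat n * ((\<Prod>j<r. ?a j (l j)) * fps_nth (fps_const (1 / of_nat (l 0)) * ?t l) n)"
    proof (cases "0 < l 0")
      case True
      have "(\<Sum>(p, ss)\<in>?S. visit_weight r Y l (sites p ss)) =
          of_nat n * fps_nth (fps_const (1 / of_nat (l 0)) * ?t l) n"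
        using sum_visit_weight[where Y = Y and l = l, OF Y r n True] True by (simp add: field_simps)
      then show ?thesis by simp
    next
      case False
      \<comment> \<open>Without a mark at \<open>Y 0\<close> there is no visit to move the root to,
        but then \<open>l 0 < k 0\<close> and the binomial in the coefficient is 0.\<close>
      then have "?a 0 (l 0) = 0" using k[OF r] by (simp add: binomial_eq_0)
      then have "(\<Prod>j<r. ?a j (l j)) = 0" using r by (intro prod_zero) auto
      then show ?thesis by (simp only: mult_zero_left mult_zero_right)
    qed
  qed
  finally show ?thesis by (simp only: sum_distrib_left)
qed

text \<open>With \<open>l = h + g\<close>, the part of \<open>vertex_fps h k oo \<omega>\<close>
  that involves at most \<open>L\<close> marks.\<close>

definition vertex_trunc :: "nat \<Rightarrow> nat \<Rightarrow> nat \<Rightarrow> complex fps \<Rightarrow> complex fps" where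
  "vertex_trunc L h k \<omega> = (\<Sum>l=h..L.
     fps_const ((-1) ^ (l + k) * of_nat (l choose k) * (fact (l - 1) / fact (l - h))) * \<omega> ^ (l - h))"

text \<open>The sums over \<open>l\<close> and over \<open>hs\<close> are interchanged. For fixed
  \<open>hs\<close> the numbers of loops at the vertices are independent, so the sum over
  \<open>l\<close> becomes a product.\<close>

lemma card_visit_tuples_edges:
  fixes Y :: "nat \<Rightarrow> int ^ ('d::finite)"
  assumes Y: "inj_on Y {..<r}" and r: "0 < r" and n: "0 < n" and k: "\<And>j. j < r \<Longrightarrow> 0 < k j"
    and L: "n \<le> L"
  defines "x \<equiv> \<lambda>a b. h_series (Y b - Y a)"
  shows "of_nat (card (visit_tuples n r Y k)) = of_nat n *
    (\<Sum>hs\<in>bounded_lists r L. \<Sum>F\<in>H hs. fps_nth (of_int (cof hs F) * edge_factor r x F *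
       (\<Prod>j<r. vertex_trunc L (hs ! j) (k j) (x j j))) n)"
proof -
  let ?P = "{..<r} \<rightarrow>\<^sub>E {..L}"
  let ?a = "\<lambda>j l. (-1) ^ (l + k j) * of_nat (l choose k j) :: complex"
  let ?v = "\<lambda>hs l j. fps_const (fact (l - 1) / fact (l - hs ! j)) * x j j ^ (l - hs ! j) :: complex fps"
  let ?b = "\<lambda>hs l j. fps_const (?a j l * (fact (l - 1) / fact (l - hs ! j))) * x j j ^ (l - hs ! j)"
  let ?c = "\<lambda>hs F. of_int (cof hs F) * edge_factor r x F"
  let ?le = "\<lambda>hs l. \<forall>j<r. hs ! j \<le> l j"
  have restrict: "{hs. length hs = r \<and> ?le hs l} = {hs\<in>bounded_lists r L. ?le hs l}" if "l \<in> ?P" for l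
    using that by (auto simp: bounded_lists_def) (metis PiE_mem atMost_iff lessThan_iff order_trans)
  have E: "(\<Prod>j<r. ?a j (l j)) * fps_nth (fps_const (1 / of_nat (l 0)) * trail_series r x l 0) n =
      (\<Sum>hs\<in>{hs\<in>bounded_lists r L. ?le hs l}. \<Sum>F\<in>H hs. fps_nth (?c hs F * (\<Prod>j<r. ?b hs (l j) j)) n)"
    if l: "l \<in> ?P" for l
  proof -
    have b: "(\<Prod>j<r. ?b hs (l j) j) = fps_const (\<Prod>j<r. ?a j (l j)) * (\<Prod>j<r. ?v hs (l j) j)" for hs
      by (simp only: fps_const_prod prod.distrib[symmetric] fps_const_mult[symmetric] mult.assoc)
    show ?thesis
    proof (cases "\<exists>j<r. l j = 0")
      case True
      then obtain j where j: "j < r" "l j = 0" by blast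
      then have "?a j (l j) = 0" using k[of j] by (simp add: binomial_eq_0)
      then have z: "(\<Prod>j<r. ?a j (l j)) = 0"
        using j k[of j] by (intro prod_zero) (auto intro!: bexI[of _ j])
      show ?thesis unfolding b z by simp
    next
      case False
      then have "\<And>j. j < r \<Longrightarrow> 0 < l j" by auto
      then have "fps_const (1 / of_nat (l 0)) * trail_series r x l 0 =
          (\<Sum>hs\<in>{hs\<in>bounded_lists r L. ?le hs l}. \<Sum>F\<in>H hs. ?c hs F * (\<Prod>j<r. ?v hs (l j) j))"
        using trail_series_conv_edges[of r l x] r restrict[OF l] by simp
      then have "(\<Prod>j<r. ?a j (l j)) * fps_nth (fps_const (1 / of_nat (l 0)) * trail_series r x l 0) n =
          (\<Sum>hs\<in>{hs\<in>bounded_lists r L. ?le hs l}. \<Sum>F\<in>H hs.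
             fps_nth (fps_const (\<Prod>j<r. ?a j (l j)) * (?c hs F * (\<Prod>j<r. ?v hs (l j) j))) n)"
        by (simp only: fps_sum_nth sum_distrib_left fps_mult_left_const_nth)
      then show ?thesis unfolding b by (simp only: mult.left_commute)
    qed
  qed
  have "of_nat (card (visit_tuples n r Y k)) = of_nat n *
      (\<Sum>l\<in>?P. (\<Prod>j<r. ?a j (l j)) * fps_nth (fps_const (1 / of_nat (l 0)) * trail_series r x l 0) n)"
    unfolding x_def by (rule card_visit_tuples) (use Y r n k L in auto)
  also have "(\<Sum>l\<in>?P. (\<Prod>j<r. ?a j (l j)) * fps_nth (fps_const (1 / of_nat (l 0)) * trail_series r x l 0) n) =
      (\<Sum>l\<in>?P. \<Sum>hs\<in>{hs\<in>bounded_lists r L. ?le hs l}. \<Sum>F\<in>H hs. fps_nth (?c hs F * (\<Prod>j<r. ?b hs (l j) j)) n)"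
    by (intro sum.cong refl E)
  also have "(\<Sum>l\<in>?P. \<Sum>hs\<in>{hs\<in>bounded_lists r L. ?le hs l}. \<Sum>F\<in>H hs. fps_nth (?c hs F * (\<Prod>j<r. ?b hs (l j) j)) n) =
      (\<Sum>hs\<in>bounded_lists r L. \<Sum>l\<in>{l\<in>?P. ?le hs l}. \<Sum>F\<in>H hs. fps_nth (?c hs F * (\<Prod>j<r. ?b hs (l j) j)) n)"
    by (rule sum.swap_restrict) (auto intro: finite_PiE finite_bounded_lists)
  also have "\<dots> = (\<Sum>hs\<in>bounded_lists r L. \<Sum>F\<in>H hs. fps_nth (?c hs F *
       (\<Prod>j<r. vertex_trunc L (hs ! j) (k j) (x j j))) n)"
  proof (intro sum.cong refl)
    fix hs assume "hs \<in> bounded_lists r L"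
    have P: "{l\<in>?P. ?le hs l} = (\<Pi>\<^sub>E j\<in>{..<r}. {hs ! j..L})"
      by (rule Set.set_eqI)
        (simp only: PiE_iff mem_Collect_eq lessThan_iff Ball_def atLeastAtMost_iff atMost_iff, blast)
    have "(\<Prod>j<r. vertex_trunc L (hs ! j) (k j) (x j j)) = (\<Sum>l\<in>{l\<in>?P. ?le hs l}. \<Prod>j<r. ?b hs (l j) j)"
      unfolding vertex_trunc_def P by (rule prod_sum_PiE) auto
    then show "(\<Sum>l\<in>{l\<in>?P. ?le hs l}. \<Sum>F\<in>H hs. fps_nth (?c hs F * (\<Prod>j<r. ?b hs (l j) j)) n) =
        (\<Sum>F\<in>H hs. fps_nth (?c hs F * (\<Prod>j<r. vertex_trunc L (hs ! j) (k j) (x j j))) n)"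
      by (subst sum.swap) (simp only: sum_distrib_left fps_sum_nth)
  qed
  finally show ?thesis .
qed

section \<open>Orders of vanishing in z, and the passage to the summands of the theorem\<close>

lemma fps_mult_agree:
  assumes "\<And>m. m \<le> n \<Longrightarrow> fps_nth f m = fps_nth g m" "\<And>m. m \<le> n \<Longrightarrow> fps_nth f' m = fps_nth g' m" "m \<le> n"
  shows "fps_nth (f * f') m = fps_nth (g * g' :: 'a :: comm_semiring_1 fps) m"
  using assms by (auto simp: fps_mult_nth intro!: sum.cong)

lemma fps_prod_agree:
  assumes "\<And>j m. j \<in> S \<Longrightarrow> m \<le> n \<Longrightarrow> fps_nth (f j) m = fps_nth (g j) m" "m \<le> n"
  shows "fps_nth (\<Prod>j\<in>S. f j) m = fps_nth (\<Prod>j\<in>S. g j :: 'a :: comm_semiring_1 fps) m"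
  using assms
proof (induction S arbitrary: m rule: infinite_finite_induct)
  case (insert j S)
  then show ?case by (simp del: fps_mult_nth_0) (rule fps_mult_agree[of n]; auto)
qed auto

text \<open>\<open>\<omega> ^ g\<close> has no coefficient below degree \<open>g\<close>, so cutting
  \<open>g\<close> off at \<open>L - h >= m\<close> is invisible at degree \<open>m\<close>.\<close>

lemma vertex_trunc_nth:
  assumes \<omega>: "fps_nth \<omega> 0 = 0" and m: "h + m \<le> L"
  shows "fps_nth (vertex_trunc L h k \<omega>) m = fps_nth (vertex_fps h k oo \<omega>) m"
proof -
  have "fps_nth (vertex_trunc L h k \<omega>) m =
      (\<Sum>l=h..L. fps_nth (vertex_fps h k) (l - h) * fps_nth (\<omega> ^ (l - h)) m)"
    by (auto simp: vertex_trunc_def fps_sum_nth vertex_fps_def intro!: sum.cong)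
  also have "\<dots> = (\<Sum>g\<in>{0..L - h}. fps_nth (vertex_fps h k) g * fps_nth (\<omega> ^ g) m)"
    using m by (intro sum.reindex_bij_witness[of _ "\<lambda>g. g + h" "\<lambda>l. l - h"]) auto
  also have "\<dots> = (\<Sum>g\<in>{0..m}. fps_nth (vertex_fps h k) g * fps_nth (\<omega> ^ g) m)"
    using m \<omega> by (intro sum.mono_neutral_right) (auto simp: startsby_zero_power_prefix)
  finally show ?thesis by (simp add: fps_compose_nth)
qed

lemma fps_X_power_dvd_nth:
  assumes "fps_X ^ N dvd (f :: 'a :: comm_ring_1 fps)" "m < N"
  shows "fps_nth f m = 0"
  using assms by (auto simp: dvd_def fps_X_power_mult_nth)

lemma h_series_nth_0: "fps_nth (h_series p) 0 = 0"
  by (simp add: h_series_rec)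

lemma fps_X_dvd_iff: "fps_X dvd f \<longleftrightarrow> fps_nth (f :: complex fps) 0 = 0"
proof
  assume "fps_nth f 0 = 0"
  then have "f = fps_X * fps_shift 1 f"
    by (intro fps_ext) (auto simp: fps_X_mult_nth)
  then show "fps_X dvd f" by (metis dvd_triv_left)
qed (auto simp: dvd_def)

lemma fps_X_power_dvd_edge_factor:
  assumes x: "\<And>a b. fps_nth (x a b) 0 = 0" and F: "F \<in> H hs" and r: "length hs = r"
  shows "fps_X ^ sum_list hs dvd edge_factor r x F"
proof -
  have "(\<Sum>a<r. \<Sum>b<r. F $$ (a, b)) = (\<Sum>a<r. hs ! a)"
    using F r by (intro sum.cong) (auto simp: H_def)
  also have "\<dots> = sum_list hs" using r by (simp add: sum_list_sum_nth atLeast0LessThan)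
  finally have "sum_list hs = (\<Sum>a<r. \<Sum>b<r. F $$ (a, b))" ..
  then have s: "fps_X ^ sum_list hs = (\<Prod>a<r. \<Prod>b<r. (fps_X :: complex fps) ^ F $$ (a, b))"
    by (simp only: power_sum)
  show ?thesis
    unfolding s edge_factor_def using x
    by (intro prod_dvd_prod dvd_mult dvd_power_same) (simp add: fps_X_dvd_iff)
qed

text \<open>The inverse powers of 1 + h(0) from row \<open>a\<close> of \<open>F\<close> have total
  exponent \<open>hs ! a\<close> and cancel against those of
  \<open>vertex_fps_compose\<close>.\<close>

lemma summand_eq:
  fixes Y :: "(int ^ ('d::finite)) list"
  assumes r: "r = length ks" "length hs = r" and F: "F \<in> H hs"
    and k: "\<forall>j<r. 0 < ks ! \<sigma> j"
  shows "summand ks \<sigma> Y hs F = of_int (cof hs F) * edge_factor r (\<lambda>a b. h_series (Y ! b - Y ! a)) F *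
    (\<Prod>j<r. vertex_fps (hs ! j) (ks ! \<sigma> j) oo h_series (0 :: int ^ 'd))"
proof -
  define h0 where "h0 = h_series (0 :: int ^ 'd)"
  let ?x = "\<lambda>a b. h_series (Y ! b - Y ! a)"
  let ?U = "1 + h0" and ?I = "inverse (1 + h0)"
  have h0: "fps_nth h0 0 = 0" by (simp add: h0_def h_series_nth_0)
  then have U: "?I * ?U = 1" by (intro inverse_mult_eq_1) simp
  have "h_series (Y ! a - Y ! b) ^ F $$ (a, b) / (?U ^ F $$ (a, b) * of_nat (fact (F $$ (a, b)))) =
      fps_const (1 / fact (F $$ (a, b))) * ?x a b ^ F $$ (a, b) * ?I ^ F $$ (a, b)" for a b
  proof -
    let ?m = "F $$ (a, b)"
    have hx: "h_series (Y ! a - Y ! b) = ?x a b" using h_series_minus[of "Y ! b - Y ! a"] by simp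
    have fc: "of_nat (fact ?m) = (fps_const (fact ?m) :: complex fps)"
      by (metis fps_of_nat of_nat_fact)
    have inv: "inverse (?U ^ ?m * fps_const (fact ?m)) = ?I ^ ?m * fps_const (1 / fact ?m)"
      by (simp add: fps_inverse_mult fps_inverse_power fps_const_inverse inverse_eq_divide)
    have nz: "fps_nth (?U ^ ?m * fps_const (fact ?m)) 0 \<noteq> 0" using h0 by simp
    show ?thesis unfolding hx fc fps_divide_unit[OF nz] inv by (simp only: mult_ac)
  qed
  then have "(\<Prod>a<r. \<Prod>b<r. h_series (Y ! a - Y ! b) ^ F $$ (a, b) /
      (?U ^ F $$ (a, b) * of_nat (fact (F $$ (a, b))))) =
      edge_factor r ?x F * (\<Prod>a<r. \<Prod>b<r. ?I ^ F $$ (a, b))"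
    by (simp add: edge_factor_def prod.distrib)
  also have "(\<Prod>a<r. \<Prod>b<r. ?I ^ F $$ (a, b)) = (\<Prod>a<r. ?I ^ hs ! a)"
    using F r by (intro prod.cong) (auto simp: H_def simp flip: power_sum)
  finally have e: "(\<Prod>a<r. \<Prod>b<r. h_series (Y ! a - Y ! b) ^ F $$ (a, b) /
      (?U ^ F $$ (a, b) * of_nat (fact (F $$ (a, b))))) =
      edge_factor r ?x F * (\<Prod>j<r. ?I ^ hs ! j)" .
  have "(\<Prod>j<r. (-1) ^ (hs ! j) * of_nat (fact (hs ! j)) * K (hs ! j) (ks ! \<sigma> j) h0) =
      (\<Prod>j<r. (vertex_fps (hs ! j) (ks ! \<sigma> j) oo h0) * ?U ^ (hs ! j))"
    using k by (intro prod.cong refl) (simp add: vertex_fps_compose[OF h0])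
  then have "(\<Prod>j<r. ?I ^ hs ! j) * (\<Prod>j<r. (-1) ^ (hs ! j) * of_nat (fact (hs ! j)) * K (hs ! j) (ks ! \<sigma> j) h0) =
      (\<Prod>j<r. (?I * ?U) ^ (hs ! j) * (vertex_fps (hs ! j) (ks ! \<sigma> j) oo h0))"
    by (simp only: prod.distrib[symmetric] power_mult_distrib mult_ac)
  then have v: "(\<Prod>j<r. ?I ^ hs ! j) * (\<Prod>j<r. (-1) ^ (hs ! j) * of_nat (fact (hs ! j)) * K (hs ! j) (ks ! \<sigma> j) h0) =
      (\<Prod>j<r. vertex_fps (hs ! j) (ks ! \<sigma> j) oo h0)"
    by (simp add: U)
  show ?thesis
    unfolding summand_def Let_def r(1)[symmetric] h0_def[symmetric] e v[symmetric]
    by (simp only: mult.assoc)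
qed

lemma fps_X_power_dvd_summand:
  assumes "r = length ks" "length hs = r" "F \<in> H hs" "\<forall>j<r. 0 < ks ! \<sigma> j"
  shows "fps_X ^ sum_list hs dvd summand ks \<sigma> Y hs F"
  unfolding summand_eq[where Y = Y and \<sigma> = \<sigma>, OF assms]
  by (intro dvd_mult2 dvd_mult fps_X_power_dvd_edge_factor assms) (simp_all add: h_series_nth_0)

text \<open>The cutoff \<open>2 * n\<close> leaves room for orders up to \<open>n\<close> and
  degrees up to \<open>n\<close>, as \<open>vertex_trunc_nth\<close> asks for
  \<open>h + m <= L\<close>. If some \<open>hs ! j\<close> exceeds \<open>n\<close>, both terms
  vanish to an order above \<open>n\<close>.\<close>

lemma card_visit_tuples_summand:
  fixes Y :: "(int ^ ('d::finite)) list"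
  assumes r: "r = length ks" "0 < r" and Y: "length Y = r" "distinct Y" and n: "0 < n"
    and k: "\<forall>j<r. 0 < ks ! \<sigma> j"
  shows "of_nat (card (visit_tuples n r ((!) Y) (\<lambda>j. ks ! \<sigma> j))) = of_nat n *
    (\<Sum>hs\<in>bounded_lists r (2 * n). \<Sum>F\<in>H hs. fps_nth (summand ks \<sigma> Y hs F) n)"
proof -
  define x where "x = (\<lambda>a b. h_series (Y ! b - Y ! a))"
  have inj: "inj_on ((!) Y) {..<r}" using Y by (auto intro: inj_on_nth)
  have xd: "x j j = h_series (0 :: int ^ 'd)" for j by (simp add: x_def)
  have "fps_nth (of_int (cof hs F) * edge_factor r x F *
       (\<Prod>j<r. vertex_trunc (2 * n) (hs ! j) (ks ! \<sigma> j) (x j j))) n = fps_nth (summand ks \<sigma> Y hs F) n"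
    if hs: "hs \<in> bounded_lists r (2 * n)" and F: "F \<in> H hs" for hs F
  proof -
    have len: "length hs = r" using hs by (simp add: bounded_lists_def)
    note S = summand_eq[where Y = Y and \<sigma> = \<sigma>, OF r(1) len F k]
    show ?thesis
    proof (cases "\<forall>j<r. hs ! j \<le> n")
      case True
      show ?thesis
        unfolding S x_def[symmetric] xd
        by (rule fps_mult_agree[of n], simp, rule fps_prod_agree[of _ n])
           (use True in \<open>auto simp: h_series_nth_0 intro!: vertex_trunc_nth\<close>)
    next
      case False
      then obtain j where j: "j < r" "n < hs ! j" by auto
      then have "n < sum_list hs"
        using len member_le_sum_list[of "hs ! j" hs] by auto
      moreover have "fps_X ^ sum_list hs dvd edge_factor r x F"
        by (rule fps_X_power_dvd_edge_factor[OF _ F len]) (simp add: x_def h_series_nth_0)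
      then have "fps_X ^ sum_list hs dvd of_int (cof hs F) * edge_factor r x F *
         (\<Prod>j<r. vertex_trunc (2 * n) (hs ! j) (ks ! \<sigma> j) (x j j))"
        by (intro dvd_mult2 dvd_mult)
      moreover have "fps_X ^ sum_list hs dvd summand ks \<sigma> Y hs F"
        by (rule fps_X_power_dvd_summand[OF r(1) len F k])
      ultimately show ?thesis by (simp add: fps_X_power_dvd_nth)
    qed
  qed
  then show ?thesis
    using card_visit_tuples_edges[where Y = "(!) Y" and k = "\<lambda>j. ks ! \<sigma> j" and L = "2 * n", OF inj r(2) n] k
    by (simp add: x_def)
qed

subsection \<open>Distributions of visit numbers\<close>

text \<open>From each level set of \<open>v\<close> a subset of the prescribed size is chosen
  independently, which is the product of binomials in \<open>P\<close>.\<close>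

lemma card_sets_with_values:
  fixes v :: "'a \<Rightarrow> nat"
  assumes fin: "\<And>k. k \<in> set ks \<Longrightarrow> finite {q. v q = k}"
  shows "card {T. T \<subseteq> {q. v q \<in> set ks} \<and> image_mset v (mset_set T) = mset ks} =
    P (\<lambda>k. card {q. v q = k}) ks"
proof -
  let ?X = "{q. v q \<in> set ks}"
  let ?T = "{T. T \<subseteq> ?X \<and> image_mset v (mset_set T) = mset ks}"
  let ?A = "\<lambda>k. {A. A \<subseteq> {q. v q = k} \<and> card A = count_list ks k}"
  let ?f = "\<lambda>T. restrict (\<lambda>k. {q\<in>T. v q = k}) (set ks)"
  have "?X = (\<Union>k\<in>set ks. {q. v q = k})" by auto
  then have X: "finite ?X" using fin by simp
  have T: "T \<in> ?T \<longleftrightarrow> T \<subseteq> ?X \<and> (\<forall>k\<in>set ks. card {q\<in>T. v q = k} = count_list ks k)" for T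
  proof (cases "T \<subseteq> ?X")
    case True
    then have fT: "finite T" using X finite_subset by blast
    have c: "count (image_mset v (mset_set T)) k = card {q\<in>T. v q = k}" for k
    proof -
      have "v -` {k} \<inter> T = {q\<in>T. v q = k}" by auto
      then show ?thesis using fT by (simp add: count_image_mset)
    qed
    have "{q\<in>T. v q = k} = {}" "count_list ks k = 0" if "k \<notin> set ks" for k
      using that True by (auto simp: count_list_0_iff)
    then have "(\<forall>k. card {q\<in>T. v q = k} = count_list ks k) \<longleftrightarrow>
        (\<forall>k\<in>set ks. card {q\<in>T. v q = k} = count_list ks k)"
      by (metis card.empty)
    then show ?thesis using True by (simp add: multiset_eq_iff c count_mset)
  qed simp
  have "bij_betw ?f ?T (Pi\<^sub>E (set ks) ?A)"
  proof (rule bij_betw_byWitness[of _ "\<lambda>g. \<Union>k\<in>set ks. g k"])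
    show "\<forall>T\<in>?T. (\<Union>k\<in>set ks. ?f T k) = T" by auto
    show "\<forall>g\<in>Pi\<^sub>E (set ks) ?A. ?f (\<Union>k\<in>set ks. g k) = g"
      by (intro ballI ext) (auto simp: PiE_iff extensional_def restrict_def)
    show "?f ` ?T \<subseteq> Pi\<^sub>E (set ks) ?A" using T by auto
    show "(\<lambda>g. \<Union>k\<in>set ks. g k) ` Pi\<^sub>E (set ks) ?A \<subseteq> ?T"
    proof
      fix T assume "T \<in> (\<lambda>g. \<Union>k\<in>set ks. g k) ` Pi\<^sub>E (set ks) ?A"
      then obtain g where g: "g \<in> Pi\<^sub>E (set ks) ?A" "T = (\<Union>k\<in>set ks. g k)" by blast
      then have "{q\<in>T. v q = k} = g k" if "k \<in> set ks" for k
        using that by (auto simp: PiE_iff)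
      then show "T \<in> ?T" unfolding T using g by (auto simp: PiE_iff)
    qed
  qed
  then have "card ?T = card (Pi\<^sub>E (set ks) ?A)" by (rule bij_betw_same_card)
  also have "\<dots> = (\<Prod>k\<in>set ks. card (?A k))" by (simp add: card_PiE)
  also have "\<dots> = (\<Prod>k\<in>set ks. card {q. v q = k} choose count_list ks k)"
    using fin by (intro prod.cong refl n_subsets)
  finally show ?thesis by (simp add: P_def)
qed

text \<open>Each set counted by \<open>P\<close> has \<open>fact (length ks)\<close> orderings;
  sorted by their sequences of values, these lists run through the distinct rearrangements of
  \<open>ks\<close>.\<close>

lemma fact_mult_P:
  fixes v :: "'a \<Rightarrow> nat"
  assumes fin: "\<And>k. k \<in> set ks \<Longrightarrow> finite {q. v q = k}"
  shows "fact (length ks) * P (\<lambda>k. card {q. v q = k}) ks =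
    (\<Sum>\<kappa>\<in>permutations_of_multiset (mset ks). card {Y. distinct Y \<and> map v Y = \<kappa>})"
proof -
  let ?X = "{q. v q \<in> set ks}"
  let ?T = "{T. T \<subseteq> ?X \<and> image_mset v (mset_set T) = mset ks}"
  let ?Y = "\<lambda>\<kappa>. {Y. distinct Y \<and> map v Y = \<kappa>}"
  let ?M = "permutations_of_multiset (mset ks)"
  have "?X = (\<Union>k\<in>set ks. {q. v q = k})" by auto
  then have X: "finite ?X" using fin by simp
  have fT: "finite T" if "T \<in> ?T" for T using that X finite_subset by blast
  have finY: "finite (?Y \<kappa>)" if "\<kappa> \<in> ?M" for \<kappa>
  proof (rule finite_subset)
    have \<kappa>: "set \<kappa> = set ks" using that by (metis permutations_of_multisetD set_mset_mset)
    show "?Y \<kappa> \<subseteq> {Y. set Y \<subseteq> ?X \<and> length Y = length \<kappa>}"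
    proof
      fix Y assume "Y \<in> ?Y \<kappa>"
      then have "map v Y = \<kappa>" by simp
      then have "length Y = length \<kappa>" "v ` set Y = set ks"
        using \<kappa> by (metis length_map, metis set_map)
      then show "Y \<in> {Y. set Y \<subseteq> ?X \<and> length Y = length \<kappa>}" by blast
    qed
    show "finite {Y. set Y \<subseteq> ?X \<and> length Y = length \<kappa>}"
      by (rule finite_lists_length_eq[OF X])
  qed
  have "(\<Sum>\<kappa>\<in>?M. card (?Y \<kappa>)) = card (\<Union>\<kappa>\<in>?M. ?Y \<kappa>)"
    using finY by (intro card_UN_disjoint[symmetric]) auto
  also have "(\<Union>\<kappa>\<in>?M. ?Y \<kappa>) = (\<Union>T\<in>?T. permutations_of_set T)"
  proof (intro equalityI subsetI)
    fix Y assume "Y \<in> (\<Union>\<kappa>\<in>?M. ?Y \<kappa>)"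
    then have Y: "distinct Y" "mset (map v Y) = mset ks" by (auto simp: permutations_of_multiset_def)
    then have "image_mset v (mset_set (set Y)) = mset ks" by (simp add: mset_set_set)
    moreover have "set Y \<subseteq> ?X"
      using Y(2) by (metis (mono_tags) image_eqI mem_Collect_eq set_map set_mset_mset subsetI)
    ultimately show "Y \<in> (\<Union>T\<in>?T. permutations_of_set T)"
      using Y(1) by (auto simp: permutations_of_set_def)
  next
    fix Y assume "Y \<in> (\<Union>T\<in>?T. permutations_of_set T)"
    then obtain T where "T \<in> ?T" "set Y = T" "distinct Y" by (auto simp: permutations_of_set_def)
    then show "Y \<in> (\<Union>\<kappa>\<in>?M. ?Y \<kappa>)"
      by (auto simp: permutations_of_multiset_def mset_set_set)
  qed
  also have "card \<dots> = (\<Sum>T\<in>?T. card (permutations_of_set T))"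
    using X by (intro card_UN_disjoint) (auto dest: permutations_of_setD)
  also have "\<dots> = (\<Sum>T\<in>?T. fact (length ks))"
  proof (rule sum.cong)
    fix T assume T: "T \<in> ?T"
    then have "size (image_mset v (mset_set T)) = length ks" by simp
    then have "card T = length ks" using fT[OF T] by simp
    then show "card (permutations_of_set T) = fact (length ks)" using fT[OF T] by simp
  qed simp
  also have "\<dots> = fact (length ks) * P (\<lambda>k. card {q. v q = k}) ks"
    using card_sets_with_values[OF fin] by simp
  finally show ?thesis by simp
qed

section \<open>Permutation classes as rearrangements\<close>

lemma perm_rel_equiv: "equiv {\<sigma>. \<sigma> permutes {..<length ks}} (perm_rel ks)"
  by (rule equivI) (auto simp: perm_rel_def refl_on_def sym_def trans_def)

lemma rep_in:
  assumes "C \<in> D ks"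
  shows "rep C \<in> C" "rep C permutes {..<length ks}"
proof -
  have "C \<noteq> {}" "C \<subseteq> {\<sigma>. \<sigma> permutes {..<length ks}}"
    using assms in_quotient_imp_non_empty[OF perm_rel_equiv] in_quotient_imp_subset[OF perm_rel_equiv]
    by (auto simp: D_def)
  then show "rep C \<in> C" unfolding rep_def by (metis ex_in_conv someI_ex)
  then show "rep C permutes {..<length ks}" using \<open>C \<subseteq> _\<close> by auto
qed

text \<open>Equivalent permutations are those that rearrange \<open>ks\<close> in the same way, so
  \<open>D ks\<close> can index the sum over \<open>\<kappa>\<close> in
  \<open>fact_mult_P\<close>.\<close>

lemma bij_betw_D_permutations:
  "bij_betw (\<lambda>C. map (\<lambda>j. ks ! rep C j) [0..<length ks]) (D ks) (permutations_of_multiset (mset ks))"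
proof -
  let ?S = "{\<sigma>. \<sigma> permutes {..<length ks}}"
  let ?f = "\<lambda>C. map (\<lambda>j. ks ! rep C j) [0..<length ks]"
  have f: "?f C = permute_list (rep C) ks" for C by (simp add: permute_list_def)
  have "inj_on ?f (D ks)"
  proof (rule inj_onI)
    fix C C' assume C: "C \<in> D ks" "C' \<in> D ks" and e: "?f C = ?f C'"
    have "(rep C, rep C') \<in> perm_rel ks"
      using e rep_in[OF C(1)] rep_in[OF C(2)] by (auto simp: perm_rel_def)
    then show "C = C'"
      using quotient_eqI[OF perm_rel_equiv _ _ rep_in(1)[OF C(1)] rep_in(1)[OF C(2)]] C
      by (simp add: D_def)
  qed
  moreover have "?f ` D ks = permutations_of_multiset (mset ks)"
  proof (intro equalityI subsetI)
    fix \<kappa> assume "\<kappa> \<in> ?f ` D ks"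
    then show "\<kappa> \<in> permutations_of_multiset (mset ks)"
      using rep_in by (auto simp: f permutations_of_multiset_def)
  next
    fix \<kappa> assume "\<kappa> \<in> permutations_of_multiset (mset ks)"
    then obtain \<sigma> where \<sigma>: "\<sigma> permutes {..<length ks}" "permute_list \<sigma> ks = \<kappa>"
      by (metis mset_eq_permutation permutations_of_multisetD)
    let ?C = "perm_rel ks `` {\<sigma>}"
    have C: "?C \<in> D ks" using \<sigma> by (auto simp: D_def intro: quotientI)
    have "(\<sigma>, rep ?C) \<in> perm_rel ks" using rep_in(1)[OF C] by simp
    then have "?f ?C = \<kappa>"
      using \<sigma>(2) by (auto simp: perm_rel_def permute_list_def)
    then show "\<kappa> \<in> ?f ` D ks" using C by blast
  qed
  ultimately show ?thesis by (simp add: bij_betw_def)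
qed

section \<open>Multiplicities of closed walks as visit numbers\<close>

lemma walk_point_eq: "i \<le> length ss \<Longrightarrow> walk_point (p, ss) i = p + displacement (take i ss)"
  by (simp add: walk_point_def sum_list_sum_nth atLeast0LessThan)

lemma closed_walk_iff: "closed_walk (p, ss) \<longleftrightarrow> displacement ss = 0"
  by (simp add: closed_walk_def walk_length_def walk_point_eq)

lemma mu_eq:
  assumes "displacement ss = 0" "ss \<noteq> []"
  shows "mu q (p, ss) = 2 * count_list (sites p ss) q"
proof -
  let ?n = "length ss"
  have n: "0 < ?n" using assms by simp
  have s: "sites p ss ! i = walk_point (p, ss) i" if "i < ?n" for i
    using that by (simp add: sites_nth walk_point_eq)
  have "count_list (sites p ss) q = (\<Sum>i\<in>{0..<?n}. of_bool (q = walk_point (p, ss) i))"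
    unfolding count_list_conv_sum by (intro sum.cong) (auto simp: s)
  also have "{0..<?n} = insert 0 {1..<?n}" using n by auto
  also have "(\<Sum>i\<in>\<dots>. of_bool (q = walk_point (p, ss) i)) =
      of_bool (q = walk_point (p, ss) 0) + (\<Sum>i\<in>{1..<?n}. of_bool (q = walk_point (p, ss) i) :: nat)"
    by (rule sum.insert) auto
  also have "walk_point (p, ss) 0 = p" by (simp add: walk_point_def)
  finally show ?thesis
    using assms by (simp add: mu_def walk_length_def walk_point_eq)
qed

lemma N2_eq:
  assumes "displacement ss = 0" "ss \<noteq> []"
  shows "N2 k (p, ss) = card {q. count_list (sites p ss) q = k}"
  unfolding N2_def mu_eq[OF assms] by simp

lemma sites_translate: "sites (p + t) ss = map (\<lambda>q. q + t) (sites p ss)"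
proof (induction ss arbitrary: p)
  case (Cons s ss)
  show ?case using Cons[of "p + step_vec s"] by (simp add: add_ac)
qed simp

subsection \<open>The moment formula\<close>

text \<open>A walk rooted at 0 and a tuple \<open>Y\<close> are translated together by
  \<open>- Y ! 0\<close>; the new starting point of the walk remembers the shift. The finite set
  \<open>JB\<close> stands in for \<open>J r\<close>, which may be infinite.\<close>

lemma sum_card_translates:
  fixes \<kappa> :: "nat list"
  assumes r: "length \<kappa> = r" "0 < r" and pos: "\<forall>k\<in>set \<kappa>. 0 < k"
    and J: "finite JB" "JB \<subseteq> (J r :: (int ^ ('d::finite)) list set)"
    and out: "\<And>Y. Y \<in> J r - JB \<Longrightarrow> visit_tuples n r ((!) Y) ((!) \<kappa>) = {}"
  shows "(\<Sum>ss | length ss = n \<and> displacement ss = (0 :: int ^ 'd).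
      card {Y. distinct Y \<and> map (count_list (sites 0 ss)) Y = \<kappa>}) =
    (\<Sum>Y\<in>JB. card (visit_tuples n r ((!) Y) ((!) \<kappa>)))"
proof -
  let ?L = "{ss :: 'd step list. length ss = n \<and> displacement ss = 0}"
  let ?Y = "\<lambda>ss. {Y. distinct Y \<and> map (count_list (sites 0 ss)) Y = \<kappa>}"
  let ?V = "\<lambda>Y. visit_tuples n r ((!) Y) ((!) \<kappa>)"
  have k0: "0 < \<kappa> ! 0" using r pos by (metis nth_mem)
  have finV: "finite (?V Y)" for Y
    by (rule finite_subset[OF visit_tuples_subset[where k = "(!) \<kappa>", OF r(2) k0] finite_closed_visiting])
  have finY: "finite (?Y ss)" for ss :: "'d step list"
  proof (rule finite_subset)
    show "?Y ss \<subseteq> {Y. set Y \<subseteq> set (sites 0 ss) \<and> length Y = r}"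
    proof
      fix Y assume "Y \<in> ?Y ss"
      then have m: "map (count_list (sites 0 ss)) Y = \<kappa>" by simp
      have "y \<in> set (sites 0 ss)" if "y \<in> set Y" for y
      proof -
        have "count_list (sites 0 ss) y \<in> set \<kappa>" using m that by auto
        then have "count_list (sites 0 ss) y \<noteq> 0" using pos by force
        then show ?thesis by (simp add: count_list_0_iff)
      qed
      moreover have "length Y = r" using m r by auto
      ultimately show "Y \<in> {Y. set Y \<subseteq> set (sites 0 ss) \<and> length Y = r}" by blast
    qed
  qed (rule finite_lists_length_eq, simp)
  have count: "count_list (map (\<lambda>q. q + t) xs) (y + t) = count_list xs y" for xs and t y :: "int ^ 'd"
    by (induction xs) auto
  have "(\<Sum>ss\<in>?L. card (?Y ss)) = card (Sigma ?L ?Y)"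
    using finY by (intro card_SigmaI[symmetric]) auto
  also have "\<dots> = card (Sigma JB ?V)"
  proof (rule bij_betw_same_card)
    let ?f = "\<lambda>(ss, Y). (map (\<lambda>y. y - Y ! 0) Y, (- (Y ! 0), ss)) :: (int ^ 'd) list \<times> 'd walk"
    let ?g = "\<lambda>(Y, (p, ss)). (ss, map (\<lambda>y. y - p) Y) :: 'd step list \<times> (int ^ 'd) list"
    show "bij_betw ?f (Sigma ?L ?Y) (Sigma JB ?V)"
    proof (rule bij_betw_byWitness[of _ ?g])
      show "\<forall>t\<in>Sigma ?L ?Y. ?g (?f t) = t" by (auto simp: comp_def)
      show "\<forall>t\<in>Sigma JB ?V. ?f (?g t) = t"
      proof
        fix t assume t: "t \<in> Sigma JB ?V"
        then obtain Y p ss where e: "t = (Y, (p, ss))" by (metis prod.exhaust)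
        then have "Y \<in> J r" using t J by auto
        then have "length Y = r" "Y ! 0 = 0" by (auto simp: J_def)
        then show "?f (?g t) = t" using r by (simp add: e comp_def)
      qed
      show "?f ` Sigma ?L ?Y \<subseteq> Sigma JB ?V"
      proof
        fix t assume "t \<in> ?f ` Sigma ?L ?Y"
        then obtain ss Y where t: "t = ?f (ss, Y)" and ss: "length ss = n" "displacement ss = 0"
          and Y: "distinct Y" "map (count_list (sites 0 ss)) Y = \<kappa>" by auto
        let ?Z = "map (\<lambda>y. y - Y ! 0) Y"
        have len: "length Y = r" using Y r by auto
        have ZJ: "?Z \<in> J r" using Y len r by (auto simp: J_def distinct_map inj_on_def)
        have "count_list (sites (- (Y ! 0)) ss) (?Z ! j) = \<kappa> ! j" if "j < r" for j
        proof -
          have "count_list (sites (0 + - (Y ! 0)) ss) (Y ! j + - (Y ! 0)) = count_list (sites 0 ss) (Y ! j)"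
            unfolding sites_translate by (rule count)
          then show ?thesis using that len Y(2) by auto
        qed
        then have V: "(- (Y ! 0), ss) \<in> ?V ?Z" using ss by (simp add: visit_tuples_def)
        then have "?Z \<in> JB" using ZJ out[of ?Z] by blast
        then show "t \<in> Sigma JB ?V" using V t by auto
      qed
      show "?g ` Sigma JB ?V \<subseteq> Sigma ?L ?Y"
      proof
        fix t assume "t \<in> ?g ` Sigma JB ?V"
        then obtain Y p ss where t: "t = (ss, map (\<lambda>y. y - p) Y)" and Y: "Y \<in> JB"
          and V: "(p, ss) \<in> ?V Y" by auto
        have YJ: "distinct Y" "length Y = r" using Y J by (auto simp: J_def)
        have "count_list (sites 0 ss) (Y ! j - p) = \<kappa> ! j" if "j < r" for j
        proof -
          have "count_list (sites (0 + p) ss) ((Y ! j - p) + p) = count_list (sites 0 ss) (Y ! j - p)"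
            unfolding sites_translate by (rule count)
          then show ?thesis using V that by (simp add: visit_tuples_def)
        qed
        then have "map (count_list (sites 0 ss)) (map (\<lambda>y. y - p) Y) = \<kappa>"
          using YJ r by (intro nth_equalityI) auto
        then show "t \<in> Sigma ?L ?Y"
          using V YJ by (auto simp: t visit_tuples_def distinct_map inj_on_def)
      qed
    qed
  qed
  also have "\<dots> = (\<Sum>Y\<in>JB. card (?V Y))"
    using finV J by (intro card_SigmaI) auto
  finally show ?thesis .
qed

section \<open>Locality of the summands and convergence of the infinite sum\<close>

lemma displacement_le: "\<bar>vec_nth (displacement ss) a\<bar> \<le> int (length (ss :: ('d::finite) step list))"
proof (induction ss)
  case (Cons s ss)
  have "\<bar>vec_nth (step_vec s) a\<bar> \<le> 1" by (cases s) (auto simp: axis_def)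
  then show ?case using Cons by (auto simp: abs_le_iff)
qed simp

lemma h_series_nth_nonzero:
  fixes p :: "int ^ ('d::finite)"
  assumes "fps_nth (h_series p) m \<noteq> 0"
  shows "\<bar>vec_nth p a\<bar> \<le> int m"
proof -
  have "num_walks m p \<noteq> 0"
  proof
    assume z: "num_walks m p = 0"
    then have "m \<noteq> 0 \<or> p \<noteq> 0" by (auto simp: num_walks_0)
    then show False
      using assms z h_series_nth_0[of p] by (cases m; cases "p = 0") (auto simp: h_series_eq green_def)
  qed
  then have "{ss :: 'd step list. length ss = m \<and> displacement ss = p} \<noteq> {}"
    by (intro notI) (simp add: num_walks_def)
  then obtain ss :: "'d step list" where "length ss = m" "displacement ss = p" by blast
  then show ?thesis using displacement_le[of ss a] by simp
qed

lemma fps_X_power_dvdI: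
  assumes "\<And>m. m < N \<Longrightarrow> fps_nth (f :: complex fps) m = 0"
  shows "fps_X ^ N dvd f"
proof -
  have "f = fps_X ^ N * fps_shift N f"
    by (intro fps_ext) (auto simp: fps_X_power_mult_nth assms)
  then show ?thesis by (metis dvd_triv_left)
qed

text \<open>A walk of length at most \<open>n\<close> moves each coordinate by at most
  \<open>n\<close>, so the factor of an edge between points farther apart begins above degree
  \<open>n\<close>.\<close>

lemma summand_edge_bound:
  fixes Y :: "(int ^ ('d::finite)) list"
  assumes r: "r = length ks" "length hs = r" and F: "F \<in> H hs" and k: "\<forall>j<r. 0 < ks ! \<sigma> j"
    and nz: "fps_nth (summand ks \<sigma> Y hs F) n \<noteq> 0" and ij: "i < r" "j < r" "F $$ (i, j) \<noteq> 0"
  shows "\<bar>vec_nth (Y ! j) a - vec_nth (Y ! i) a\<bar> \<le> int n"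
proof (rule ccontr)
  let ?x = "\<lambda>a b. h_series (Y ! b - Y ! a)"
  assume far: "\<not> ?thesis"
  have "fps_X ^ Suc n dvd ?x i j"
  proof (rule fps_X_power_dvdI)
    fix m assume "m < Suc n"
    then show "fps_nth (?x i j) m = 0"
      using far h_series_nth_nonzero[of "Y ! j - Y ! i" m a] by force
  qed
  also have "\<dots> dvd fps_const (1 / fact (F $$ (i, j))) * ?x i j ^ F $$ (i, j)"
    using ij by (intro dvd_mult dvd_power) auto
  also have "\<dots> dvd (\<Prod>b<r. fps_const (1 / fact (F $$ (i, b))) * ?x i b ^ F $$ (i, b))"
    using ij by (intro dvd_prodI) auto
  also have "\<dots> dvd edge_factor r ?x F"
    unfolding edge_factor_def
    using ij by (intro dvd_prodI[where f = "\<lambda>a. \<Prod>b<r. fps_const (1 / fact (F $$ (a, b))) * ?x a b ^ F $$ (a, b)"]) auto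
  also have "\<dots> dvd summand ks \<sigma> Y hs F"
    unfolding summand_eq[where Y = Y and \<sigma> = \<sigma>, OF r F k] by simp
  finally show False using nz fps_X_power_dvd_nth by blast
qed

text \<open>A nonzero cofactor forces every vertex to be connected to vertex 0. A path there has at
  most \<open>r * r\<close> edges, each spanning at most \<open>n\<close>, whence the bound
  \<open>r * r * n\<close>. For \<open>r\<close> other than 1 the same argument makes all entries of
  \<open>hs\<close> positive.\<close>

lemma summand_support:
  fixes Y :: "(int ^ ('d::finite)) list"
  assumes r: "r = length ks" "0 < r" "length hs = r" and F: "F \<in> H hs" and k: "\<forall>j<r. 0 < ks ! \<sigma> j"
    and Y: "Y \<in> J r" and nz: "fps_nth (summand ks \<sigma> Y hs F) n \<noteq> 0"
  shows "sum_list hs \<le> n" and "hs \<in> orders r"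
    and "\<And>j a. j < r \<Longrightarrow> \<bar>vec_nth (Y ! j) a\<bar> \<le> int (r * r * n)"
proof -
  have cof: "cof hs F \<noteq> 0" using nz by (auto simp: summand_def Let_def)
  show "sum_list hs \<le> n"
    using nz fps_X_power_dvd_nth[OF fps_X_power_dvd_summand[OF r(1,3) F k], of n Y] by force
  have F0: "F $$ (j, j) = 0" if "j < r" for j using F r that by (auto simp: H_def)
  have row: "(\<Sum>i<r. F $$ (j, i)) = hs ! j" and col: "(\<Sum>i<r. F $$ (i, j)) = hs ! j" if "j < r" for j
    using F r that by (auto simp: H_def)
  show "hs \<in> orders r"
  proof (cases "r = 1")
    case True
    then have "hs ! 0 = 0" using row[of 0] F0[of 0] by simp
    then have "hs = [0]" using True r(3) by (cases hs) auto
    then show ?thesis using True by (simp add: orders_def)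
  next
    case False
    have "0 < hs ! j" if j: "j < r" for j
    proof (rule ccontr)
      assume "\<not> 0 < hs ! j"
      then have z: "F $$ (i, j) = 0" "F $$ (j, i) = 0" if "i < r" for i
        using row[OF j] col[OF j] that by auto
      \<comment> \<open>\<open>cof_eq_0\<close> asks for a set that avoids vertex 0: the isolated
        vertex itself, or its complement if vertex 0 is the isolated one.\<close>
      define S where "S = (if j = 0 then {1..<r} else {j})"
      have S: "S \<subseteq> {1..<r}" "S \<noteq> {}" using j False r(2) by (auto simp: S_def)
      have "cof hs F = 0"
        by (rule cof_eq_0[OF F, of S]) (use S r z j in \<open>auto simp: S_def not_le split: if_splits\<close>)
      then show False using cof by simp
    qed
    then have "\<forall>h\<in>set hs. 1 \<le> h" using r by (fastforce simp: in_set_conv_nth)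
    then show ?thesis using False r by (simp add: orders_def)
  qed
  define E where "E = {(i, j). i < r \<and> j < r \<and> (F $$ (i, j) \<noteq> 0 \<or> F $$ (j, i) \<noteq> 0)}"
  have Esub: "E \<subseteq> {..<r} \<times> {..<r}" by (auto simp: E_def)
  then have finE: "finite E" by (rule finite_subset) simp
  have cardE: "card E \<le> r * r" using card_mono[OF _ Esub] by simp
  define S where "S = {j. j < r \<and> (j, 0) \<notin> E\<^sup>*}"
  have "S = {}"
  proof (rule ccontr)
    assume "S \<noteq> {}"
    moreover have "S \<subseteq> {1..<length hs}" using r by (auto simp: S_def not_less_eq_eq intro!: Suc_leI gr0I)
    moreover have "F $$ (i, j) = 0 \<and> F $$ (j, i) = 0" if "i \<in> S" "j < r" "j \<notin> S" for i j
    proof (rule ccontr)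
      assume "\<not> ?thesis"
      then have "(i, j) \<in> E" using that by (auto simp: E_def S_def)
      moreover have "(j, 0) \<in> E\<^sup>*" using that by (auto simp: S_def)
      ultimately have "(i, 0) \<in> E\<^sup>*" by (rule converse_rtrancl_into_rtrancl)
      then show False using that by (auto simp: S_def)
    qed
    ultimately have "cof hs F = 0" using r by (intro cof_eq_0[OF F, of S]) auto
    then show False using cof by simp
  qed
  have edge: "\<bar>vec_nth (Y ! i) a - vec_nth (Y ! j) a\<bar> \<le> int n" if "(i, j) \<in> E" for i j a
    using that summand_edge_bound[OF r(1,3) F k nz, of i j a] summand_edge_bound[OF r(1,3) F k nz, of j i a]
    by (auto simp: E_def abs_minus_commute)
  have walk: "\<bar>vec_nth (Y ! j) a\<bar> \<le> int (m * n)" if "(j, 0) \<in> E ^^ m" for j m a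
    using that
  proof (induction m arbitrary: j)
    case 0
    then show ?case using Y by (simp add: J_def)
  next
    case (Suc m)
    then obtain i where i: "(j, i) \<in> E" "(i, 0) \<in> E ^^ m" by (meson relpow_Suc_E2)
    show ?case using Suc.IH[OF i(2)] edge[OF i(1), of a] by (simp add: algebra_simps)
  qed
  show "\<bar>vec_nth (Y ! j) a\<bar> \<le> int (r * r * n)" if j: "j < r" for j a
  proof -
    have "(j, 0) \<in> E\<^sup>*" using j \<open>S = {}\<close> by (auto simp: S_def)
    then obtain m where m: "m \<le> card E" "(j, 0) \<in> E ^^ m"
      using rtrancl_finite_eq_relpow[OF finE] by auto
    have "m * n \<le> r * r * n" using m(1) cardE by (intro mult_right_mono) auto
    then show ?thesis using walk[OF m(2), of a] by linarith
  qed
qed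

definition bounded_tuples :: "nat \<Rightarrow> nat \<Rightarrow> (int ^ ('d::finite)) list set" where
  "bounded_tuples r M = {Y \<in> J r. \<forall>j<r. \<forall>a. \<bar>vec_nth (Y ! j) a\<bar> \<le> int M}"

lemma finite_bounded_tuples: "finite (bounded_tuples r M :: (int ^ ('d::finite)) list set)"
proof (rule finite_subset)
  let ?B = "vec_lambda ` ((UNIV :: 'd set) \<rightarrow>\<^sub>E {- int M..int M})"
  show "bounded_tuples r M \<subseteq> {Y. set Y \<subseteq> ?B \<and> length Y = r}"
  proof
    fix Y :: "(int ^ 'd) list" assume Y: "Y \<in> bounded_tuples r M"
    have "y \<in> ?B" if "y \<in> set Y" for y
    proof -
      have "vec_nth y \<in> UNIV \<rightarrow>\<^sub>E {- int M..int M}"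
        using Y that by (auto simp: bounded_tuples_def J_def in_set_conv_nth abs_le_iff minus_le_iff)
      then have "vec_lambda (vec_nth y) \<in> ?B" by (rule imageI)
      then show ?thesis by simp
    qed
    then show "Y \<in> {Y. set Y \<subseteq> ?B \<and> length Y = r}" using Y by (auto simp: bounded_tuples_def J_def)
  qed
  show "finite {Y. set Y \<subseteq> ?B \<and> length Y = r}"
    by (intro finite_lists_length_eq finite_imageI finite_PiE) auto
qed

text \<open>Convergence in \<open>fps\<close> means that each coefficient is eventually constant
  along the finite subsets; for coefficient \<open>n\<close> this holds from \<open>B n\<close>
  on.\<close>

lemma has_sum_fps:
  fixes f :: "'b \<Rightarrow> complex fps"
  assumes "\<And>n. finite (B n)" "\<And>n. B n \<subseteq> A"
    and "\<And>n i. i \<in> A - B n \<Longrightarrow> fps_nth (f i) n = 0"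
  shows "(f has_sum Abs_fps (\<lambda>n. \<Sum>i\<in>B n. fps_nth (f i) n)) A"
  unfolding has_sum_def tendsto_fps_iff
proof
  fix n
  show "\<forall>\<^sub>F T in finite_subsets_at_top A. fps_nth (sum f T) n =
      fps_nth (Abs_fps (\<lambda>n. \<Sum>i\<in>B n. fps_nth (f i) n)) n"
    unfolding eventually_finite_subsets_at_top
  proof (intro exI[of _ "B n"] conjI allI impI)
    fix T assume "finite T \<and> B n \<subseteq> T \<and> T \<subseteq> A"
    then show "fps_nth (sum f T) n = fps_nth (Abs_fps (\<lambda>n. \<Sum>i\<in>B n. fps_nth (f i) n)) n"
      using assms(3)[of _ n] by (auto simp: fps_sum_nth intro!: sum.mono_neutral_right)
  qed (use assms in auto)
qed

theorem theorem2p3: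
  fixes ks :: "nat list" and r N :: nat
  assumes r: "r = length ks" "1 \<le> r"
    and pos: "\<forall>k\<in>set ks. 0 < k"
  shows "(\<forall>C\<in>D ks. (\<lambda>(Y :: (int ^ 'd::finite) list, hs). \<Sum>F\<in>H hs. summand ks (rep C) Y hs F)
            summable_on (J r \<times> orders r)) \<and>
         (\<Sum>w\<in>(closed_walks_upto (2 * N) :: 'd walk set).
            of_nat (P (\<lambda>k. N2 k w) ks) * fps_X ^ walk_length w) =
         fps_const (1 / fact r) * fps_X * fps_deriv
           (trunc (2 * N)
             (\<Sum>C\<in>D ks. \<Sum>\<^sub>\<infinity>(Y :: (int ^ 'd) list, hs)\<in>J r \<times> orders r.
                \<Sum>F\<in>H hs. summand ks (rep C) Y hs F))"
proof -
  have r0: "0 < r" using r(2) by linarith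
  define f where "f C = (\<lambda>(Y :: (int ^ 'd) list, hs). \<Sum>F\<in>H hs. summand ks (rep C) Y hs F)" for C
  define JB where "JB n = (bounded_tuples r (r * r * n) :: (int ^ 'd) list set)" for n
  have JB: "finite (JB n)" "JB n \<subseteq> J r" for n
    unfolding JB_def by (rule finite_bounded_tuples) (auto simp: bounded_tuples_def)
  define OB where "OB n = bounded_lists r (2 * n) \<inter> orders r" for n
  have len: "length hs = r" if "hs \<in> orders r" for hs using that by (auto simp: orders_def split: if_splits)
  have kpos: "\<forall>j<r. 0 < ks ! rep C j" if "C \<in> D ks" for C
    using rep_in(2)[OF that] pos r permutes_in_image by (metis lessThan_iff nth_mem)
  have supp: "hs \<in> OB n \<and> Y \<in> JB n"
    if "C \<in> D ks" "length hs = r" "F \<in> H hs" "Y \<in> J r" "fps_nth (summand ks (rep C) Y hs F) n \<noteq> 0"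
    for C hs F n and Y :: "(int ^ 'd) list"
  proof -
    note S = summand_support[OF r(1) r0 that(2,3) kpos[OF that(1)] that(4,5)]
    have "hs ! j \<le> 2 * n" if "j < r" for j
      using S(1) member_le_sum_list[of "hs ! j" hs] that \<open>length hs = r\<close> by fastforce
    then show ?thesis
      using S that by (auto simp: OB_def JB_def bounded_lists_def bounded_tuples_def)
  qed
  have hassum: "(f C has_sum Abs_fps (\<lambda>n. \<Sum>i\<in>JB n \<times> OB n. fps_nth (f C i) n)) (J r \<times> orders r)"
    if C: "C \<in> D ks" for C
  proof (rule has_sum_fps)
    fix n
    show "finite (JB n \<times> OB n)"
      by (simp add: JB_def OB_def finite_bounded_tuples finite_bounded_lists)
    show "JB n \<times> OB n \<subseteq> J r \<times> orders r"
      by (auto simp: JB_def OB_def bounded_tuples_def)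
    fix i assume i: "i \<in> J r \<times> orders r - JB n \<times> OB n"
    obtain Y hs where e: "i = (Y, hs)" by (cases i)
    have "fps_nth (summand ks (rep C) Y hs F) n = 0" if "F \<in> H hs" for F
      using supp[OF C len that, of Y n] i e by blast
    then show "fps_nth (f C i) n = 0" by (simp add: f_def e fps_sum_nth)
  qed
  have inf: "fps_nth (\<Sum>\<^sub>\<infinity>i\<in>J r \<times> orders r. f C i) n =
      (\<Sum>Y\<in>JB n. \<Sum>hs\<in>bounded_lists r (2 * n). \<Sum>F\<in>H hs. fps_nth (summand ks (rep C) Y hs F) n)"
    if C: "C \<in> D ks" for C n
  proof -
    have "fps_nth (\<Sum>\<^sub>\<infinity>i\<in>J r \<times> orders r. f C i) n = (\<Sum>i\<in>JB n \<times> OB n. fps_nth (f C i) n)"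
      using infsumI[OF hassum[OF C]] by simp
    also have "\<dots> = (\<Sum>Y\<in>JB n. \<Sum>hs\<in>OB n. \<Sum>F\<in>H hs. fps_nth (summand ks (rep C) Y hs F) n)"
      by (simp add: sum.cartesian_product f_def fps_sum_nth case_prod_beta)
    \<comment> \<open>Lists outside \<open>orders r\<close> contribute 0 by \<open>supp\<close>;
      adding them gives the index set of \<open>card_visit_tuples_summand\<close>.\<close>
    also have "\<dots> = (\<Sum>Y\<in>JB n. \<Sum>hs\<in>bounded_lists r (2 * n). \<Sum>F\<in>H hs. fps_nth (summand ks (rep C) Y hs F) n)"
    proof (rule sum.cong[OF refl])
      fix Y assume Y: "Y \<in> JB n"
      have "fps_nth (summand ks (rep C) Y hs F) n = 0"
        if "hs \<in> bounded_lists r (2 * n) - OB n" "F \<in> H hs" for hs F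
        using that Y supp[OF C, of hs F Y n]
        by (auto simp: JB_def bounded_tuples_def bounded_lists_def)
      then show "(\<Sum>hs\<in>OB n. \<Sum>F\<in>H hs. fps_nth (summand ks (rep C) Y hs F) n) =
          (\<Sum>hs\<in>bounded_lists r (2 * n). \<Sum>F\<in>H hs. fps_nth (summand ks (rep C) Y hs F) n)"
        by (intro sum.mono_neutral_left) (auto simp: OB_def finite_bounded_lists intro!: sum.neutral)
    qed
    finally show ?thesis .
  qed
  have key: "of_nat (fact r) * (\<Sum>ss | length ss = n \<and> displacement ss = (0 :: int ^ 'd).
      of_nat (P (\<lambda>k. N2 k (0, ss)) ks)) =
      of_nat n * (\<Sum>C\<in>D ks. fps_nth (\<Sum>\<^sub>\<infinity>i\<in>J r \<times> orders r. f C i) n)" (is "?l = _") if n: "0 < n" for n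
  proof -
    let ?L = "{ss :: 'd step list. length ss = n \<and> displacement ss = 0}"
    let ?c = "\<lambda>ss \<kappa>. card {Y. distinct Y \<and> map (count_list (sites (0 :: int ^ 'd) ss)) Y = \<kappa>}"
    let ?M = "permutations_of_multiset (mset ks)"
    let ?\<kappa> = "\<lambda>C. map (\<lambda>j. ks ! rep C j) [0..<length ks]"
    have cV: "of_nat (card (visit_tuples n r ((!) Y) ((!) (?\<kappa> C)))) = of_nat n *
        (\<Sum>hs\<in>bounded_lists r (2 * n). \<Sum>F\<in>H hs. fps_nth (summand ks (rep C) Y hs F) n)"
      if "C \<in> D ks" "Y \<in> J r" for C and Y :: "(int ^ 'd) list"
    proof -
      have "visit_tuples n r ((!) Y) ((!) (?\<kappa> C)) = visit_tuples n r ((!) Y) (\<lambda>j. ks ! rep C j)"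
        using r by (auto simp: visit_tuples_def)
      then show ?thesis
        using card_visit_tuples_summand[OF r(1) r0 _ _ n kpos[OF that(1)], of Y] that(2)
        by (simp add: J_def)
    qed
    have trans: "(\<Sum>ss\<in>?L. ?c ss (?\<kappa> C)) = (\<Sum>Y\<in>JB n. card (visit_tuples n r ((!) Y) ((!) (?\<kappa> C))))"
      if C: "C \<in> D ks" for C
    proof (rule sum_card_translates)
      show "length (?\<kappa> C) = r" using r by simp
      show "\<forall>k\<in>set (?\<kappa> C). 0 < k" using kpos[OF C] r by auto
      fix Y :: "(int ^ 'd) list" assume Y: "Y \<in> J r - JB n"
      have "(\<Sum>hs\<in>bounded_lists r (2 * n). \<Sum>F\<in>H hs. fps_nth (summand ks (rep C) Y hs F) n) = 0"
        using supp[OF C, of _ _ Y n] Y by (intro sum.neutral ballI) (auto simp: bounded_lists_def)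
      then have "card (visit_tuples n r ((!) Y) ((!) (?\<kappa> C))) = 0"
        using cV[OF C, of Y] Y by simp
      \<comment> \<open>\<open>card\<close> is 0 for infinite sets too, so finiteness is what turns
        it into emptiness.\<close>
      moreover have "finite (visit_tuples n r ((!) Y) ((!) (?\<kappa> C)))"
        using kpos[OF C] r r0
        by (intro finite_subset[OF visit_tuples_subset[of r "(!) (?\<kappa> C)"] finite_closed_visiting]) auto
      ultimately show "visit_tuples n r ((!) Y) ((!) (?\<kappa> C)) = {}" by simp
    qed (use r0 JB in auto)
    have P: "fact r * P (\<lambda>k. N2 k (0, ss)) ks = (\<Sum>\<kappa>\<in>?M. ?c ss \<kappa>)" if "ss \<in> ?L" for ss
    proof -
      have "ss \<noteq> []" "displacement ss = 0" using that n by auto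
      then have "N2 k (0, ss) = card {q. count_list (sites 0 ss) q = k}" for k by (simp add: N2_eq)
      moreover have "finite {q. count_list (sites 0 ss) q = k}" if "k \<in> set ks" for k
      proof (rule finite_subset)
        show "{q. count_list (sites 0 ss) q = k} \<subseteq> set (sites 0 ss)"
          using pos that by (metis (mono_tags) count_list_0_iff less_irrefl mem_Collect_eq subsetI)
      qed simp
      ultimately show ?thesis using fact_mult_P[of ks "count_list (sites 0 ss)"] r by simp
    qed
    have "fact r * (\<Sum>ss\<in>?L. P (\<lambda>k. N2 k (0, ss)) ks) = (\<Sum>ss\<in>?L. \<Sum>\<kappa>\<in>?M. ?c ss \<kappa>)"
      unfolding sum_distrib_left by (intro sum.cong refl P)
    also have "\<dots> = (\<Sum>\<kappa>\<in>?M. \<Sum>ss\<in>?L. ?c ss \<kappa>)" by (rule sum.swap)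
    also have "\<dots> = (\<Sum>C\<in>D ks. \<Sum>ss\<in>?L. ?c ss (?\<kappa> C))"
      by (rule sum.reindex_bij_betw[OF bij_betw_D_permutations, symmetric])
    also have "\<dots> = (\<Sum>C\<in>D ks. \<Sum>Y\<in>JB n. card (visit_tuples n r ((!) Y) ((!) (?\<kappa> C))))"
      by (intro sum.cong refl trans)
    finally have "?l = of_nat (\<Sum>C\<in>D ks. \<Sum>Y\<in>JB n. card (visit_tuples n r ((!) Y) ((!) (?\<kappa> C))))"
      by (simp only: of_nat_mult[symmetric] of_nat_sum[symmetric])
    also have "\<dots> = (\<Sum>C\<in>D ks. \<Sum>Y\<in>JB n. of_nat n *
        (\<Sum>hs\<in>bounded_lists r (2 * n). \<Sum>F\<in>H hs. fps_nth (summand ks (rep C) Y hs F) n))"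
      unfolding of_nat_sum by (intro sum.cong refl cV) (auto simp: JB_def bounded_tuples_def)
    also have "\<dots> = of_nat n * (\<Sum>C\<in>D ks. fps_nth (\<Sum>\<^sub>\<infinity>i\<in>J r \<times> orders r. f C i) n)"
      unfolding sum_distrib_left by (intro sum.cong refl) (simp only: inf sum_distrib_left)
    finally show ?thesis .
  qed
  have walks: "(closed_walks_upto (2 * N) :: 'd walk set) =
      (\<Union>n\<in>{1..2 * N}. Pair 0 ` {ss. length ss = n \<and> displacement ss = 0})"
    by (auto simp: closed_walks_upto_def closed_walk_iff walk_length_def image_iff)
  have fin: "finite (closed_walks_upto (2 * N) :: 'd walk set)" unfolding walks by auto
  have "(\<Sum>w\<in>(closed_walks_upto (2 * N) :: 'd walk set). of_nat (P (\<lambda>k. N2 k w) ks) * fps_X ^ walk_length w) =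
         fps_const (1 / fact r) * fps_X * fps_deriv
           (trunc (2 * N) (\<Sum>C\<in>D ks. \<Sum>\<^sub>\<infinity>i\<in>J r \<times> orders r. f C i))" (is "?lhs = ?rhs")
  proof (rule fps_ext)
    fix n
    let ?P = "\<lambda>w. of_nat (P (\<lambda>k. N2 k w) ks) :: complex"
    have "fps_nth ?lhs n = (\<Sum>w\<in>(closed_walks_upto (2 * N) :: 'd walk set). if walk_length w = n then ?P w else 0)"
      by (auto simp: fps_sum_nth fps_X_power_nth intro!: sum.cong)
    also have "\<dots> = (\<Sum>w\<in>{w\<in>(closed_walks_upto (2 * N) :: 'd walk set). walk_length w = n}. ?P w)"
      using fin by (intro sum.inter_filter[symmetric])
    also have "{w\<in>(closed_walks_upto (2 * N) :: 'd walk set). walk_length w = n} =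
        (if 1 \<le> n \<and> n \<le> 2 * N then Pair 0 ` {ss. length ss = n \<and> displacement ss = 0} else {})"
      by (auto simp: closed_walks_upto_def closed_walk_iff walk_length_def image_iff)
    also have "sum ?P \<dots> = (if 1 \<le> n \<and> n \<le> 2 * N then
        (\<Sum>ss | length ss = n \<and> displacement ss = (0 :: int ^ 'd). ?P (0, ss)) else 0)"
      by (auto simp: sum.reindex inj_on_def)
    also have "\<dots> = (if 1 \<le> n \<and> n \<le> 2 * N then 1 / fact r *
        (of_nat n * (\<Sum>C\<in>D ks. fps_nth (\<Sum>\<^sub>\<infinity>i\<in>J r \<times> orders r. f C i) n)) else 0)"
      using key[of n] by (auto simp: field_simps)
    \<comment> \<open>At \<open>n = 0\<close> both sides vanish, the right one by the factor
      \<open>fps_X\<close>. For \<open>n > 0\<close> the derivative supplies the factor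
      \<open>n\<close> of the moved root, and \<open>fps_X\<close> restores the degree.\<close>
    also have "\<dots> = fps_nth ?rhs n"
      by (cases n) (auto simp: trunc_def fps_sum_nth mult.assoc)
    finally show "fps_nth ?lhs n = fps_nth ?rhs n" .
  qed
  moreover have "\<forall>C\<in>D ks. f C summable_on (J r \<times> orders r)"
    using hassum by (auto simp: summable_on_def)
  ultimately show ?thesis unfolding f_def by simp
qed

end
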